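(* The rank problem for $\mathcal{C}(n)$ is NP-hard (under polynomial-time many-one, i.e. Karp, reductions): given a positive integer $q$ and a symmetric $n\times n$ rational matrix $\Gamma$ that is promised to belong to $\mathcal{C}(n)$, decide whether there exists $p\in\mathbb{R}^{2^n}$ with $p\ge 0$ such that $\|p\|_0\le q$ and $\Gamma=\sum_{0\le k\le P_n}p_k\,x_kx_k^{\top}$.
   Context: For an integer $n\ge 1$ let $P_n=2^n-1$, and for $0\le k\le P_n$ let $x_k\in\{0,1\}^n$ be the vector giving the base-2 representation of $k$ (so $x_0,\dots,x_{P_n}$ enumerate $\{0,1\}^n$). The correlation cone is $\mathcal{C}(n)=\{\sum_{0\le k\le P_n}p_kx_kx_k^{\top} : p\ge 0\}$. $\|p\|_0$ denotes the number of nonzero components of $p$. The promise that $\Gamma\in\mathcal{C}(n)$ means that every instance satisfies $\Gamma\in\mathcal{C}(n)$, but the weights of a decomposition are not part of the input; a promise problem is NP-hard if every language in NP has a polynomial-time many-one reduction to it whose outputs always satisfy the promise. *)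

theory Defs
  imports
    "HOL-Computational_Algebra.Polynomial"
    "Jordan_Normal_Form.Matrix"
begin

section \<open>Deterministic multi-tape Turing machines\<close>

text \<open>
  Tapes are infinite in both directions. States and tape symbols are natural numbers; the working
  states are the numbers below \<open>nstates M\<close>, the start state is \<open>0\<close>, and the number
  \<open>nstates M\<close> itself is the unique halting state. Symbol \<open>0\<close> is the blank, and
  symbols \<open>1\<close> and \<open>2\<close> represent the bits. Tape \<open>0\<close> is the input tape
  and tape \<open>1\<close> the output tape; both may be read and written.
\<close>

datatype move = Left | Stay | Right

fun offset :: "move \<Rightarrow> int" where
  "offset Left = -1"
| "offset Stay = 0"
| "offset Right = 1"

record tm =
  ntapes :: nat
  nsyms :: nat
  nstates :: nat
  delta :: "nat \<Rightarrow> nat list \<Rightarrow> nat \<times> (nat \<times> move) list"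

text \<open>
  Only the values of \<open>delta\<close> on the finitely many arguments quantified over here are ever
  used in a computation, so that a well-formed machine is a finite object.
\<close>

definition wf_tm :: "tm \<Rightarrow> bool" where
  "wf_tm M \<longleftrightarrow> 2 \<le> ntapes M \<and> 3 \<le> nsyms M \<and> 1 \<le> nstates M \<and>
     (\<forall>s<nstates M. \<forall>as. length as = ntapes M \<and> (\<forall>a\<in>set as. a < nsyms M) \<longrightarrow>
        fst (delta M s as) \<le> nstates M \<and>
        length (snd (delta M s as)) = ntapes M \<and>
        (\<forall>b\<in>fst ` set (snd (delta M s as)). b < nsyms M))"

type_synonym tape = "(int \<Rightarrow> nat) \<times> int"  \<comment> \<open>cell contents and head position\<close>

type_synonym config = "nat \<times> tape list"

fun read :: "tape \<Rightarrow> nat" where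
  "read (c, h) = c h"

fun act :: "nat \<times> move \<Rightarrow> tape \<Rightarrow> tape" where
  "act (a, d) (c, h) = (c(h := a), h + offset d)"

definition step :: "tm \<Rightarrow> config \<Rightarrow> config" where
  "step M = (\<lambda>(s, ts).
     if s < nstates M
     then (let (s', acts) = delta M s (map read ts) in (s', map2 act acts ts))
     else (s, ts))"

definition bit_symbol :: "bool \<Rightarrow> nat" where
  "bit_symbol b = (if b then 2 else 1)"

definition blank_tape :: tape where
  "blank_tape = ((\<lambda>_. 0), 0)"

definition input_tape :: "bool list \<Rightarrow> tape" where
  "input_tape x =
     ((\<lambda>i. if 0 \<le> i \<and> i < int (length x) then bit_symbol (x ! nat i) else 0), 0)"

definition init_config :: "tm \<Rightarrow> bool list \<Rightarrow> config" where
  "init_config M x = (0, input_tape x # replicate (ntapes M - 1) blank_tape)"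

text \<open>The string on a tape is read from cell \<open>0\<close> rightwards up to the first blank.\<close>

definition holds_string :: "tape \<Rightarrow> bool list \<Rightarrow> bool" where
  "holds_string t y \<longleftrightarrow>
     (\<forall>i<length y. fst t (int i) = bit_symbol (y ! i)) \<and> fst t (int (length y)) = 0"

definition halts_with :: "tm \<Rightarrow> bool list \<Rightarrow> nat \<Rightarrow> bool list \<Rightarrow> bool" where
  "halts_with M x t y \<longleftrightarrow>
     (case (step M ^^ t) (init_config M x) of
        (s, ts) \<Rightarrow> s = nstates M \<and> holds_string (ts ! 1) y)"

section \<open>Polynomial time, NP and NP-hardness of promise problems\<close>

definition polytime :: "(bool list \<Rightarrow> bool list) \<Rightarrow> bool" where
  "polytime f \<longleftrightarrow>
     (\<exists>M (p :: nat poly). wf_tm M \<and>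
        (\<forall>x. \<exists>t \<le> poly p (length x). halts_with M x t (f x)))"

text \<open>
  An injective pairing of strings: the bits of the first component are doubled, and \<open>01\<close>
  separates them from the second component.
\<close>

definition pair :: "bool list \<Rightarrow> bool list \<Rightarrow> bool list" where
  "pair x y = concat (map (\<lambda>b. [b, b]) x) @ [False, True] @ y"

definition NP :: "bool list set set" where
  "NP = {L. \<exists>V (p :: nat poly). polytime V \<and>
     (\<forall>x. x \<in> L \<longleftrightarrow> (\<exists>u. length u = poly p (length x) \<and> V (pair x u) = [True]))}"

text \<open>
  The promise problem with promise \<open>P\<close> and set \<open>Y\<close> of yes-instances. A Karp reduction
  to it has to map every string, whether in the language or not, into the promise.
\<close>

definition NP_hard_promise :: "bool list set \<Rightarrow> bool list set \<Rightarrow> bool" where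
  "NP_hard_promise P Y \<longleftrightarrow>
     (\<forall>L\<in>NP. \<exists>f. polytime f \<and> (\<forall>x. f x \<in> P \<and> (x \<in> L \<longleftrightarrow> f x \<in> Y)))"

section \<open>The rank problem for the correlation cone\<close>

text \<open>The base-2 representation of \<open>k < 2^n\<close>, most significant bit first.\<close>

definition binvec :: "nat \<Rightarrow> nat \<Rightarrow> real vec" where
  "binvec n k = vec n (\<lambda>i. of_bool (bit k (n - 1 - i)))"

definition outer :: "real vec \<Rightarrow> real mat" where
  "outer v = mat (dim_vec v) (dim_vec v) (\<lambda>(i, j). v $ i * v $ j)"

definition corr_sum :: "nat \<Rightarrow> real vec \<Rightarrow> real mat" where
  "corr_sum n p = mat n n (\<lambda>(i, j). \<Sum>k = 0..2 ^ n - 1. p $ k * outer (binvec n k) $$ (i, j))"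

definition corr_cone :: "nat \<Rightarrow> real mat set" where
  "corr_cone n = {corr_sum n p | p. p \<in> carrier_vec (2 ^ n) \<and> 0\<^sub>v (2 ^ n) \<le> p}"

definition nnz :: "real vec \<Rightarrow> nat" where
  "nnz p = card {k. k < dim_vec p \<and> p $ k \<noteq> 0}"

definition rank_promise :: "(nat \<times> rat mat) set" where
  "rank_promise = {(q, G). 0 < q \<and>
     (\<exists>n\<ge>1. G \<in> carrier_mat n n \<and> G\<^sup>T = G \<and> map_mat real_of_rat G \<in> corr_cone n)}"

definition rank_yes :: "(nat \<times> rat mat) set" where
  "rank_yes = {(q, G) \<in> rank_promise.
     \<exists>p\<in>carrier_vec (2 ^ dim_row G). 0\<^sub>v (2 ^ dim_row G) \<le> p \<and> nnz p \<le> q \<and>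
       map_mat real_of_rat G = corr_sum (dim_row G) p}"

section \<open>Binary encoding of the instances\<close>

fun enc_nat :: "nat \<Rightarrow> bool list" where  \<comment> \<open>least significant bit first\<close>
  "enc_nat n = (if n = 0 then [] else odd n # enc_nat (n div 2))"

declare enc_nat.simps [simp del]

definition enc_int :: "int \<Rightarrow> bool list" where
  "enc_int a = (a < 0) # enc_nat (nat \<bar>a\<bar>)"

definition enc_rat :: "rat \<Rightarrow> bool list" where
  "enc_rat r = (case quotient_of r of (a, b) \<Rightarrow> pair (enc_int a) (enc_int b))"

definition enc_list :: "bool list list \<Rightarrow> bool list" where
  "enc_list ws = foldr pair ws []"

definition entries :: "'a mat \<Rightarrow> 'a list" where  \<comment> \<open>row by row\<close>
  "entries A = map (($$) A) (List.product [0..<dim_row A] [0..<dim_col A])"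

definition enc_instance :: "nat \<times> rat mat \<Rightarrow> bool list" where
  "enc_instance = (\<lambda>(q, G).
     enc_list (enc_nat q # enc_nat (dim_row G) # map enc_rat (entries G)))"

text \<open>Distinct square instances have distinct encodings.\<close>

lemma pair_inject [simp]: "pair x y = pair x' y' \<longleftrightarrow> x = x' \<and> y = y'"
proof (induction x arbitrary: x')
  case Nil
  show ?case by (cases x') (auto simp: pair_def)
next
  case (Cons b x)
  then show ?case by (cases x') (auto simp: pair_def)
qed

lemma pair_neq_Nil [simp]: "pair x y \<noteq> []"
  by (simp add: pair_def)

lemma enc_nat_inject [simp]: "enc_nat m = enc_nat n \<longleftrightarrow> m = n"
proof (induction m arbitrary: n rule: less_induct)
  case (less m)
  show ?case
  proof (cases "m = 0 \<or> n = 0")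
    case True
    then show ?thesis by (auto simp: enc_nat.simps[of m] enc_nat.simps[of n])
  next
    case False
    then have "enc_nat m = enc_nat n \<longleftrightarrow> odd m = odd n \<and> m div 2 = n div 2"
      using less[of "m div 2" "n div 2"] by (simp add: enc_nat.simps[of m] enc_nat.simps[of n])
    also have "\<dots> \<longleftrightarrow> m = n"
      by (metis bit_eq_rec)
    finally show ?thesis .
  qed
qed

lemma enc_int_inject [simp]: "enc_int a = enc_int b \<longleftrightarrow> a = b"
  by (auto simp: enc_int_def)

lemma enc_rat_inject [simp]: "enc_rat r = enc_rat s \<longleftrightarrow> r = s"
  by (cases "quotient_of r"; cases "quotient_of s")
     (auto simp: enc_rat_def intro: quotient_of_inject)

lemma enc_list_inject [simp]: "enc_list ws = enc_list ws' \<longleftrightarrow> ws = ws'"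
proof (induction ws arbitrary: ws')
  case Nil
  show ?case by (cases ws') (auto simp: enc_list_def dest: sym)
next
  case (Cons w ws)
  then show ?case by (cases ws') (auto simp: enc_list_def)
qed

lemma inj_on_enc_instance: "inj_on enc_instance {(q, G). square_mat G}"
proof (rule inj_onI, clarify)
  fix q q' and G G' :: "rat mat"
  assume sq: "square_mat G" "square_mat G'"
    and eq: "enc_instance (q, G) = enc_instance (q', G')"
  have inj: "inj enc_rat"
    by (simp add: inj_def)
  from eq have "q = q'" and dim: "dim_row G = dim_row G'" and "entries G = entries G'"
    by (auto simp: enc_instance_def inj_map_eq_map[OF inj])
  then have "\<forall>i<dim_row G. \<forall>j<dim_col G. G $$ (i, j) = G' $$ (i, j)"
    using sq by (auto simp: entries_def)
  with dim sq have "G = G'"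
    by (intro eq_matI) auto
  with \<open>q = q'\<close> show "q = q' \<and> G = G'" by simp
qed

end

theory Submission
  imports Defs
begin

text \<open>
  The run of a verifier on \<open>pair x u\<close> with unknown certificate \<open>u\<close> is described by clauses, the
  clauses become a subset sum instance whose numbers are written in a base so large that no carries
  occur, and a subset sum instance with numbers \<open>a\<^sub>i\<close> and target \<open>T\<close> becomes a matrix. In this matrix
  the item \<open>i\<close> is split by two further coordinates \<open>y\<close>, \<open>z\<close> with
  \<open>\<Gamma>\<^sub>i\<^sub>i = 2 a\<^sub>i\<close> and \<open>\<Gamma>\<^sub>i\<^sub>y = \<Gamma>\<^sub>i\<^sub>z = a\<^sub>i\<close>; the weight of \<open>{i,y,z}\<close> may be anything between
  \<open>0\<close> and \<open>a\<^sub>i\<close>, but only the two extremes keep the number of vectors at two per item, and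
  \<open>\<Gamma>\<^sub>y\<^sub>z = T\<close> forces the chosen weights to sum up to \<open>T\<close> unless one more vector is spent.
  Every bit of the output is a comparison of polynomials in a few loop counters of polynomial size, so
  the reduction runs on a Turing machine that keeps its counters in unary, as head positions.
\<close>

section \<open>Counter programs\<close>

text \<open>The promise must also hold for inputs outside the language, so the matrix needs a
  decomposition that presupposes no solution. One is always at hand: weight \<open>0\<close> on
  every \<open>{i,y,z}\<close> and weight \<open>T\<close> on \<open>{y,z}\<close>. The question is
  then only whether the vector \<open>{y,z}\<close> can be saved. The large diagonal entry
  \<open>B\<close> makes \<open>{y}\<close> and \<open>{z}\<close> indispensable, so that a budget
  of two vectors per item plus two is tight.

  The reduction must be exhibited as a machine, while the numbers of the instance are exponentially
  large. They never enter a counter and exist only as sequences of printed bits. Hence digits have a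
  fixed width, the number of clauses is an expression in the input length alone, and every positive
  number is laid out so that its last printed bit is its leading \<open>1\<close>: the binary code
  admits no zeros at the top.

  Addressing tape cells relative to the head makes transition clauses uniform in the position of the
  head; only the origin of the output tape has to be tracked.\<close>

datatype action = Inc nat | Dec nat | InR | InL | Out bool

datatype test = NZ nat | InOne | InBlank | And test test | Neg test

datatype prog = Do action | Seq prog prog | Cond test prog prog | While test prog | Nop

datatype instr = IDo action | IJump test nat

text \<open>Position of the input head, registers, and the output written so far. The input is never
  overwritten and the output only grows, so no more of these two tapes has to be remembered.\<close>

type_synonym cstate = "int \<times> (nat \<Rightarrow> nat) \<times> bool list"

definition input_cell :: "bool list \<Rightarrow> int \<Rightarrow> nat" where
  "input_cell x i = fst (input_tape x) i"

fun exec_action :: "action \<Rightarrow> cstate \<Rightarrow> cstate" where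
  "exec_action (Inc r) (i, c, out) = (i, c(r := Suc (c r)), out)"
| "exec_action (Dec r) (i, c, out) = (i, c(r := c r - 1), out)"
| "exec_action InR (i, c, out) = (i + 1, c, out)"
| "exec_action InL (i, c, out) = (i - 1, c, out)"
| "exec_action (Out b) (i, c, out) = (i, c, out @ [b])"

fun holds_test :: "bool list \<Rightarrow> test \<Rightarrow> cstate \<Rightarrow> bool" where
  "holds_test x (NZ r) (i, c, out) = (c r \<noteq> 0)"
| "holds_test x InOne (i, c, out) = (input_cell x i = 2)"
| "holds_test x InBlank (i, c, out) = (input_cell x i = 0)"
| "holds_test x (And t u) s = (holds_test x t s \<and> holds_test x u s)"
| "holds_test x (Neg t) s = (\<not> holds_test x t s)"

text \<open>Beyond the last instruction nothing changes any more; the address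
  \<open>length P\<close> becomes the halting state of the simulating machine.\<close>

definition instr_step :: "bool list \<Rightarrow> instr list \<Rightarrow> nat \<times> cstate \<Rightarrow> nat \<times> cstate" where
  "instr_step x P = (\<lambda>(pc, s). if pc < length P then
     (case P ! pc of IDo a \<Rightarrow> (Suc pc, exec_action a s)
      | IJump t l \<Rightarrow> (if holds_test x t s then l else Suc pc, s)) else (pc, s))"

text \<open>
  Code is compiled for a fixed start address, so that jump targets are absolute. The test
  \<open>Neg (And t (Neg t))\<close> always holds.
\<close>

fun code :: "nat \<Rightarrow> prog \<Rightarrow> instr list" where
  "code b (Do a) = [IDo a]"
| "code b (Seq p q) = (let cp = code b p in cp @ code (b + length cp) q)"
| "code b (Cond t p q) = (let cp = code (b + 1) p; cq = code (b + length cp + 2) q in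
     IJump (Neg t) (b + length cp + 2) # cp @
     IJump (Neg (And t (Neg t))) (b + length cp + 2 + length cq) # cq)"
| "code b (While t p) = (let cp = code (b + 1) p in
     IJump (Neg t) (b + length cp + 2) # cp @ [IJump (Neg (And t (Neg t))) b])"
| "code b Nop = []"

section \<open>Simulation of counter programs by Turing machines\<close>

text \<open>
  Tape \<open>r + 2\<close> holds counter \<open>r\<close> as its head position, cell \<open>0\<close> being marked
  by the symbol \<open>1\<close>. The marks are written in the first step, from state \<open>0\<close>, so that program
  address \<open>pc\<close> is state \<open>pc + 1\<close>.
\<close>

fun test_symbols :: "test \<Rightarrow> nat list \<Rightarrow> bool" where
  "test_symbols (NZ r) as = (as ! (r + 2) \<noteq> 1)"
| "test_symbols InOne as = (as ! 0 = 2)"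
| "test_symbols InBlank as = (as ! 0 = 0)"
| "test_symbols (And t u) as = (test_symbols t as \<and> test_symbols u as)"
| "test_symbols (Neg t) as = (\<not> test_symbols t as)"

text \<open>On a counter tape a move to the right is an increment. The mark \<open>1\<close> stops
  the head at cell \<open>0\<close>, which turns \<open>Dec\<close> into truncated
  subtraction.\<close>

fun action_on :: "action \<Rightarrow> nat \<Rightarrow> nat \<Rightarrow> nat \<times> move" where
  "action_on (Inc r) i a = (a, if i = r + 2 then Right else Stay)"
| "action_on (Dec r) i a = (a, if i = r + 2 \<and> a \<noteq> 1 then Left else Stay)"
| "action_on InR i a = (a, if i = 0 then Right else Stay)"
| "action_on InL i a = (a, if i = 0 then Left else Stay)"
| "action_on (Out b) i a = (if i = 1 then (bit_symbol b, Right) else (a, Stay))"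

definition counter_tm :: "nat \<Rightarrow> instr list \<Rightarrow> tm" where
  "counter_tm K P = \<lparr>ntapes = K + 2, nsyms = 3, nstates = Suc (length P),
     delta = (\<lambda>s as. case s of
        0 \<Rightarrow> (1, map (\<lambda>i. (if i < 2 then as ! i else 1, Stay)) [0..<K + 2])
      | Suc pc \<Rightarrow> (case P ! pc of
          IDo a \<Rightarrow> (Suc s, map (\<lambda>i. action_on a i (as ! i)) [0..<K + 2])
        | IJump t l \<Rightarrow> (if test_symbols t as then Suc l else Suc s,
            map (\<lambda>i. (as ! i, Stay)) [0..<K + 2])))\<rparr>"

definition tape_of :: "bool list \<Rightarrow> cstate \<Rightarrow> nat \<Rightarrow> tape" where
  "tape_of x = (\<lambda>(i, c, out) j.
     if j = 0 then (input_cell x, i)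
     else if j = 1 then (fst (input_tape out), int (length out))
     else ((\<lambda>_. 0)(0 := 1), int (c (j - 2))))"

definition tm_config :: "bool list \<Rightarrow> nat \<Rightarrow> nat \<times> cstate \<Rightarrow> config" where
  "tm_config x K = (\<lambda>(pc, s). (Suc pc, map (tape_of x s) [0..<K + 2]))"

fun test_regs :: "test \<Rightarrow> nat" where
  "test_regs (NZ r) = Suc r"
| "test_regs (And t u) = max (test_regs t) (test_regs u)"
| "test_regs (Neg t) = test_regs t"
| "test_regs _ = 0"

fun instr_regs :: "instr \<Rightarrow> nat" where
  "instr_regs (IDo (Inc r)) = Suc r"
| "instr_regs (IDo (Dec r)) = Suc r"
| "instr_regs (IDo _) = 0"
| "instr_regs (IJump t l) = test_regs t"

text \<open>Equality is allowed because a jump to the end of the program halts it.\<close>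

fun jump_le :: "nat \<Rightarrow> instr \<Rightarrow> bool" where
  "jump_le n (IJump t l) = (l \<le> n)"
| "jump_le n (IDo a) = True"

section \<open>Faithfulness of the simulation\<close>

lemma read_tape_of [simp]:
  "read (tape_of x (i, c, out) 0) = input_cell x i"
  "read (tape_of x (i, c, out) (Suc 0)) = 0"
  "read (tape_of x (i, c, out) (Suc (Suc r))) = (if c r = 0 then 1 else 0)"
  by (auto simp: tape_of_def input_tape_def)

lemma test_symbols_iff:
  "test_regs t \<le> K \<Longrightarrow>
   test_symbols t (map (\<lambda>j. read (tape_of x s j)) [0..<K + 2]) = holds_test x t s"
  by (induction t) (cases s; auto simp del: upt_Suc)+

lemma act_action_on:
  assumes "j < K + 2" "instr_regs (IDo a) \<le> K"
  shows "act (action_on a j (read (tape_of x s j))) (tape_of x s j)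
     = tape_of x (exec_action a s) j"
proof -
  obtain i c out where s: "s = (i, c, out)" by (cases s) auto
  have upd: "(fst (input_tape out))(int (length out) := bit_symbol b) = fst (input_tape (out @ [b]))" for b
    by (auto simp: input_tape_def fun_eq_iff nth_append)
  have blank: "fst (input_tape out) (int (length out)) = 0"
    by (simp add: input_tape_def)
  consider "j = 0" | "j = 1" | r where "j = Suc (Suc r)"
    by (metis One_nat_def nat.exhaust)
  then show ?thesis
  proof cases
    case 1
    then show ?thesis by (cases a) (auto simp: s tape_of_def fun_upd_idem)
  next
    case 2
    then show ?thesis by (cases a) (auto simp: s tape_of_def upd blank fun_upd_idem)
  next
    case 3
    then show ?thesis by (cases a) (auto simp: s tape_of_def fun_upd_idem)
  qed
qed

lemma act_stay: "act (read t, Stay) t = t"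
  by (cases t) auto

lemma map2_act_map:
  "map2 act (map f [0..<n]) (map g [0..<n]) = map (\<lambda>j. act (f j) (g j)) [0..<n]"
  by (simp add: map2_map_map)

text \<open>One instruction is one machine step. Past the end of the program both sides are
  stationary, so that no case distinction is needed when steps are iterated.\<close>

lemma step_counter_tm:
  assumes regs: "\<forall>I\<in>set P. instr_regs I \<le> K"
  shows "step (counter_tm K P) (tm_config x K (pc, s)) = tm_config x K (instr_step x P (pc, s))"
proof (cases "pc < length P")
  case False
  then show ?thesis by (simp add: step_def tm_config_def instr_step_def counter_tm_def)
next
  case True
  then have "P ! pc \<in> set P" by simp
  with regs have r: "instr_regs (P ! pc) \<le> K" by blast
  show ?thesis
  proof (cases "P ! pc")
    case (IDo a)
    with r True show ?thesis
      by (auto simp: step_def tm_config_def instr_step_def counter_tm_def o_def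
          map2_act_map act_action_on simp del: upt_Suc intro!: map_cong)
  next
    case (IJump t l)
    then have "test_regs t \<le> K" using r by simp
    from test_symbols_iff[OF this, of x s] IJump True show ?thesis
      by (auto simp: step_def tm_config_def instr_step_def counter_tm_def o_def
          map2_act_map act_stay simp del: upt_Suc intro!: map_cong)
  qed
qed

lemma steps_counter_tm:
  assumes regs: "\<forall>I\<in>set P. instr_regs I \<le> K"
  shows "(step (counter_tm K P) ^^ t) (tm_config x K ps) = tm_config x K ((instr_step x P ^^ t) ps)"
proof (induction t)
  case (Suc t)
  then show ?case
    by (cases "(instr_step x P ^^ t) ps") (simp add: step_counter_tm[OF regs])
qed simp

lemma init_counter_tm:
  "step (counter_tm K P) (init_config (counter_tm K P) x) = tm_config x K (0, 0, (\<lambda>_. 0), [])"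
proof -
  have "input_tape x # replicate (Suc K) blank_tape =
      map (\<lambda>j. if j = 0 then input_tape x else blank_tape) [0..<K + 2]"
    by (rule nth_equalityI) (auto simp: nth_Cons' simp del: upt_Suc)
  then show ?thesis
    by (auto simp: step_def init_config_def counter_tm_def tm_config_def map2_act_map o_def
        tape_of_def blank_tape_def input_cell_def input_tape_def fun_eq_iff
        simp del: upt_Suc replicate_Suc intro!: map_cong)
qed

lemma wf_counter_tm:
  assumes "\<forall>I\<in>set P. jump_le (length P) I"
  shows "wf_tm (counter_tm K P)"
  unfolding wf_tm_def
proof (intro conjI allI impI)
  fix s as
  assume s: "s < nstates (counter_tm K P)"
    and as: "length as = ntapes (counter_tm K P) \<and> (\<forall>a\<in>set as. a < nsyms (counter_tm K P))"
  have a3: "as ! i < 3" if "i < K + 2" for i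
    using as that by (auto simp: counter_tm_def)
  have ao: "fst (action_on a i b) < 3" if "b < 3" for a i b
    using that by (cases a) (auto simp: bit_symbol_def)
  have j: "jump_le (length P) (P ! pc)" if "s = Suc pc" for pc
    using s that assms by (simp add: counter_tm_def)
  show "fst (delta (counter_tm K P) s as) \<le> nstates (counter_tm K P)"
    using j s by (auto simp: counter_tm_def split: nat.splits instr.splits)
  show "length (snd (delta (counter_tm K P) s as)) = ntapes (counter_tm K P)"
    by (auto simp: counter_tm_def split: nat.splits instr.splits)
  show "\<forall>b\<in>fst ` set (snd (delta (counter_tm K P) s as)). b < nsyms (counter_tm K P)"
    using a3 ao by (auto simp: counter_tm_def split: nat.splits instr.splits simp del: upt_Suc)
qed (auto simp: counter_tm_def)

text \<open>Jump targets are absolute, so code can be run only at the address for which it was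
  compiled; quantifying over all surroundings \<open>pre\<close> and \<open>post\<close> makes the
  statement composable. The time is an upper bound, so that branches of different length can share
  one.\<close>

definition runs :: "bool list \<Rightarrow> prog \<Rightarrow> cstate \<Rightarrow> nat \<Rightarrow> cstate \<Rightarrow> bool" where
  "runs x p s n s' \<longleftrightarrow> (\<forall>pre post. \<exists>t\<le>n.
     (instr_step x (pre @ code (length pre) p @ post) ^^ t) (length pre, s)
       = (length pre + length (code (length pre) p), s'))"

lemma runs_mono: "runs x p s n s' \<Longrightarrow> n \<le> n' \<Longrightarrow> runs x p s n' s'"
  unfolding runs_def by (meson le_trans)

lemma runs_at:
  assumes "runs x p s n s'" "length pre = b" "P = pre @ code b p @ post"
  obtains t where "t \<le> n" "(instr_step x P ^^ t) (b, s) = (b + length (code b p), s')"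
  using assms unfolding runs_def by blast

lemma runs_Do: "runs x (Do a) s 1 (exec_action a s)"
  unfolding runs_def
  by (intro allI exI[of _ 1]) (simp add: instr_step_def nth_append)

lemma runs_Nop: "runs x Nop s 0 s"
  unfolding runs_def by auto

lemma runs_Seq:
  assumes "runs x p s n s'" "runs x q s' m s''"
  shows "runs x (Seq p q) s (n + m) s''"
  unfolding runs_def
proof (intro allI)
  fix pre post :: "instr list"
  let ?b = "length pre"
  let ?cp = "code ?b p"
  let ?cq = "code (?b + length ?cp) q"
  let ?P = "pre @ code ?b (Seq p q) @ post"
  obtain t where t: "t \<le> n" "(instr_step x ?P ^^ t) (?b, s) = (?b + length ?cp, s')"
    by (rule runs_at[OF assms(1), of pre _ _ "?cq @ post"]) (auto simp: Let_def)
  obtain u where u: "u \<le> m" "(instr_step x ?P ^^ u) (?b + length ?cp, s')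
      = (?b + length ?cp + length ?cq, s'')"
    by (rule runs_at[OF assms(2), of "pre @ ?cp" _ _ "post"]) (auto simp: Let_def)
  have "(instr_step x ?P ^^ (u + t)) (?b, s) = (?b + length (code ?b (Seq p q)), s'')"
    using t u by (simp add: funpow_add Let_def)
  with t u show "\<exists>t\<le>n + m. (instr_step x ?P ^^ t) (?b, s)
      = (?b + length (code ?b (Seq p q)), s'')"
    by (intro exI[of _ "u + t"]) auto
qed

lemma holds_trivial [simp]: "\<not> holds_test x (And t (Neg t)) s"
  by simp

lemma funpow_first_last:
  assumes "f a = b" "(f ^^ u) b = c" "f c = d"
  shows "(f ^^ Suc (Suc u)) a = d"
  using assms by (metis comp_apply funpow.simps(2) funpow_Suc_right)

text \<open>The two extra steps are the entry test and the jump over the second branch.\<close>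

lemma runs_Cond:
  assumes "holds_test x t s \<Longrightarrow> runs x p s n s'" "\<not> holds_test x t s \<Longrightarrow> runs x q s n s'"
  shows "runs x (Cond t p q) s (n + 2) s'"
  unfolding runs_def
proof (intro allI)
  fix pre post :: "instr list"
  let ?b = "length pre"
  let ?cp = "code (?b + 1) p"
  let ?b' = "?b + length ?cp + 2"
  let ?cq = "code ?b' q"
  let ?P = "pre @ code ?b (Cond t p q) @ post"
  let ?J = "IJump (Neg t) ?b'" and ?J' = "IJump (Neg (And t (Neg t))) (?b' + length ?cq)"
  have P: "?P = pre @ (?J # ?cp @ ?J' # ?cq) @ post"
    by (simp add: Let_def)
  have len: "length (code ?b (Cond t p q)) = length ?cp + length ?cq + 2"
    by (simp add: Let_def)
  show "\<exists>u\<le>n + 2. (instr_step x ?P ^^ u) (?b, s) = (?b + length (code ?b (Cond t p q)), s')"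
  proof (cases "holds_test x t s")
    case True
    have 1: "instr_step x ?P (?b, s) = (Suc ?b, s)"
      unfolding P using True by (simp add: instr_step_def nth_append)
    obtain u where u: "u \<le> n" "(instr_step x ?P ^^ u) (?b + 1, s) = (?b + 1 + length ?cp, s')"
      by (rule runs_at[OF assms(1)[OF True], of "pre @ [?J]" _ _ "?J' # ?cq @ post"]) (auto simp: Let_def)
    have 2: "instr_step x ?P (?b + 1 + length ?cp, s') = (?b' + length ?cq, s')"
      unfolding P by (simp add: instr_step_def nth_append)
    have "(instr_step x ?P ^^ (Suc (Suc u))) (?b, s) = (?b' + length ?cq, s')"
      by (rule funpow_first_last[where f = "instr_step x ?P", OF 1 _ 2]) (use u in simp)
    then show ?thesis using u len by (intro exI[of _ "Suc (Suc u)"]) auto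
  next
    case False
    have 1: "instr_step x ?P (?b, s) = (?b', s)"
      unfolding P using False by (simp add: instr_step_def nth_append)
    obtain u where u: "u \<le> n" "(instr_step x ?P ^^ u) (?b', s) = (?b' + length ?cq, s')"
      by (rule runs_at[OF assms(2)[OF False], of "pre @ [?J] @ ?cp @ [?J']" _ _ "post"]) (auto simp: Let_def)
    have "(instr_step x ?P ^^ (Suc u)) (?b, s) = (?b' + length ?cq, s')"
      using u 1 by (simp add: funpow_Suc_right del: funpow.simps)
    then show ?thesis using u len by (intro exI[of _ "Suc u"]) auto
  qed
qed

lemma runs_While_False:
  assumes "\<not> holds_test x t s"
  shows "runs x (While t p) s 1 s"
  unfolding runs_def using assms
  by (intro allI exI[of _ 1]) (simp add: instr_step_def nth_append Let_def)

lemma runs_While_True: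
  assumes "holds_test x t s" "runs x p s n s'" "runs x (While t p) s' m s''"
  shows "runs x (While t p) s (n + m + 2) s''"
  unfolding runs_def
proof (intro allI)
  fix pre post :: "instr list"
  let ?b = "length pre"
  let ?cp = "code (?b + 1) p"
  let ?P = "pre @ code ?b (While t p) @ post"
  let ?J = "IJump (Neg t) (?b + length ?cp + 2)" and ?J' = "IJump (Neg (And t (Neg t))) ?b"
  have P: "?P = pre @ (?J # ?cp @ [?J']) @ post"
    by (simp add: Let_def)
  have 1: "instr_step x ?P (?b, s) = (Suc ?b, s)"
    unfolding P using assms(1) by (simp add: instr_step_def nth_append)
  obtain u where u: "u \<le> n" "(instr_step x ?P ^^ u) (?b + 1, s) = (?b + 1 + length ?cp, s')"
    by (rule runs_at[OF assms(2), of "pre @ [?J]" _ _ "?J' # post"]) (auto simp: Let_def)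
  have 2: "instr_step x ?P (?b + 1 + length ?cp, s') = (?b, s')"
    unfolding P by (simp add: instr_step_def nth_append)
  obtain v where v: "v \<le> m" "(instr_step x ?P ^^ v) (?b, s') = (?b + length (code ?b (While t p)), s'')"
    by (rule runs_at[OF assms(3), of pre _ _ post]) auto
  have 3: "(instr_step x ?P ^^ (Suc (Suc u))) (?b, s) = (?b, s')"
    by (rule funpow_first_last[where f = "instr_step x ?P", OF 1 _ 2]) (use u in simp)
  have "(instr_step x ?P ^^ (v + Suc (Suc u))) (?b, s) = (?b + length (code ?b (While t p)), s'')"
    unfolding funpow_add comp_apply 3 v ..
  then show "\<exists>u\<le>n + m + 2. (instr_step x ?P ^^ u) (?b, s) = (?b + length (code ?b (While t p)), s'')"
    using u v by (intro exI[of _ "v + Suc (Suc u)"]) auto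
qed

text \<open>The sequence \<open>f\<close> of states at the head of the loop takes the place of
  invariant and variant. Each round pays for the test and the jump back; the final \<open>1\<close>
  is the failing test.\<close>

lemma runs_While:
  assumes "\<And>j. j < m \<Longrightarrow> holds_test x t (f j)" "\<And>j. j < m \<Longrightarrow> runs x p (f j) n (f (Suc j))"
    and "\<not> holds_test x t (f m)"
  shows "runs x (While t p) (f 0) (m * (n + 2) + 1) (f m)"
  using assms
proof (induction m arbitrary: f)
  case 0
  then show ?case by (simp add: runs_While_False[simplified])
next
  case (Suc m)
  have "runs x (While t p) (f (Suc 0)) (m * (n + 2) + 1) (f (Suc m))"
    by (rule Suc.IH[of "\<lambda>j. f (Suc j)"]) (use Suc.prems in auto)
  from runs_While_True[OF Suc.prems(1)[of 0] Suc.prems(2)[of 0] this]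
  show ?case by (simp add: algebra_simps)
qed

fun seqs :: "prog list \<Rightarrow> prog" where
  "seqs [] = Nop"
| "seqs (p # ps) = Seq p (seqs ps)"

fun exec_actions :: "action list \<Rightarrow> cstate \<Rightarrow> cstate" where
  "exec_actions [] s = s"
| "exec_actions (a # as) s = exec_actions as (exec_action a s)"

lemma runs_actions: "runs x (seqs (map Do as)) s (length as) (exec_actions as s)"
proof (induction as arbitrary: s)
  case Nil
  show ?case by (simp add: runs_Nop)
next
  case (Cons a as)
  have "runs x (Seq (Do a) (seqs (map Do as))) s (1 + length as)
      (exec_actions as (exec_action a s))"
    by (rule runs_Seq[OF runs_Do Cons.IH])
  then show ?case by simp
qed

lemma runs_actions':
  "exec_actions as s = s' \<Longrightarrow> length as \<le> n \<Longrightarrow> runs x (seqs (map Do as)) s n s'"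
  using runs_actions runs_mono by blast

section \<open>Polynomial expressions evaluated by counters\<close>

datatype aexp = Num nat | Var nat | Plus aexp aexp | Times aexp aexp

primrec aval :: "aexp \<Rightarrow> (nat \<Rightarrow> nat) \<Rightarrow> nat" where
  "aval (Num n) env = n"
| "aval (Var v) env = env v"
| "aval (Plus a b) env = aval a env + aval b env"
| "aval (Times a b) env = aval a env * aval b env"

primrec avars :: "aexp \<Rightarrow> nat set" where
  "avars (Num n) = {}"
| "avars (Var v) = {v}"
| "avars (Plus a b) = avars a \<union> avars b"
| "avars (Times a b) = avars a \<union> avars b"

lemma aval_cong: "(\<And>v. v \<in> avars e \<Longrightarrow> env v = env' v) \<Longrightarrow> aval e env = aval e env'"
  by (induction e) auto

text \<open>Without subtraction expressions are monotone, so a single bound \<open>B\<close> on all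
  variables serves every time estimate.\<close>

lemma aval_le: "(\<And>v. v \<in> avars e \<Longrightarrow> env v \<le> B) \<Longrightarrow> aval e env \<le> aval e (\<lambda>_. B)"
  by (induction e) (auto intro: add_mono mult_le_mono)

text \<open>In \<open>add_exp e k d\<close> the registers from \<open>k\<close> on are scratch.\<close>

primrec add_exp :: "aexp \<Rightarrow> nat \<Rightarrow> nat \<Rightarrow> prog" where
  "add_exp (Num n) k d = seqs (map Do (replicate n (Inc d)))"
| "add_exp (Var v) k d =
     Seq (While (NZ v) (seqs (map Do [Dec v, Inc k, Inc d])))
         (While (NZ k) (seqs (map Do [Dec k, Inc v])))"
| "add_exp (Plus a b) k d = Seq (add_exp a k d) (add_exp b k d)"
| "add_exp (Times a b) k d = Seq (add_exp a (Suc k) k)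
     (While (NZ k) (Seq (Do (Dec k)) (add_exp b (Suc k) d)))"

primrec add_time :: "aexp \<Rightarrow> nat \<Rightarrow> nat" where
  "add_time (Num n) B = n"
| "add_time (Var v) B = 9 * B + 2"
| "add_time (Plus a b) B = add_time a B + add_time b B"
| "add_time (Times a b) B = add_time a B + (aval a (\<lambda>_. B) * (add_time b B + 3) + 1)"

lemma exec_Incs: "exec_actions (replicate n (Inc d)) (i, c, out) = (i, c(d := c d + n), out)"
  by (induction n arbitrary: c) auto

text \<open>A register is read by counting it down, so a variable passes through the scratch
  register \<open>k\<close> and is restored. The bound \<open>l\<close> on the variables is kept
  apart from the destination \<open>d\<close> because a factor of a product is evaluated into a
  scratch register. Only registers below \<open>l\<close> are bounded by \<open>B\<close>, since
  \<open>d\<close> accumulates.\<close>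

lemma runs_add_exp:
  assumes "avars e \<subseteq> {..<l}" "l \<le> d" "d < k" "\<And>r. r < l \<Longrightarrow> c r \<le> B" "\<And>r. k \<le> r \<Longrightarrow> c r = 0"
  shows "runs x (add_exp e k d) (i, c, out) (add_time e B) (i, c(d := c d + aval e c), out)"
  using assms
proof (induction e arbitrary: k d c)
  case (Num n)
  show ?case
    unfolding add_exp.simps add_time.simps aval.simps
    by (rule runs_actions') (simp_all add: exec_Incs fun_eq_iff)
next
  case (Var v)
  then have v: "v < l" "v \<noteq> d" "v \<noteq> k" "d \<noteq> k" "c v \<le> B" "c k = 0" by auto
  let ?f = "\<lambda>j. (i, c(v := c v - j, k := j, d := c d + j), out)"
  have 1: "runs x (While (NZ v) (seqs (map Do [Dec v, Inc k, Inc d])))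
      (?f 0) (c v * (3 + 2) + 1) (?f (c v))"
    by (rule runs_While[where f = ?f])
       (use v in \<open>auto intro!: runs_actions' simp: fun_eq_iff simp del: seqs.simps list.map\<close>)
  let ?g = "\<lambda>j. (i, c(v := j, k := c v - j, d := c d + c v), out)"
  have 2: "runs x (While (NZ k) (seqs (map Do [Dec k, Inc v])))
      (?g 0) (c v * (2 + 2) + 1) (?g (c v))"
    by (rule runs_While[where f = ?g])
       (use v in \<open>auto intro!: runs_actions' simp: fun_eq_iff simp del: seqs.simps list.map\<close>)
  have e: "?f 0 = (i, c, out)" "?f (c v) = ?g 0" "?g (c v) = (i, c(d := c d + aval (Var v) c), out)"
    using v by (auto simp: fun_eq_iff)
  have "runs x (add_exp (Var v) k d) (?f 0) (c v * (3 + 2) + 1 + (c v * (2 + 2) + 1)) (?g (c v))"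
    unfolding add_exp.simps by (rule runs_Seq[OF 1]) (use 2 e in simp)
  then show ?case unfolding e by (rule runs_mono) (use v in auto)
next
  case (Plus a b)
  let ?c = "c(d := c d + aval a c)"
  have eq: "aval b ?c = aval b c"
    by (rule aval_cong) (use Plus.prems in auto)
  have "runs x (add_exp b k d) (i, ?c, out) (add_time b B) (i, ?c(d := ?c d + aval b ?c), out)"
    using Plus.prems by (intro Plus.IH(2)) auto
  moreover have "runs x (add_exp a k d) (i, c, out) (add_time a B) (i, ?c, out)"
    using Plus.prems by (intro Plus.IH(1)) auto
  ultimately have "runs x (add_exp (Plus a b) k d) (i, c, out) (add_time (Plus a b) B)
      (i, ?c(d := ?c d + aval b ?c), out)"
    unfolding add_exp.simps add_time.simps by (intro runs_Seq)
  also have "(i, ?c(d := ?c d + aval b ?c), out) = (i, c(d := c d + aval (Plus a b) c), out)"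
    by (simp add: eq add.assoc)
  finally show ?case .
next
  case (Times a b)
  let ?m = "aval a c"
  let ?f = "\<lambda>j. (i, c(k := ?m - j, d := c d + j * aval b c), out)"
  have "runs x (add_exp a (Suc k) k) (i, c, out) (add_time a B) (i, c(k := c k + aval a c), out)"
    using Times.prems by (intro Times.IH(1)) auto
  moreover have "c(k := c k + aval a c) = c(k := ?m - 0, d := c d + 0 * aval b c)"
    using Times.prems by (auto simp: fun_eq_iff)
  ultimately have 1: "runs x (add_exp a (Suc k) k) (i, c, out) (add_time a B) (?f 0)"
    by simp
  have body: "runs x (Seq (Do (Dec k)) (add_exp b (Suc k) d)) (?f j) (1 + add_time b B) (?f (Suc j))"
    if "j < ?m" for j
  proof -
    let ?c = "c(k := ?m - Suc j, d := c d + j * aval b c)"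
    have eq: "aval b ?c = aval b c"
      by (rule aval_cong) (use Times.prems in auto)
    have s: "exec_action (Dec k) (?f j) = (i, ?c, out)"
      using Times.prems by (auto simp: fun_eq_iff)
    have "runs x (add_exp b (Suc k) d) (i, ?c, out) (add_time b B) (i, ?c(d := ?c d + aval b ?c), out)"
      using Times.prems by (intro Times.IH(2)) auto
    also have "(i, ?c(d := ?c d + aval b ?c), out) = ?f (Suc j)"
      unfolding eq using Times.prems by (auto simp: fun_eq_iff)
    finally show ?thesis
      using runs_Seq[OF runs_Do[of x "Dec k" "?f j"]] unfolding s by blast
  qed
  have 2: "runs x (While (NZ k) (Seq (Do (Dec k)) (add_exp b (Suc k) d)))
      (?f 0) (?m * (1 + add_time b B + 2) + 1) (?f ?m)"
    by (rule runs_While[where f = ?f]) (use Times.prems body in auto)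
  have e: "?f ?m = (i, c(d := c d + aval (Times a b) c), out)"
    using Times.prems by (auto simp: fun_eq_iff)
  have "?m \<le> aval a (\<lambda>_. B)"
    by (rule aval_le) (use Times.prems in auto)
  then have "?m * (1 + add_time b B + 2) \<le> aval a (\<lambda>_. B) * (add_time b B + 3)"
    by (rule mult_le_mono) simp
  then have le: "?m * (1 + add_time b B + 2) + 1 \<le> aval a (\<lambda>_. B) * (add_time b B + 3) + 1"
    by simp
  show ?case
    unfolding add_exp.simps add_time.simps
    using runs_Seq[OF 1 runs_mono[OF 2 le]] unfolding e .
qed

section \<open>A generator language\<close>

text \<open>
  Registers are de Bruijn levels: at level \<open>k\<close> the registers below \<open>k\<close> are in use, and
  \<open>For\<close> binds register \<open>k\<close>. Its loop runs downwards, because then the loop variable is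
  itself the counter.
\<close>

datatype 'a gen = Leaf 'a | Skip | Then "'a gen" "'a gen" | IfEq aexp aexp "'a gen" "'a gen"
  | IfBit aexp "'a gen" "'a gen" | For aexp "'a gen"

text \<open>Leaves come with the level and environment in which they are reached, so that a leaf can
  later be replaced by a generator of its own.\<close>

primrec eval :: "bool list \<Rightarrow> 'a gen \<Rightarrow> nat \<Rightarrow> (nat \<Rightarrow> nat) \<Rightarrow> ('a \<times> nat \<times> (nat \<Rightarrow> nat)) list" where
  "eval x (Leaf a) k env = [(a, k, env)]"
| "eval x Skip k env = []"
| "eval x (Then g h) k env = eval x g k env @ eval x h k env"
| "eval x (IfEq a b g h) k env =
     (if aval a env = aval b env then eval x g k env else eval x h k env)"
| "eval x (IfBit a g h) k env =
     (if aval a env < length x \<and> x ! aval a env then eval x g k env else eval x h k env)"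
| "eval x (For a g) k env =
     concat (map (\<lambda>i. eval x g (Suc k) (env(k := i))) (rev [0..<aval a env]))"

primrec gen_ok :: "('a \<Rightarrow> nat set) \<Rightarrow> 'a gen \<Rightarrow> nat \<Rightarrow> bool" where
  "gen_ok lv (Leaf a) k = (lv a \<subseteq> {..<k})"
| "gen_ok lv Skip k = True"
| "gen_ok lv (Then g h) k = (gen_ok lv g k \<and> gen_ok lv h k)"
| "gen_ok lv (IfEq a b g h) k =
     (avars a \<subseteq> {..<k} \<and> avars b \<subseteq> {..<k} \<and> gen_ok lv g k \<and> gen_ok lv h k)"
| "gen_ok lv (IfBit a g h) k = (avars a \<subseteq> {..<k} \<and> gen_ok lv g k \<and> gen_ok lv h k)"
| "gen_ok lv (For a g) k = (avars a \<subseteq> {..<k} \<and> gen_ok lv g (Suc k))"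

text \<open>The part of a \<open>pair\<close> in front of its separator.\<close>

definition double :: "bool list \<Rightarrow> bool list" where
  "double w = concat (map (\<lambda>b. [b, b]) w)"

datatype out_leaf = Bits "bool list" | Binary aexp

primrec leaf_vars :: "out_leaf \<Rightarrow> nat set" where
  "leaf_vars (Bits w) = {}"
| "leaf_vars (Binary a) = avars a"

text \<open>A number is printed as an element of a list, hence doubled.\<close>

fun leaf_out :: "out_leaf \<times> nat \<times> (nat \<Rightarrow> nat) \<Rightarrow> bool list" where
  "leaf_out (Bits w, k, env) = w"
| "leaf_out (Binary a, k, env) = double (enc_nat (aval a env))"

definition produce :: "bool list \<Rightarrow> out_leaf gen \<Rightarrow> nat \<Rightarrow> (nat \<Rightarrow> nat) \<Rightarrow> bool list" where
  "produce x g k env = concat (map leaf_out (eval x g k env))"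

lemma concat_concat: "concat (concat xss) = concat (map concat xss)"
  by (induction xss) auto

lemma produce_simps [simp]:
  "produce x (Leaf l) k env = leaf_out (l, k, env)"
  "produce x Skip k env = []"
  "produce x (Then g h) k env = produce x g k env @ produce x h k env"
  "produce x (IfEq a b g h) k env =
     (if aval a env = aval b env then produce x g k env else produce x h k env)"
  "produce x (IfBit a g h) k env =
     (if aval a env < length x \<and> x ! aval a env then produce x g k env else produce x h k env)"
  "produce x (For a g) k env =
     concat (map (\<lambda>i. produce x g (Suc k) (env(k := i))) (rev [0..<aval a env]))"
  by (auto simp: produce_def map_concat concat_concat o_def)

subsection \<open>Compilation to counter programs\<close>

definition emit :: "bool list \<Rightarrow> prog" where
  "emit w = seqs (map Do (map Out w))"

definition clear :: "nat \<Rightarrow> prog" where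
  "clear r = While (NZ r) (seqs (map Do [Dec r]))"

definition transfer :: "nat \<Rightarrow> nat \<Rightarrow> prog" where
  "transfer r s = While (NZ r) (seqs (map Do [Dec r, Inc s]))"

text \<open>Counting down in pairs leaves the quotient in \<open>k + 1\<close> and the parity, the
  next bit to print, in \<open>k + 2\<close>.\<close>

definition halve :: "nat \<Rightarrow> prog" where
  "halve k = While (NZ k) (Seq (Do (Dec k))
     (Cond (NZ k) (seqs (map Do [Dec k, Inc (k + 1)])) (seqs (map Do [Inc (k + 2)]))))"

definition emit_binary :: "nat \<Rightarrow> prog" where
  "emit_binary k = While (NZ k) (Seq (halve k) (Seq
     (Cond (NZ (k + 2)) (seqs (map Do [Dec (k + 2), Out True, Out True]))
        (seqs (map Do [Out False, Out False])))
     (transfer (k + 1) k)))"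

definition go_back :: "nat \<Rightarrow> prog" where
  "go_back k = While (NZ k) (seqs (map Do [Dec k, InL]))"

text \<open>Registers from \<open>k\<close> on are zero on entry and on exit. In \<open>IfEq\<close>
  two values are counted down together and agree iff both run out at once; the remainder must be
  cleared before the second branch. In \<open>IfBit\<close> the head returns to cell
  \<open>0\<close> before either branch, register \<open>k + 1\<close> remembering the
  distance.\<close>

primrec compile :: "out_leaf gen \<Rightarrow> nat \<Rightarrow> prog" where
  "compile (Leaf l) k = (case l of Bits w \<Rightarrow> emit w
     | Binary a \<Rightarrow> Seq (add_exp a (k + 1) k) (emit_binary k))"
| "compile Skip k = Nop"
| "compile (Then g h) k = Seq (compile g k) (compile h k)"
| "compile (IfEq a b g h) k =
     Seq (add_exp a (k + 2) k) (Seq (add_exp b (k + 2) (k + 1))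
       (Seq (While (And (NZ k) (NZ (k + 1))) (seqs (map Do [Dec k, Dec (k + 1)])))
         (Cond (And (Neg (NZ k)) (Neg (NZ (k + 1)))) (compile g k)
           (Seq (clear k) (Seq (clear (k + 1)) (compile h k))))))"
| "compile (IfBit a g h) k =
     Seq (add_exp a (k + 1) k) (Seq (While (NZ k) (seqs (map Do [Dec k, Inc (k + 1), InR])))
       (Cond InOne (Seq (go_back (k + 1)) (compile g k)) (Seq (go_back (k + 1)) (compile h k))))"
| "compile (For a g) k =
     Seq (add_exp a (k + 1) k) (While (NZ k) (Seq (Do (Dec k)) (compile g (Suc k))))"

abbreviation bound :: "aexp \<Rightarrow> nat \<Rightarrow> nat" where
  "bound a B \<equiv> aval a (\<lambda>_. B)"

primrec leaf_time :: "out_leaf \<Rightarrow> nat \<Rightarrow> nat" where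
  "leaf_time (Bits w) B = length w"
| "leaf_time (Binary a) B = add_time a B + 60 * bound a B + 1"

text \<open>Inside a loop the bound \<open>B\<close> grows by the loop bound, since the loop
  variable is itself a register. Conditionals are charged for both branches.\<close>

primrec gen_time :: "out_leaf gen \<Rightarrow> nat \<Rightarrow> nat" where
  "gen_time (Leaf l) B = leaf_time l B"
| "gen_time Skip B = 0"
| "gen_time (Then g h) B = gen_time g B + gen_time h B"
| "gen_time (IfEq a b g h) B = add_time a B + add_time b B + 10 * (bound a B + bound b B) + 10
     + gen_time g B + gen_time h B"
| "gen_time (IfBit a g h) B = add_time a B + 10 * bound a B + 10 + gen_time g B + gen_time h B"
| "gen_time (For a g) B =
     add_time a B + bound a B * (gen_time g (B + bound a B) + 3) + 1"

lemma runs_emit: "runs x (emit w) (i, c, out) (length w) (i, c, out @ w)"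
proof -
  have "exec_actions (map Out w) (i, c, out) = (i, c, out @ w)" for out
    by (induction w arbitrary: out) auto
  then show ?thesis unfolding emit_def by (intro runs_actions') auto
qed

lemma runs_clear: "runs x (clear r) (i, c, out) (c r * 3 + 1) (i, c(r := 0), out)"
proof -
  let ?f = "\<lambda>j. (i, c(r := c r - j), out)"
  have "runs x (clear r) (?f 0) (c r * (1 + 2) + 1) (?f (c r))"
    unfolding clear_def
    by (rule runs_While[where f = ?f]) (auto intro!: runs_actions' simp: fun_eq_iff simp del: seqs.simps list.map)
  then show ?thesis by (auto intro: runs_mono)
qed

lemma runs_transfer:
  assumes "r \<noteq> s"
  shows "runs x (transfer r s) (i, c, out) (c r * 4 + 1) (i, c(r := 0, s := c s + c r), out)"
proof -
  let ?f = "\<lambda>j. (i, c(r := c r - j, s := c s + j), out)"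
  have "runs x (transfer r s) (?f 0) (c r * (2 + 2) + 1) (?f (c r))"
    unfolding transfer_def
    by (rule runs_While[where f = ?f])
      (use assms in \<open>auto intro!: runs_actions' simp: fun_eq_iff simp del: seqs.simps list.map\<close>)
  then show ?thesis using assms by simp
qed

lemma runs_go_back:
  "runs x (go_back r) (i, c, out) (c r * 4 + 1) (i - int (c r), c(r := 0), out)"
proof -
  let ?f = "\<lambda>j. (i - int j, c(r := c r - j), out)"
  have "runs x (go_back r) (?f 0) (c r * (2 + 2) + 1) (?f (c r))"
    unfolding go_back_def
    by (rule runs_While[where f = ?f]) (auto intro!: runs_actions' simp: fun_eq_iff simp del: seqs.simps list.map)
  then show ?thesis by simp
qed

lemma runs_halve:
  assumes "c (k + 1) = 0" "c (k + 2) = 0"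
  shows "runs x (halve k) (i, c, out) (7 * c k + 8)
    (i, c(k := 0, k + 1 := c k div 2, k + 2 := c k mod 2), out)"
proof -
  let ?v = "c k"
  \<comment> \<open>An odd value ends with a round of a single decrement; the truncated difference
    and \<open>min\<close> describe this round as well.\<close>
  let ?f = "\<lambda>j. (i, c(k := ?v - 2 * j, k + 1 := min j (?v div 2),
      k + 2 := (if ?v < 2 * j then 1 else 0)), out)"
  let ?body = "Seq (Do (Dec k))
     (Cond (NZ k) (seqs (map Do [Dec k, Inc (k + 1)])) (seqs (map Do [Inc (k + 2)])))"
  have body: "runs x ?body (?f j) (1 + (2 + 2)) (?f (Suc j))" if j: "j < (?v + 1) div 2" for j
  proof (rule runs_Seq[OF runs_Do runs_Cond])
    assume "holds_test x (NZ k) (exec_action (Dec k) (?f j))"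
    then have "j < ?v div 2" by auto
    then show "runs x (seqs (map Do [Dec k, Inc (k + 1)])) (exec_action (Dec k) (?f j)) 2 (?f (Suc j))"
      by (intro runs_actions') (auto simp: fun_eq_iff)
  next
    assume "\<not> holds_test x (NZ k) (exec_action (Dec k) (?f j))"
    then have "j = ?v div 2" "?v = 2 * j + 1" using j by auto
    then show "runs x (seqs (map Do [Inc (k + 2)])) (exec_action (Dec k) (?f j)) 2 (?f (Suc j))"
      by (intro runs_actions') (auto simp: fun_eq_iff)
  qed
  let ?m = "(?v + 1) div 2"
  have "runs x (halve k) (?f 0) (?m * (1 + (2 + 2) + 2) + 1) (?f ?m)"
    unfolding halve_def by (rule runs_While[where f = ?f]) (use body in auto)
  moreover have "?f 0 = (i, c, out)"
    using assms by (auto simp: fun_eq_iff)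
  moreover have "?f ?m = (i, c(k := 0, k + 1 := ?v div 2, k + 2 := ?v mod 2), out)"
  proof -
    have "?v - 2 * ?m = 0" "min ?m (?v div 2) = ?v div 2" "(if ?v < 2 * ?m then 1 else 0) = ?v mod 2"
      by presburger+
    then show ?thesis by simp
  qed
  ultimately show ?thesis
    by (auto intro: runs_mono)
qed

lemma runs_emit_binary:
  assumes "c (k + 1) = 0" "c (k + 2) = 0"
  shows "runs x (emit_binary k) (i, c, out) (60 * c k + 1)
    (i, c(k := 0), out @ double (enc_nat (c k)))"
  using assms
proof (induction "c k" arbitrary: c out rule: less_induct)
  case less
  let ?v = "c k"
  show ?case
  proof (cases "?v = 0")
    case True
    then show ?thesis
      using runs_While_False[of x "NZ k" "(i, c, out)"]
      by (simp add: emit_binary_def enc_nat.simps double_def fun_upd_idem)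
  next
    case False
    let ?c1 = "c(k := 0, k + 1 := ?v div 2, k + 2 := ?v mod 2)"
    let ?c2 = "c(k := 0, k + 1 := ?v div 2)"
    let ?c3 = "c(k := ?v div 2)"
    let ?o = "out @ [odd ?v, odd ?v]"
    have 1: "runs x (halve k) (i, c, out) (7 * c k + 8) (i, ?c1, out)"
      by (rule runs_halve) (use less.prems in auto)
    have 2: "runs x (Cond (NZ (k + 2)) (seqs (map Do [Dec (k + 2), Out True, Out True]))
        (seqs (map Do [Out False, Out False]))) (i, ?c1, out) (3 + 2) (i, ?c2, ?o)"
      by (rule runs_Cond; rule runs_actions')
        (use less.prems in \<open>auto simp: fun_eq_iff odd_iff_mod_2_eq_one\<close>)
    have 3: "runs x (transfer (k + 1) k) (i, ?c2, ?o) (?v div 2 * 4 + 1) (i, ?c3, ?o)"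
      using runs_transfer[of "k + 1" k x i ?c2 ?o] less.prems
      by (simp add: fun_upd_idem fun_upd_twist)
    have 4: "runs x (emit_binary k) (i, ?c3, ?o) (60 * ?c3 k + 1)
        (i, ?c3(k := 0), ?o @ double (enc_nat (?c3 k)))"
      by (rule less.hyps) (use less.prems False in auto)
    have enc: "double (enc_nat ?v) = [odd ?v, odd ?v] @ double (enc_nat (?v div 2))"
      using False by (subst enc_nat.simps) (simp add: double_def)
    have "runs x (emit_binary k) (i, c, out)
        (7 * c k + 8 + (3 + 2 + (?v div 2 * 4 + 1)) + (60 * ?c3 k + 1) + 2)
        (i, ?c3(k := 0), ?o @ double (enc_nat (?c3 k)))"
      unfolding emit_binary_def
      by (rule runs_While_True[OF _ runs_Seq[OF 1 runs_Seq[OF 2 3]] 4[unfolded emit_binary_def]])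
        (use False in simp)
    then have "runs x (emit_binary k) (i, c, out)
        (7 * c k + 8 + (3 + 2 + (?v div 2 * 4 + 1)) + (60 * (?v div 2) + 1) + 2)
        (i, c(k := 0), out @ double (enc_nat ?v))"
      unfolding enc by simp
    \<comment> \<open>The cost of a round is linear and the value is halved, so the total stays
      linear: at most \<open>39 v + 17\<close>, which is below \<open>60 v + 1\<close> for positive
      \<open>v\<close>.\<close>
    then show ?thesis
      by (rule runs_mono) (use False in linarith)
  qed
qed

lemma runs_compile:
  assumes "gen_ok leaf_vars g k" "\<And>r. r < k \<Longrightarrow> c r \<le> B" "\<And>r. k \<le> r \<Longrightarrow> c r = 0"
  shows "runs x (compile g k) (0, c, out) (gen_time g B) (0, c, out @ produce x g k c)"
  using assms
proof (induction g arbitrary: k c B out)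
  case (Leaf l)
  show ?case
  proof (cases l)
    case (Bits w)
    then show ?thesis by (simp add: runs_emit)
  next
    case (Binary a)
    have k0: "c k = 0" using Leaf by auto
    have 1: "runs x (add_exp a (k + 1) k) (0, c, out) (add_time a B) (0, c(k := aval a c), out)"
      using runs_add_exp[of a k k "k + 1" c B x 0 out] Leaf Binary k0 by simp
    have 2: "runs x (emit_binary k) (0, c(k := aval a c), out) (60 * (c(k := aval a c)) k + 1)
        (0, c(k := aval a c, k := 0), out @ double (enc_nat ((c(k := aval a c)) k)))"
      by (rule runs_emit_binary) (use Leaf in auto)
    have "runs x (compile (Leaf l) k) (0, c, out) (add_time a B + (60 * aval a c + 1))
        (0, c, out @ double (enc_nat (aval a c)))"
      using runs_Seq[OF 1 2] Binary k0 by (simp add: fun_upd_idem)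
    moreover have "aval a c \<le> bound a B"
      by (rule aval_le) (use Leaf Binary in auto)
    ultimately show ?thesis
      using Binary by (auto intro: runs_mono)
  qed
next
  case Skip
  then show ?case by (simp add: runs_Nop)
next
  case (Then g h)
  have "runs x (compile (Then g h) k) (0, c, out) (gen_time g B + gen_time h B)
      (0, c, (out @ produce x g k c) @ produce x h k c)"
    unfolding compile.simps
    by (rule runs_Seq[OF Then.IH(1) Then.IH(2)]) (use Then.prems in auto)
  then show ?case by simp
next
  case (IfEq a b g h)
  let ?a = "aval a c" and ?b = "aval b c"
  let ?m = "min ?a ?b"
  have k0: "c k = 0" "c (k + 1) = 0" "c (Suc k) = 0" using IfEq.prems by auto
  have 1: "runs x (add_exp a (k + 2) k) (0, c, out) (add_time a B) (0, c(k := ?a), out)"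
    using runs_add_exp[of a k k "k + 2" c B x 0 out] IfEq.prems k0 by simp
  have "aval b (c(k := ?a)) = ?b"
    by (rule aval_cong) (use IfEq.prems in auto)
  then have 2: "runs x (add_exp b (k + 2) (k + 1)) (0, c(k := ?a), out) (add_time b B)
      (0, c(k := ?a, k + 1 := ?b), out)"
    using runs_add_exp[of b k "k + 1" "k + 2" "c(k := ?a)" B x 0 out] IfEq.prems k0 by simp
  let ?f = "\<lambda>j. (0, c(k := ?a - j, k + 1 := ?b - j), out)"
  have 3: "runs x (While (And (NZ k) (NZ (k + 1))) (seqs (map Do [Dec k, Dec (k + 1)])))
      (?f 0) (?m * (2 + 2) + 1) (?f ?m)"
    by (rule runs_While[where f = ?f])
      (auto intro!: runs_actions' simp: fun_eq_iff min_def split: if_splits simp del: seqs.simps list.map)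
  have ab: "?a \<le> bound a B" "?b \<le> bound b B"
    by (rule aval_le; use IfEq.prems in auto)+
  let ?n = "3 * (?a + ?b) + 2 + gen_time g B + gen_time h B"
  have 4: "runs x (Cond (And (Neg (NZ k)) (Neg (NZ (k + 1)))) (compile g k)
       (Seq (clear k) (Seq (clear (k + 1)) (compile h k)))) (?f ?m) (?n + 2)
       (0, c, out @ produce x (IfEq a b g h) k c)"
  proof (rule runs_Cond)
    assume "holds_test x (And (Neg (NZ k)) (Neg (NZ (k + 1)))) (?f ?m)"
    then have eq: "?a = ?b" by (auto simp: min_def split: if_splits)
    then have "?f ?m = (0, c, out)" using k0 by (auto simp: fun_eq_iff)
    moreover have "runs x (compile g k) (0, c, out) (gen_time g B) (0, c, out @ produce x g k c)"
      by (rule IfEq.IH(1)) (use IfEq.prems in auto)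
    ultimately show "runs x (compile g k) (?f ?m) ?n (0, c, out @ produce x (IfEq a b g h) k c)"
      using eq by (auto intro: runs_mono)
  next
    assume "\<not> holds_test x (And (Neg (NZ k)) (Neg (NZ (k + 1)))) (?f ?m)"
    then have neq: "?a \<noteq> ?b" by auto
    let ?c = "c(k := ?a - ?m, k + 1 := ?b - ?m)"
    have h: "runs x (compile h k) (0, ?c(k := 0, k + 1 := 0), out) (gen_time h B)
        (0, c, out @ produce x h k c)"
      using IfEq.IH(2)[of k c B out] IfEq.prems k0
      by (simp add: fun_upd_idem fun_upd_twist)
    have "runs x (Seq (clear k) (Seq (clear (k + 1)) (compile h k))) (0, ?c, out)
      (?c k * 3 + 1 + ((?c(k := 0)) (k + 1) * 3 + 1 + gen_time h B)) (0, c, out @ produce x h k c)"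
      by (rule runs_Seq[OF runs_clear runs_Seq[OF runs_clear h]])
    moreover have "?c k * 3 + 1 + ((?c(k := 0)) (k + 1) * 3 + 1 + gen_time h B) \<le> ?n"
      by auto
    ultimately show "runs x (Seq (clear k) (Seq (clear (k + 1)) (compile h k))) (?f ?m) ?n
       (0, c, out @ produce x (IfEq a b g h) k c)"
      using neq by (auto intro: runs_mono simp del: fun_upd_apply)
  qed
  have "runs x (compile (IfEq a b g h) k) (0, c, out)
     (add_time a B + (add_time b B + (?m * (2 + 2) + 1 + (?n + 2))))
     (0, c, out @ produce x (IfEq a b g h) k c)"
    unfolding compile.simps
    by (rule runs_Seq[OF 1 runs_Seq[OF 2 runs_Seq[OF _ 4]]]) (use 3 in simp)
  then show ?case
    by (rule runs_mono) (use ab in auto)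
next
  case (IfBit a g h)
  let ?a = "aval a c"
  have k0: "c k = 0" "c (k + 1) = 0" "c (Suc k) = 0" using IfBit.prems by auto
  have 1: "runs x (add_exp a (k + 1) k) (0, c, out) (add_time a B) (0, c(k := ?a), out)"
    using runs_add_exp[of a k k "k + 1" c B x 0 out] IfBit.prems k0 by simp
  let ?f = "\<lambda>j. (int j, c(k := ?a - j, k + 1 := j), out)"
  have 2: "runs x (While (NZ k) (seqs (map Do [Dec k, Inc (k + 1), InR])))
      (?f 0) (?a * (3 + 2) + 1) (?f ?a)"
    by (rule runs_While[where f = ?f])
      (auto intro!: runs_actions' simp: fun_eq_iff simp del: seqs.simps list.map)
  have f0: "?f 0 = (0, c(k := ?a), out)" using k0 by (auto simp: fun_eq_iff)
  have fa: "?f ?a = (int ?a, c(k + 1 := ?a), out)" using k0 by (auto simp: fun_eq_iff)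
  have ret: "runs x (go_back (k + 1)) (?f ?a) (?a * 4 + 1) (0, c, out)"
    using runs_go_back[of x "k + 1" "int ?a" "c(k + 1 := ?a)" out] k0
    unfolding fa by (simp add: fun_upd_idem)
  \<comment> \<open>Beyond the input the cell is blank, so the range check of \<open>IfBit\<close>
    is implicit in the test for symbol \<open>2\<close>.\<close>
  have bit: "holds_test x InOne (?f ?a) \<longleftrightarrow> ?a < length x \<and> x ! ?a"
    by (auto simp: input_cell_def input_tape_def bit_symbol_def)
  let ?n = "?a * 4 + 1 + (gen_time g B + gen_time h B)"
  have g: "runs x (compile g k) (0, c, out) (gen_time g B + gen_time h B) (0, c, out @ produce x g k c)"
    by (rule runs_mono[OF IfBit.IH(1)]) (use IfBit.prems in auto)
  have h: "runs x (compile h k) (0, c, out) (gen_time g B + gen_time h B) (0, c, out @ produce x h k c)"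
    by (rule runs_mono[OF IfBit.IH(2)]) (use IfBit.prems in auto)
  have 3: "runs x (Cond InOne (Seq (go_back (k + 1)) (compile g k)) (Seq (go_back (k + 1)) (compile h k)))
      (?f ?a) (?n + 2) (0, c, out @ produce x (IfBit a g h) k c)"
    by (rule runs_Cond; unfold bit)
      (use runs_Seq[OF ret g] runs_Seq[OF ret h] in \<open>simp_all del: de_Morgan_conj\<close>)
  have le: "?a \<le> bound a B"
    by (rule aval_le; use IfBit.prems in auto)
  have "runs x (compile (IfBit a g h) k) (0, c, out)
     (add_time a B + (?a * (3 + 2) + 1 + (?n + 2))) (0, c, out @ produce x (IfBit a g h) k c)"
    unfolding compile.simps
    by (rule runs_Seq[OF 1 runs_Seq[OF 2[unfolded f0] 3]])
  then show ?case
    by (rule runs_mono) (use le in auto)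
next
  case (For a g)
  let ?a = "aval a c"
  have k0: "c k = 0" using For.prems by auto
  have 1: "runs x (add_exp a (k + 1) k) (0, c, out) (add_time a B) (0, c(k := ?a), out)"
    using runs_add_exp[of a k k "k + 1" c B x 0 out] For.prems k0 by simp
  have le: "?a \<le> bound a B"
    by (rule aval_le; use For.prems in auto)
  let ?o = "\<lambda>i. produce x g (Suc k) (c(k := i))"
  \<comment> \<open>After \<open>j\<close> rounds the indices from \<open>?a - j\<close> to
    \<open>?a - 1\<close> have been served, the largest first.\<close>
  let ?out = "\<lambda>j. out @ concat (map ?o (rev [?a - j..<?a]))"
  let ?f = "\<lambda>j. (0, c(k := ?a - j), ?out j)"
  let ?t = "gen_time g (B + bound a B)"
  have body: "runs x (Seq (Do (Dec k)) (compile g (Suc k))) (?f j) (1 + ?t) (?f (Suc j))"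
    if "j < ?a" for j
  proof (rule runs_Seq[OF runs_Do])
    let ?i = "?a - Suc j"
    have ij: "[?i..<?a] = ?i # [?a - j..<?a]"
      using that by (subst upt_conv_Cons) (auto simp: Suc_diff_Suc)
    have "runs x (compile g (Suc k)) (0, c(k := ?i), ?out j) ?t (0, c(k := ?i), ?out j @ ?o ?i)"
      using For.prems le that
      by (intro For.IH) (auto simp: less_Suc_eq intro: trans_le_add1)
    then show "runs x (compile g (Suc k)) (exec_action (Dec k) (?f j)) ?t (?f (Suc j))"
      unfolding ij by simp
  qed
  have 2: "runs x (While (NZ k) (Seq (Do (Dec k)) (compile g (Suc k)))) (?f 0) (?a * (1 + ?t + 2) + 1) (?f ?a)"
    by (rule runs_While[where f = ?f]) (use body in auto)
  have f0: "?f 0 = (0, c(k := ?a), out)" by simp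
  have fa: "?f ?a = (0, c, out @ produce x (For a g) k c)" using k0 by (simp add: fun_upd_idem)
  have "runs x (compile (For a g) k) (0, c, out) (add_time a B + (?a * (1 + ?t + 2) + 1))
     (0, c, out @ produce x (For a g) k c)"
    unfolding compile.simps
    by (rule runs_Seq[OF 1]) (use 2 in \<open>unfold f0 fa\<close>)
  moreover have "?a * (1 + ?t + 2) \<le> bound a B * (?t + 3)"
    using le by (intro mult_le_mono) auto
  ultimately show ?case
    by (auto intro: runs_mono)
qed

section \<open>Polynomial time bounds and the resulting machine\<close>

definition poly_bounded :: "(nat \<Rightarrow> nat) \<Rightarrow> bool" where
  "poly_bounded f \<longleftrightarrow> (\<exists>p :: nat poly. \<forall>n. f n \<le> poly p n)"

text \<open>Natural coefficients make polynomials monotone, which is what bounds on compositions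
  rely on.\<close>

lemma poly_mono_nat: "m \<le> n \<Longrightarrow> poly (p :: nat poly) m \<le> poly p n"
  by (induction p) (auto intro: add_mono mult_le_mono)

lemma poly_bounded_const [intro]: "poly_bounded (\<lambda>n. c)"
  unfolding poly_bounded_def by (intro exI[of _ "[:c:]"]) auto

lemma poly_bounded_id [intro]: "poly_bounded (\<lambda>n. n)"
  unfolding poly_bounded_def by (intro exI[of _ "[:0, 1:]"]) auto

lemma poly_bounded_add [intro]:
  assumes "poly_bounded f" "poly_bounded g"
  shows "poly_bounded (\<lambda>n. f n + g n)"
proof -
  obtain p q :: "nat poly" where "\<forall>n. f n \<le> poly p n" "\<forall>n. g n \<le> poly q n"
    using assms unfolding poly_bounded_def by blast
  then show ?thesis
    unfolding poly_bounded_def by (intro exI[of _ "p + q"]) (auto intro: add_mono)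
qed

lemma poly_bounded_mult [intro]:
  assumes "poly_bounded f" "poly_bounded g"
  shows "poly_bounded (\<lambda>n. f n * g n)"
proof -
  obtain p q :: "nat poly" where "\<forall>n. f n \<le> poly p n" "\<forall>n. g n \<le> poly q n"
    using assms unfolding poly_bounded_def by blast
  then show ?thesis
    unfolding poly_bounded_def by (intro exI[of _ "p * q"]) (auto intro: mult_le_mono)
qed

lemma poly_bounded_Suc [intro]: "poly_bounded f \<Longrightarrow> poly_bounded (\<lambda>n. Suc (f n))"
  using poly_bounded_add[of f "\<lambda>_. 1"] by auto

lemma poly_bounded_compose:
  assumes "poly_bounded f" "poly_bounded g"
  shows "poly_bounded (\<lambda>n. f (g n))"
proof -
  obtain p q :: "nat poly" where p: "\<forall>n. f n \<le> poly p n" and q: "\<forall>n. g n \<le> poly q n"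
    using assms unfolding poly_bounded_def by blast
  have "f (g n) \<le> poly (pcompose p q) n" for n
    using p poly_mono_nat[of "g n" "poly q n" p] q by (auto simp: poly_pcompose intro: le_trans)
  then show ?thesis unfolding poly_bounded_def by blast
qed

lemma poly_bounded_bound: "poly_bounded (bound a)"
  by (induction a) auto

lemma poly_bounded_add_time: "poly_bounded (add_time a)"
  by (induction a) (auto intro!: poly_bounded_Suc poly_bounded_add poly_bounded_mult poly_bounded_bound)

lemma poly_bounded_gen_time: "poly_bounded (gen_time g)"
proof (induction g)
  case (Leaf l)
  then show ?case
    by (cases l) (auto intro!: poly_bounded_Suc poly_bounded_add poly_bounded_mult poly_bounded_bound poly_bounded_add_time)
next
  case (For a g)
  have "poly_bounded (\<lambda>B. gen_time g (B + bound a B))"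
    by (intro poly_bounded_compose[OF For.IH] poly_bounded_add poly_bounded_id poly_bounded_bound)
  then show ?case
    by (auto intro!: poly_bounded_Suc poly_bounded_add poly_bounded_mult poly_bounded_bound poly_bounded_add_time)
qed (auto intro!: poly_bounded_Suc poly_bounded_add poly_bounded_mult poly_bounded_bound poly_bounded_add_time)

lemma jump_le_mono: "jump_le m I \<Longrightarrow> m \<le> n \<Longrightarrow> jump_le n I"
  by (cases I) auto

lemma jump_le_code: "I \<in> set (code b p) \<Longrightarrow> jump_le (b + length (code b p)) I"
  by (induction p arbitrary: b) (fastforce simp: Let_def intro: jump_le_mono)+

definition initial_env :: "nat \<Rightarrow> nat \<Rightarrow> nat" where
  "initial_env n = (\<lambda>_. 0)(0 := n)"

text \<open>Register \<open>1\<close> counts along only to bring the head back, and is zero again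
  afterwards.\<close>

definition count_input :: prog where
  "count_input = Seq (While (Neg InBlank) (seqs (map Do [InR, Inc 0, Inc 1]))) (go_back 1)"

lemma runs_count_input:
  "runs x count_input (0, (\<lambda>_. 0), []) (9 * length x + 2) (0, initial_env (length x), [])"
proof -
  let ?n = "length x"
  let ?f = "\<lambda>j. (int j, (\<lambda>_. 0)(0 := j, 1 := j), [])"
  have 1: "runs x (While (Neg InBlank) (seqs (map Do [InR, Inc 0, Inc 1])))
      (?f 0) (?n * (3 + 2) + 1) (?f ?n)"
    by (rule runs_While[where f = ?f])
      (auto intro!: runs_actions' simp: fun_eq_iff input_cell_def input_tape_def bit_symbol_def
        simp del: seqs.simps list.map)
  have "runs x (go_back 1) (?f ?n) (?n * 4 + 1) (0, initial_env ?n, [])"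
    using runs_go_back[of x 1 "int ?n" "(\<lambda>_. 0)(0 := ?n, 1 := ?n)" "[]"]
    by (simp add: initial_env_def fun_upd_idem)
  from runs_Seq[OF 1 this] show ?thesis
    unfolding count_input_def by (auto intro: runs_mono simp: fun_upd_idem)
qed

theorem polytime_gen:
  assumes "gen_ok leaf_vars g 1"
  shows "polytime (\<lambda>x. produce x g 1 (initial_env (length x)))"
proof -
  define p where "p = Seq count_input (compile g 1)"
  define P where "P = code 0 p"
  define K where "K = sum_list (map instr_regs P)"
  let ?M = "counter_tm K P"
  have regs: "\<forall>I\<in>set P. instr_regs I \<le> K"
    unfolding K_def by (auto intro: member_le_sum_list)
  have "wf_tm ?M"
    by (rule wf_counter_tm) (use jump_le_code[of _ 0 p] in \<open>auto simp: P_def\<close>)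
  moreover have "\<exists>t\<le>9 * length x + 3 + gen_time g (length x).
      halts_with ?M x t (produce x g 1 (initial_env (length x)))" for x
  proof -
    let ?e = "initial_env (length x)" and ?n = "length x"
    have "runs x (compile g 1) (0, ?e, []) (gen_time g ?n) (0, ?e, [] @ produce x g 1 ?e)"
      by (rule runs_compile) (use assms in \<open>auto simp: initial_env_def\<close>)
    from runs_Seq[OF runs_count_input this]
    have "runs x p (0, (\<lambda>_. 0), []) (9 * ?n + 2 + gen_time g ?n) (0, ?e, produce x g 1 ?e)"
      by (simp add: p_def)
    then obtain t where t: "t \<le> 9 * ?n + 2 + gen_time g ?n"
      "(instr_step x P ^^ t) (0, (0, (\<lambda>_. 0), [])) = (length P, (0, ?e, produce x g 1 ?e))"
      by (rule runs_at[where pre = "[]" and post = "[]" and b = 0]) (auto simp: P_def)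
    \<comment> \<open>One step more than the program takes, for writing the marks.\<close>
    have "(step ?M ^^ (t + 1)) (init_config ?M x) = tm_config x K (length P, (0, ?e, produce x g 1 ?e))"
      unfolding funpow_add comp_apply using t(2)
      by (simp add: init_counter_tm steps_counter_tm[OF regs])
    then have "halts_with ?M x (t + 1) (produce x g 1 ?e)"
      by (auto simp: halts_with_def tm_config_def counter_tm_def holds_string_def tape_of_def
          input_tape_def nth_append simp del: upt_Suc funpow.simps)
    with t(1) show ?thesis by (intro exI[of _ "t + 1"]) auto
  qed
  moreover have "poly_bounded (\<lambda>n. 9 * n + 3 + gen_time g n)"
    by (intro poly_bounded_add poly_bounded_mult poly_bounded_const poly_bounded_id poly_bounded_gen_time)
  then obtain q :: "nat poly" where "\<And>n. 9 * n + 3 + gen_time g n \<le> poly q n"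
    unfolding poly_bounded_def by blast
  ultimately show ?thesis
    unfolding polytime_def by (meson le_trans)
qed

section \<open>Subset sum as a rank problem\<close>

text \<open>The index whose \<open>binvec\<close> is the characteristic vector of the given set;
  coordinate \<open>i\<close> is bit \<open>n - 1 - i\<close> as the most significant bit comes
  first.\<close>

definition subset_code :: "nat \<Rightarrow> nat set \<Rightarrow> nat" where
  "subset_code n = the_inv_into {..<2 ^ n} (\<lambda>k. {i. i < n \<and> bit k (n - 1 - i)})"

lemma bij_betw_binvec_support:
  "bij_betw (\<lambda>k :: nat. {i. i < n \<and> bit k (n - 1 - i)}) {..<2 ^ n} (Pow {..<n})"
proof -
  let ?d = "\<lambda>k :: nat. {i. i < n \<and> bit k (n - 1 - i)}"
  have "inj_on ?d {..<2 ^ n}"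
  proof (rule inj_onI, rule bit_eqI)
    fix k l b :: nat
    assume kl: "k \<in> {..<2 ^ n}" "l \<in> {..<2 ^ n}" "?d k = ?d l"
    show "bit k b = bit l b"
    proof (cases "b < n")
      case True
      then have "n - 1 - b \<in> ?d k \<longleftrightarrow> n - 1 - b \<in> ?d l" using kl(3) by simp
      with True show ?thesis by auto
    next
      case False
      have "take_bit n k = k" "take_bit n l = l"
        using kl by (auto intro: take_bit_nat_eq_self)
      with False show ?thesis by (metis bit_take_bit_iff)
    qed
  qed
  \<comment> \<open>Injectivity suffices, since both sides have \<open>2 ^ n\<close>
    elements.\<close>
  moreover from this have "?d ` {..<2 ^ n} = Pow {..<n}"
    by (intro card_subset_eq) (auto simp: card_image card_Pow)
  ultimately show ?thesis by (simp add: bij_betw_def)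
qed

lemma subset_code:
  assumes "X \<subseteq> {..<n}"
  shows "subset_code n X < 2 ^ n" "i < n \<Longrightarrow> bit (subset_code n X) (n - 1 - i) \<longleftrightarrow> i \<in> X"
proof -
  let ?d = "\<lambda>k :: nat. {i. i < n \<and> bit k (n - 1 - i)}"
  have X: "X \<in> ?d ` {..<2 ^ n}" and inj: "inj_on ?d {..<2 ^ n}"
    using bij_betw_binvec_support[of n] assms by (auto simp: bij_betw_def)
  show "subset_code n X < 2 ^ n"
    using the_inv_into_into[OF inj X order.refl] by (simp add: subset_code_def)
  have "?d (subset_code n X) = X"
    unfolding subset_code_def by (rule f_the_inv_into_f[OF inj X])
  then show "i < n \<Longrightarrow> bit (subset_code n X) (n - 1 - i) \<longleftrightarrow> i \<in> X"
    by blast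
qed

lemma dim_corr_sum [simp]: "dim_row (corr_sum n p) = n" "dim_col (corr_sum n p) = n"
  by (simp_all add: corr_sum_def)

lemma corr_sum_index:
  assumes "i < n" "j < n"
  shows "corr_sum n p $$ (i, j) =
    (\<Sum>k<2 ^ n. p $ k * of_bool (bit k (n - 1 - i) \<and> bit k (n - 1 - j)))"
proof -
  have eq: "{0..2 ^ n - Suc 0} = {..<(2 :: nat) ^ n}"
    unfolding atLeast0AtMost lessThan_Suc_atMost[symmetric] by simp
  show ?thesis
    using assms by (simp add: corr_sum_def outer_def binvec_def eq flip: of_bool_conj)
qed

text \<open>Lets decompositions be given by weighted families of sets. Members of the family may
  coincide; their weights then add up, which can only lower the number of nonzero
  components.\<close>

lemma corr_sum_family:
  fixes w :: "'e \<Rightarrow> real"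
  assumes fin: "finite E" and w: "\<And>e. e \<in> E \<Longrightarrow> 0 \<le> w e" and X: "\<And>e. e \<in> E \<Longrightarrow> X e \<subseteq> {..<n}"
  obtains p where "p \<in> carrier_vec (2 ^ n)" "0\<^sub>v (2 ^ n) \<le> p" "nnz p \<le> card {e \<in> E. w e \<noteq> 0}"
    "\<And>i j. i < n \<Longrightarrow> j < n \<Longrightarrow>
      corr_sum n p $$ (i, j) = (\<Sum>e\<in>E. w e * of_bool (i \<in> X e \<and> j \<in> X e))"
proof
  let ?c = "\<lambda>e. subset_code n (X e)"
  let ?p = "vec (2 ^ n) (\<lambda>k. sum w {e \<in> E. ?c e = k})"
  show "?p \<in> carrier_vec (2 ^ n)" by simp
  show "0\<^sub>v (2 ^ n) \<le> ?p"
    using w by (auto simp: less_eq_vec_def intro!: sum_nonneg)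
  have "{k. k < dim_vec ?p \<and> ?p $ k \<noteq> 0} \<subseteq> ?c ` {e \<in> E. w e \<noteq> 0}"
    by (force dest: sum.not_neutral_contains_not_neutral)
  then have "nnz ?p \<le> card (?c ` {e \<in> E. w e \<noteq> 0})"
    unfolding nnz_def using fin by (intro card_mono) auto
  also have "\<dots> \<le> card {e \<in> E. w e \<noteq> 0}"
    using fin by (intro card_image_le) auto
  finally show "nnz ?p \<le> card {e \<in> E. w e \<noteq> 0}" .
  fix i j assume ij: "i < n" "j < n"
  let ?h = "\<lambda>e. w e * of_bool (i \<in> X e \<and> j \<in> X e)"
  have "?p $ k * of_bool (bit k (n - 1 - i) \<and> bit k (n - 1 - j)) = sum ?h {e \<in> E. ?c e = k}"
    if "k < 2 ^ n" for k
  proof -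
    have "sum ?h {e \<in> E. ?c e = k} =
        (\<Sum>e\<in>{e \<in> E. ?c e = k}. w e * of_bool (bit k (n - 1 - i) \<and> bit k (n - 1 - j)))"
      using subset_code(2)[OF X] ij by (intro sum.cong) auto
    then show ?thesis using that by (simp add: sum_distrib_right)
  qed
  then have "corr_sum n ?p $$ (i, j) = (\<Sum>k<2 ^ n. sum ?h {e \<in> E. ?c e = k})"
    using ij by (simp add: corr_sum_index)
  also have "\<dots> = sum ?h E"
    using fin subset_code(1)[OF X] by (intro sum.group) auto
  finally show "corr_sum n ?p $$ (i, j) = sum ?h E" .
qed

text \<open>
  Row \<open>i < m\<close> belongs to the item \<open>as ! i\<close>, and the last two rows are called \<open>y\<close>
  and \<open>z\<close>. Since different items exclude each other, item \<open>i\<close> is spread over the four sets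
  \<open>{i}\<close>, \<open>{i,y}\<close>, \<open>{i,z}\<close>, \<open>{i,y,z}\<close>, with weights \<open>t, as!i - t, as!i - t, t\<close>
  for some \<open>t\<close>. Only two of them have nonzero weight iff \<open>t\<close> is \<open>0\<close> or \<open>as!i\<close>, and
  \<open>{y,z}\<close> has weight \<open>0\<close> iff the numbers \<open>t\<close> sum up to \<open>T\<close>.
\<close>

definition gadget_entry :: "nat list \<Rightarrow> nat \<Rightarrow> nat \<Rightarrow> nat \<Rightarrow> nat \<Rightarrow> nat" where
  "gadget_entry as T B i j = (let m = length as in
     if i < m then (if j < m then (if i = j then 2 * as ! i else 0) else as ! i)
     else if j < m then as ! j
     else if i = j then B else T)"

definition gadget :: "nat list \<Rightarrow> nat \<Rightarrow> nat \<Rightarrow> rat mat" where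
  "gadget as T B = mat (length as + 2) (length as + 2) (\<lambda>(i, j). of_nat (gadget_entry as T B i j))"

text \<open>\<open>S\<close> need not reach the target, because weight on \<open>{y,z}\<close> makes
  up for the difference. Thus \<open>S = {}\<close> settles the promise, while a solution
  \<open>S\<close> saves the vector \<open>{y,z}\<close>.\<close>

lemma gadget_family:
  assumes S: "S \<subseteq> {..<length as}" "(\<Sum>i\<in>S. as ! i) \<le> T" and B: "sum_list as + T \<le> B"
  obtains p where "p \<in> carrier_vec (2 ^ (length as + 2))" "0\<^sub>v (2 ^ (length as + 2)) \<le> p"
    "map_mat real_of_rat (gadget as T B) = corr_sum (length as + 2) p"
    "(\<Sum>i\<in>S. as ! i) = T \<Longrightarrow> nnz p \<le> 2 * length as + 2"
proof -
  let ?m = "length as"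
  define r where "r = T - (\<Sum>i\<in>S. as ! i)"
  \<comment> \<open>The weight of \<open>{y}\<close> and of \<open>{z}\<close>: the items contribute
    their whole sum to both diagonal entries, \<open>{y,z}\<close> contributes \<open>r\<close>, and
    \<open>s\<close> fills up to \<open>B\<close>.\<close>
  define s where "s = B - sum_list as - r"
  define E where "E = {..<?m} \<times> {0, 1 :: nat} \<union> {(?m, 0), (?m, 1), (?m, 2)}"
  define X where "X = (\<lambda>(i, b :: nat).
     if i < ?m then (if i \<in> S then (if b = 0 then {i, ?m, ?m + 1} else {i})
        else (if b = 0 then {i, ?m} else {i, ?m + 1}))
     else (if b = 0 then {?m} else if b = 1 then {?m + 1} else {?m, ?m + 1}))"
  define w where "w = (\<lambda>(i, b :: nat). real (if i < ?m then as ! i else if b = 2 then r else s))"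
  have fin: "finite E" by (simp add: E_def)
  have sumE: "(\<Sum>e\<in>E. f e) = (\<Sum>i<?m. f (i, 0) + f (i, 1)) + (f (?m, 0) + f (?m, 1) + f (?m, 2))"
    for f :: "nat \<times> nat \<Rightarrow> real"
  proof -
    have "(\<Sum>e\<in>{..<?m} \<times> {0, 1 :: nat}. f e) = (\<Sum>i<?m. f (i, 0) + f (i, 1))"
      using sum.cartesian_product[of "\<lambda>i b. f (i, b)" "{0, 1}" "{..<?m}"] by (simp add: case_prod_eta)
    then show ?thesis
      unfolding E_def by (subst sum.union_disjoint) (auto simp: add.assoc)
  qed
  obtain p where p: "p \<in> carrier_vec (2 ^ (?m + 2))" "0\<^sub>v (2 ^ (?m + 2)) \<le> p"
    "nnz p \<le> card {e \<in> E. w e \<noteq> 0}"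
    "\<And>i j. i < ?m + 2 \<Longrightarrow> j < ?m + 2 \<Longrightarrow>
      corr_sum (?m + 2) p $$ (i, j) = (\<Sum>e\<in>E. w e * of_bool (i \<in> X e \<and> j \<in> X e))"
    by (rule corr_sum_family[OF fin, of w X "?m + 2"])
      (auto simp: E_def w_def X_def split: if_splits)
  have A: "(\<Sum>i<?m. real (as ! i)) = real (sum_list as)"
    by (simp add: sum_list_sum_nth atLeast0LessThan)
  have AS: "(\<Sum>i<?m. if i \<in> S then real (as ! i) else 0) = real (\<Sum>i\<in>S. as ! i)"
    using S(1) by (simp add: sum.If_cases Int_absorb1)
  have rs: "real r = real T - real (\<Sum>i\<in>S. as ! i)" "real s = real B - real (sum_list as) - real r"
    using S(2) B by (auto simp: r_def s_def)
  have entry: "(\<Sum>e\<in>E. w e * of_bool (i \<in> X e \<and> j \<in> X e)) = real (gadget_entry as T B i j)"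
    if ij: "i < ?m + 2" "j < ?m + 2" for i j
  proof -
    have single: "(\<Sum>k<?m. if k = i then f k else 0) = f i" if "i < ?m" for i and f :: "nat \<Rightarrow> real"
      using that by (simp add: sum.delta')
    have *: "(\<Sum>k<?m. w (k, 0) * of_bool (i \<in> X (k, 0) \<and> j \<in> X (k, 0))
           + w (k, 1) * of_bool (i \<in> X (k, 1) \<and> j \<in> X (k, 1))) =
      (if i < ?m then (if j < ?m then (if i = j then 2 * real (as ! i) else 0) else real (as ! i))
       else if j < ?m then real (as ! j) else if i = j then real (sum_list as)
       else real (\<Sum>i\<in>S. as ! i))" (is "?L = ?R")
    proof -
      have "?L = (\<Sum>k<?m. if i < ?m then
            (if k = i then (if j < ?m then (if i = j then 2 * real (as ! i) else 0) else real (as ! i)) else 0)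
          else if j < ?m then (if k = j then real (as ! j) else 0)
          else if i = j then real (as ! k) else (if k \<in> S then real (as ! k) else 0))"
        using ij by (intro sum.cong) (auto simp: w_def X_def)
      also have "\<dots> = ?R"
        by (auto simp: A AS)
      finally show ?thesis .
    qed
    show ?thesis
      unfolding sumE * gadget_entry_def Let_def
      using ij rs by (auto simp: w_def X_def)
  qed
  have "map_mat real_of_rat (gadget as T B) = corr_sum (?m + 2) p"
  proof (rule eq_matI)
    fix i j assume "i < dim_row (corr_sum (?m + 2) p)" "j < dim_col (corr_sum (?m + 2) p)"
    then have ij: "i < ?m + 2" "j < ?m + 2" by simp_all
    have "corr_sum (?m + 2) p $$ (i, j) = real (gadget_entry as T B i j)"
      unfolding p(4)[OF ij] by (rule entry[OF ij])
    then show "map_mat real_of_rat (gadget as T B) $$ (i, j) = corr_sum (?m + 2) p $$ (i, j)"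
      using ij by (simp add: gadget_def)
  qed (simp_all add: gadget_def)
  moreover have "nnz p \<le> 2 * ?m + 2" if "(\<Sum>i\<in>S. as ! i) = T"
  proof -
    have "{e \<in> E. w e \<noteq> 0} \<subseteq> {..<?m} \<times> {0, 1 :: nat} \<union> {(?m, 0), (?m, 1)}"
      using that by (auto simp: E_def w_def r_def)
    then have "card {e \<in> E. w e \<noteq> 0} \<le> card ({..<?m} \<times> {0, 1 :: nat} \<union> {(?m, 0), (?m, 1)})"
      by (intro card_mono) auto
    also have "\<dots> = 2 * ?m + 2"
      by (subst card_Un_disjoint) auto
    finally show ?thesis using p(3) by simp
  qed
  ultimately show ?thesis using that p by blast
qed

lemma gadget_promise:
  assumes "sum_list as + T \<le> B"
  shows "(2 * length as + 2, gadget as T B) \<in> rank_promise"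
proof -
  let ?n = "length as + 2"
  obtain p where "p \<in> carrier_vec (2 ^ ?n)" "0\<^sub>v (2 ^ ?n) \<le> p"
    "map_mat real_of_rat (gadget as T B) = corr_sum ?n p"
    by (rule gadget_family[of "{}" as T B]) (use assms in auto)
  then have "map_mat real_of_rat (gadget as T B) \<in> corr_cone ?n"
    by (auto simp: corr_cone_def)
  moreover have "gadget as T B \<in> carrier_mat ?n ?n" "(gadget as T B)\<^sup>T = gadget as T B"
    by (auto simp: gadget_def gadget_entry_def Let_def)
  ultimately show ?thesis
    unfolding rank_promise_def by (auto intro!: exI[of _ ?n])
qed

section \<open>Counting the vectors of an arbitrary decomposition\<close>

lemma three_classes_card:
  assumes "finite D" "{k \<in> D. P k \<and> Q k} \<noteq> {}" "{k \<in> D. P k \<and> \<not> Q k} \<noteq> {}" "{k \<in> D. \<not> P k} \<noteq> {}"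
  shows "3 \<le> card D"
proof -
  obtain a b c where "a \<in> D" "P a" "Q a" "b \<in> D" "P b" "\<not> Q b" "c \<in> D" "\<not> P c"
    using assms by blast
  then have "{a, b, c} \<subseteq> D" "card {a, b, c} = 3" by (auto simp: card_insert_if)
  then show ?thesis using assms(1) by (metis card_mono)
qed

text \<open>The zero entries keep the vectors of different items apart. Every item needs a vector
  with \<open>y\<close> and one without; \<open>{y}\<close> and \<open>{z}\<close> are needed
  because \<open>B\<close> exceeds what the items and \<open>T\<close> can supply. This exhausts the
  budget, so \<open>{y,z}\<close> does not occur and every item has exactly two vectors, which
  forces its weight on \<open>{i,y,z}\<close> to an extreme.\<close>

lemma gadget_subset:
  assumes pos: "\<forall>a\<in>set as. 0 < a" and B: "sum_list as + T < B"
    and p: "p \<in> carrier_vec (2 ^ (length as + 2))" "0\<^sub>v (2 ^ (length as + 2)) \<le> p"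
    and G: "map_mat real_of_rat (gadget as T B) = corr_sum (length as + 2) p"
    and nnz: "nnz p \<le> 2 * length as + 2"
  shows "\<exists>S\<subseteq>{..<length as}. (\<Sum>i\<in>S. as ! i) = T"
proof -
  let ?m = "length as"
  let ?n = "?m + 2"
  let ?z = "?m + 1"
  define K where "K = (\<lambda>i (k :: nat). bit k (?n - 1 - i))"
  define supp where "supp = {k. k < 2 ^ ?n \<and> p $ k \<noteq> 0}"
  define \<mu> where "\<mu> = (\<lambda>Q. \<Sum>k\<in>{k \<in> supp. Q k}. p $ k)"
  have fin: "finite supp" by (simp add: supp_def)
  have ppos: "0 < p $ k" if "k \<in> supp" for k
    using p that by (auto simp: less_eq_vec_def supp_def less_le)
  have nonneg: "0 \<le> \<mu> Q" for Q
    unfolding \<mu>_def using ppos by (intro sum_nonneg) (auto simp: less_imp_le)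
  have zero: "\<mu> Q = 0 \<longleftrightarrow> {k \<in> supp. Q k} = {}" for Q
  proof -
    have "\<mu> Q = 0 \<longleftrightarrow> (\<forall>k\<in>{k \<in> supp. Q k}. p $ k = 0)"
      unfolding \<mu>_def using ppos fin by (intro sum_nonneg_eq_0_iff) (auto simp: less_imp_le)
    then show ?thesis using ppos by fastforce
  qed
  have split: "\<mu> Q = \<mu> (\<lambda>k. Q k \<and> R k) + \<mu> (\<lambda>k. Q k \<and> \<not> R k)" for Q R
    unfolding \<mu>_def using fin by (subst sum.union_disjoint[symmetric]) (auto intro!: sum.cong)
  have mono: "\<mu> Q \<le> \<mu> R" if "\<And>k. Q k \<Longrightarrow> R k" for Q R
    unfolding \<mu>_def using fin that ppos by (intro sum_mono2) (auto simp: less_imp_le)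
  have \<mu>: "\<mu> (\<lambda>k. K i k \<and> K j k) = real (gadget_entry as T B i j)" if "i < ?n" "j < ?n" for i j
  proof -
    have "real (gadget_entry as T B i j) = map_mat real_of_rat (gadget as T B) $$ (i, j)"
      using that by (simp add: gadget_def)
    also have "\<dots> = (\<Sum>k<2 ^ ?n. p $ k * of_bool (K i k \<and> K j k))"
      unfolding G K_def using that by (rule corr_sum_index)
    also have "\<dots> = \<mu> (\<lambda>k. K i k \<and> K j k)"
      unfolding \<mu>_def by (rule sum.mono_neutral_cong_right) (auto simp: supp_def)
    finally show ?thesis ..
  qed
  have \<mu>2: "\<mu> (K i) = real (gadget_entry as T B i i)" if "i < ?n" for i
    using \<mu>[OF that that] by simp
  define none where "none = (\<lambda>k. \<forall>i<?m. \<not> K i k)"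
  define D where "D = (\<lambda>i. {k \<in> supp. K i k})"
  define t where "t = (\<lambda>i. \<mu> (\<lambda>k. K i k \<and> K ?m k \<and> K ?z k))"
  \<comment> \<open>Weights in the support are positive, so a zero entry excludes any vector
    containing both items.\<close>
  have disj: "\<not> (K i k \<and> K j k)" if "i < ?m" "j < ?m" "i \<noteq> j" "k \<in> supp" for i j k
    using \<mu>[of i j] zero[of "\<lambda>k. K i k \<and> K j k"] that by (auto simp: gadget_entry_def)
  have total: "\<mu> Q = (\<Sum>i<?m. \<mu> (\<lambda>k. K i k \<and> Q k)) + \<mu> (\<lambda>k. none k \<and> Q k)" for Q
  proof -
    have eq: "{k \<in> supp. Q k} = (\<Union>i<?m. {k \<in> supp. K i k \<and> Q k}) \<union> {k \<in> supp. none k \<and> Q k}"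
      by (auto simp: none_def)
    have "sum (($) p) (\<Union>i<?m. {k \<in> supp. K i k \<and> Q k}) = (\<Sum>i<?m. \<mu> (\<lambda>k. K i k \<and> Q k))"
      unfolding \<mu>_def using fin disj by (subst sum.UNION_disjoint) auto
    moreover have "\<mu> Q = sum (($) p) (\<Union>i<?m. {k \<in> supp. K i k \<and> Q k})
        + sum (($) p) {k \<in> supp. none k \<and> Q k}"
      unfolding \<mu>_def eq using fin by (subst sum.union_disjoint) (auto simp: none_def)
    ultimately show ?thesis by (simp add: \<mu>_def)
  qed
  have tcase: "2 \<le> card (D i) \<and> (card (D i) \<le> 2 \<longrightarrow> t i = 0 \<or> t i = real (as ! i))" if i: "i < ?m" for i
  proof -
    have a: "0 < as ! i" using pos i by simp
    have e: "\<mu> (K i) = 2 * real (as ! i)" "\<mu> (\<lambda>k. K i k \<and> K ?m k) = real (as ! i)"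
      "\<mu> (\<lambda>k. K i k \<and> K ?z k) = real (as ! i)"
      using i \<mu>2[of i] \<mu>[of i ?m] \<mu>[of i ?z] by (auto simp: gadget_entry_def)
    have y: "\<mu> (\<lambda>k. K i k \<and> \<not> K ?m k) = real (as ! i)"
      using split[of "K i" "K ?m"] e by simp
    have yz: "\<mu> (\<lambda>k. K i k \<and> K ?m k \<and> \<not> K ?z k) = real (as ! i) - t i"
      using split[of "\<lambda>k. K i k \<and> K ?m k" "K ?z"] e by (simp add: t_def conj_assoc)
    obtain k l where "k \<in> D i" "K ?m k" "l \<in> D i" "\<not> K ?m l"
      using zero[of "\<lambda>k. K i k \<and> K ?m k"] zero[of "\<lambda>k. K i k \<and> \<not> K ?m k"] e y a
      unfolding D_def by auto
    then have "{k, l} \<subseteq> D i" "card {k, l} = 2" by (auto simp: card_insert_if)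
    moreover have finD: "finite (D i)" using fin by (simp add: D_def)
    ultimately have "2 \<le> card (D i)" by (metis card_mono)
    \<comment> \<open>Away from the extremes the vectors containing \<open>y\<close> occur both with
      and without \<open>z\<close>, and those without \<open>y\<close> form a third class.\<close>
    moreover have "3 \<le> card (D i)" if t: "t i \<noteq> 0" "t i \<noteq> real (as ! i)"
    proof (rule three_classes_card[OF finD, of "K ?m" "K ?z"])
      show "{k \<in> D i. K ?m k \<and> K ?z k} \<noteq> {}"
        using t zero[of "\<lambda>k. K i k \<and> K ?m k \<and> K ?z k"] by (auto simp: t_def D_def)
      show "{k \<in> D i. K ?m k \<and> \<not> K ?z k} \<noteq> {}"
        using t yz zero[of "\<lambda>k. K i k \<and> K ?m k \<and> \<not> K ?z k"] by (auto simp: D_def)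
      show "{k \<in> D i. \<not> K ?m k} \<noteq> {}"
        using y a zero[of "\<lambda>k. K i k \<and> \<not> K ?m k"] by (auto simp: D_def)
    qed
    ultimately show ?thesis by fastforce
  qed
  have A: "(\<Sum>i<?m. real (as ! i)) = real (sum_list as)"
    by (simp add: sum_list_sum_nth atLeast0LessThan)
  have T: "\<mu> (\<lambda>k. K ?m k \<and> K ?z k) = real T"
    using \<mu>[of ?m ?z] by (simp add: gadget_entry_def)
  have hub: "0 < \<mu> (\<lambda>k. none k \<and> K u k \<and> \<not> K v k)"
    if uv: "u = ?m \<and> v = ?z \<or> u = ?z \<and> v = ?m" for u v
  proof -
    have "\<mu> (\<lambda>k. K i k \<and> K u k) = real (as ! i)" if "i < ?m" for i
      using that uv by (subst \<mu>) (auto simp: gadget_entry_def)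
    then have "(\<Sum>i<?m. \<mu> (\<lambda>k. K i k \<and> K u k)) = real (sum_list as)"
      using A by simp
    moreover have "\<mu> (K u) = real B"
      using uv by (subst \<mu>2) (auto simp: gadget_entry_def)
    ultimately have "\<mu> (\<lambda>k. none k \<and> K u k) = real B - real (sum_list as)"
      using total[of "K u"] by simp
    moreover have "\<mu> (\<lambda>k. (none k \<and> K u k) \<and> K v k) \<le> \<mu> (\<lambda>k. K ?m k \<and> K ?z k)"
      using uv by (intro mono) auto
    \<comment> \<open>Outside the items \<open>u\<close> still carries \<open>B\<close> minus the
      sum of the numbers, of which at most \<open>T\<close> is shared with \<open>v\<close>.\<close>
    ultimately have "real B - real (sum_list as) - real T \<le> \<mu> (\<lambda>k. none k \<and> K u k \<and> \<not> K v k)"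
      using split[of "\<lambda>k. none k \<and> K u k" "K v"] T by (simp add: conj_assoc)
    with B show ?thesis by simp
  qed
  define Y Z W where "Y = {k \<in> supp. none k \<and> K ?m k \<and> \<not> K ?z k}"
    and "Z = {k \<in> supp. none k \<and> K ?z k \<and> \<not> K ?m k}"
    and "W = {k \<in> supp. none k \<and> K ?m k \<and> K ?z k}"
  have finYZW: "finite Y" "finite Z" "finite W" using fin by (auto simp: Y_def Z_def W_def)
  have "Y \<noteq> {}" "Z \<noteq> {}"
    using hub[of ?m ?z] hub[of ?z ?m] zero[of "\<lambda>k. none k \<and> K ?m k \<and> \<not> K ?z k"]
      zero[of "\<lambda>k. none k \<and> K ?z k \<and> \<not> K ?m k"] by (auto simp: Y_def Z_def)
  then have YZ: "1 \<le> card Y" "1 \<le> card Z"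
    using finYZW by (auto simp: Suc_le_eq card_gt_0_iff)
  have cardU: "card (\<Union>i<?m. D i) = (\<Sum>i<?m. card (D i))"
    using fin disj by (intro card_UN_disjoint) (auto simp: D_def)
  have "card ((\<Union>i<?m. D i) \<union> (Y \<union> (Z \<union> W))) = (\<Sum>i<?m. card (D i)) + (card Y + (card Z + card W))"
    using fin finYZW
    by (subst card_Un_disjoint; (subst card_Un_disjoint)?; (subst card_Un_disjoint)?)
      (auto simp: cardU, auto simp: D_def Y_def Z_def W_def none_def)
  moreover have "card ((\<Union>i<?m. D i) \<union> (Y \<union> (Z \<union> W))) \<le> card supp"
    using fin by (intro card_mono) (auto simp: D_def Y_def Z_def W_def)
  moreover have "card supp = nnz p"
    using p by (simp add: nnz_def supp_def)
  \<comment> \<open>The sets \<open>Y\<close> and \<open>Z\<close> use up two vectors of the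
    budget.\<close>
  ultimately have le: "(\<Sum>i<?m. card (D i)) + card W \<le> 2 * ?m"
    using nnz YZ by linarith
  moreover have ge: "(\<Sum>i<?m. 2 :: nat) \<le> (\<Sum>i<?m. card (D i))"
    using tcase by (intro sum_mono) auto
  ultimately have "card W = 0" by simp
  then have "W = {}" using finYZW by simp
  have D2: "card (D i) \<le> 2" if "i < ?m" for i
  proof (rule ccontr)
    assume "\<not> ?thesis"
    then have "(\<Sum>i<?m. 2 :: nat) < (\<Sum>i<?m. card (D i))"
      using that tcase by (intro sum_strict_mono_ex1) (auto intro!: bexI[of _ i])
    with le show False by simp
  qed
  \<comment> \<open>Without \<open>{y,z}\<close> the entry \<open>T\<close> is carried by the items
    alone.\<close>
  have "\<mu> (\<lambda>k. none k \<and> K ?m k \<and> K ?z k) = 0"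
    using \<open>W = {}\<close> zero by (simp add: W_def)
  then have sumt: "(\<Sum>i<?m. t i) = real T"
    using total[of "\<lambda>k. K ?m k \<and> K ?z k"] T by (simp add: t_def)
  define S where "S = {i. i < ?m \<and> t i = real (as ! i)}"
  have "(\<Sum>i<?m. t i) = (\<Sum>i<?m. if i \<in> S then real (as ! i) else 0)"
    using tcase D2 by (intro sum.cong) (auto simp: S_def)
  also have "\<dots> = real (\<Sum>i\<in>S. as ! i)"
  proof -
    have "S \<subseteq> {..<?m}" by (auto simp: S_def)
    then show ?thesis by (simp add: sum.If_cases Int_absorb1)
  qed
  finally have "(\<Sum>i\<in>S. as ! i) = T" using sumt by linarith
  then show ?thesis by (intro exI[of _ S]) (auto simp: S_def)
qed

theorem gadget_yes_iff:
  assumes "\<forall>a\<in>set as. 0 < a" "sum_list as + T < B"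
  shows "(2 * length as + 2, gadget as T B) \<in> rank_yes \<longleftrightarrow>
    (\<exists>S\<subseteq>{..<length as}. (\<Sum>i\<in>S. as ! i) = T)"
proof
  have dim: "dim_row (gadget as T B) = length as + 2" by (simp add: gadget_def)
  show "\<exists>S\<subseteq>{..<length as}. (\<Sum>i\<in>S. as ! i) = T"
    if "(2 * length as + 2, gadget as T B) \<in> rank_yes"
    using that gadget_subset[OF assms] unfolding rank_yes_def by (auto simp: dim)
  show "(2 * length as + 2, gadget as T B) \<in> rank_yes" if "\<exists>S\<subseteq>{..<length as}. (\<Sum>i\<in>S. as ! i) = T"
  proof -
    from that obtain S where S: "S \<subseteq> {..<length as}" "(\<Sum>i\<in>S. as ! i) = T" by blast
    obtain p where p: "p \<in> carrier_vec (2 ^ (length as + 2))" "0\<^sub>v (2 ^ (length as + 2)) \<le> p"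
      "map_mat real_of_rat (gadget as T B) = corr_sum (length as + 2) p"
      "(\<Sum>i\<in>S. as ! i) = T \<Longrightarrow> nnz p \<le> 2 * length as + 2"
      by (rule gadget_family[of S as T B]) (use S assms in auto)
    then show ?thesis
      unfolding rank_yes_def using gadget_promise[of as T B] assms S by (auto simp: dim)
  qed
qed

section \<open>Satisfiability as a subset sum problem\<close>

type_synonym clause = "(bool \<times> nat) list"

definition sat :: "(nat \<Rightarrow> bool) \<Rightarrow> clause set \<Rightarrow> bool" where
  "sat \<nu> Cs \<longleftrightarrow> (\<forall>c\<in>Cs. \<exists>(s, v)\<in>set c. \<nu> v = s)"

text \<open>
  Items \<open>(0, v)\<close> and \<open>(1, v)\<close> stand for the two literals of variable \<open>v\<close>, and
  \<open>(2, j), \<dots>, (L, j)\<close> are slack items for clause \<open>j\<close>. The set \<open>digit_items Cs j\<close>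
  contains the items whose number has digit \<open>1\<close> (rather than \<open>0\<close>) at position \<open>j\<close>.
\<close>

definition literal_item :: "bool \<times> nat \<Rightarrow> nat \<times> nat" where
  "literal_item = (\<lambda>(s, v). (if s then 0 else 1, v))"

definition digit_items :: "clause list \<Rightarrow> nat \<Rightarrow> nat \<Rightarrow> (nat \<times> nat) set" where
  "digit_items Cs L j = (if j < length Cs then literal_item ` set (Cs ! j) \<union> {2..L} \<times> {j}
     else {(0, j - length Cs), (1, j - length Cs)})"

definition item_number :: "clause list \<Rightarrow> nat \<Rightarrow> nat \<Rightarrow> nat \<Rightarrow> nat \<times> nat \<Rightarrow> nat" where
  "item_number Cs R L b u = (\<Sum>j<length Cs + R. of_bool (u \<in> digit_items Cs L j) * b ^ j)"

text \<open>The \<open>L - 1\<close> slack items of a clause fall short of the digit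
  \<open>L\<close>, so at least one literal must be chosen; the digit \<open>1\<close> of a variable
  selects exactly one of its two literals.\<close>

definition target_number :: "clause list \<Rightarrow> nat \<Rightarrow> nat \<Rightarrow> nat \<Rightarrow> nat" where
  "target_number Cs R L b = (\<Sum>j<length Cs + R. (if j < length Cs then L else 1) * b ^ j)"

definition items :: "clause list \<Rightarrow> nat \<Rightarrow> nat \<Rightarrow> (nat \<times> nat) set" where
  "items Cs R L = {0, 1} \<times> {..<R} \<union> {2..L} \<times> {..<length Cs}"

text \<open>Taking remainder and quotient by \<open>b\<close> peels off the lowest digit.\<close>

lemma digits_unique:
  fixes b :: nat
  assumes "\<And>j. j < N \<Longrightarrow> d j < b" "\<And>j. j < N \<Longrightarrow> e j < b"
    and "(\<Sum>j<N. d j * b ^ j) = (\<Sum>j<N. e j * b ^ j)" "j < N"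
  shows "d j = e j"
  using assms
proof (induction N arbitrary: d e j)
  case (Suc N)
  have shift: "(\<Sum>j<Suc N. f j * b ^ j) = f 0 + b * (\<Sum>j<N. f (Suc j) * b ^ j)" for f
    by (subst sum.lessThan_Suc_shift) (simp add: sum_distrib_left mult_ac)
  have eq: "d 0 + b * (\<Sum>j<N. d (Suc j) * b ^ j) = e 0 + b * (\<Sum>j<N. e (Suc j) * b ^ j)"
    using Suc.prems(3) unfolding shift .
  from Suc.prems(1,2)[of 0] have lt: "d 0 < b" "e 0 < b" by auto
  have "d 0 = e 0"
    using arg_cong[OF eq, of "\<lambda>n. n mod b"] lt by simp
  moreover have "(\<Sum>j<N. d (Suc j) * b ^ j) = (\<Sum>j<N. e (Suc j) * b ^ j)"
    using arg_cong[OF eq, of "\<lambda>n. n div b"] lt by simp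
  then have "d (Suc i) = e (Suc i)" if "i < N" for i
    by (rule Suc.IH[of "\<lambda>j. d (Suc j)" "\<lambda>j. e (Suc j)", rotated 2]) (use Suc.prems that in auto)
  ultimately show ?case
    using Suc.prems(4) by (cases j) auto
qed simp

lemma digits_less:
  fixes b :: nat
  assumes "\<And>j. j < N \<Longrightarrow> d j < b" "0 < b"
  shows "(\<Sum>j<N. d j * b ^ j) < b ^ N"
  using assms
proof (induction N)
  case (Suc N)
  then have "(\<Sum>j<N. d j * b ^ j) < b ^ N" "d N \<le> b - 1" by fastforce+
  then have "(\<Sum>j<Suc N. d j * b ^ j) < b ^ N + (b - 1) * b ^ N"
    by (simp add: add_less_le_mono)
  also have "\<dots> = b ^ Suc N"
    using Suc.prems(2) by (simp add: algebra_simps)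
  finally show ?case .
qed simp

lemma finite_items [simp]: "finite (items Cs R L)"
  by (simp add: items_def)

lemma card_items: "card (items Cs R L) = 2 * R + (L - 1) * length Cs"
  unfolding items_def by (subst card_Un_disjoint) auto

lemma sum_item_number:
  assumes "finite U"
  shows "(\<Sum>u\<in>U. item_number Cs R L b u) = (\<Sum>j<length Cs + R. card (U \<inter> digit_items Cs L j) * b ^ j)"
  unfolding item_number_def using assms
  by (subst sum.swap) (simp add: sum_distrib_right[symmetric] Int_def)

text \<open>The base exceeds the number of items plus \<open>L\<close>, so column sums and target
  digits are both proper digits and can be compared position by position.\<close>

theorem subset_sum_iff_sat:
  assumes vars: "\<And>c s v. c \<in> set Cs \<Longrightarrow> (s, v) \<in> set c \<Longrightarrow> v < R"
    and len: "\<And>c. c \<in> set Cs \<Longrightarrow> length c \<le> L" and L: "1 \<le> L"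
    and b: "2 * R + (L - 1) * length Cs + L < b"
  shows "(\<exists>U\<subseteq>items Cs R L. (\<Sum>u\<in>U. item_number Cs R L b u) = target_number Cs R L b)
    \<longleftrightarrow> (\<exists>\<nu>. sat \<nu> (set Cs))"
proof -
  let ?J = "length Cs" and ?I = "items Cs R L" and ?D = "digit_items Cs L"
  have iff: "(\<Sum>u\<in>U. item_number Cs R L b u) = target_number Cs R L b \<longleftrightarrow>
      (\<forall>j<?J + R. card (U \<inter> ?D j) = (if j < ?J then L else 1))" if U: "U \<subseteq> ?I" for U
  proof -
    have fin: "finite U" using U by (rule finite_subset) simp
    have "card (U \<inter> ?D j) < b" for j
    proof -
      have "card (U \<inter> ?D j) \<le> card ?I" using U by (intro card_mono) auto
      with b show ?thesis by (simp add: card_items)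
    qed
    moreover have "(if j < ?J then L else 1) < b" for j
      using b L by auto
    ultimately show ?thesis
      unfolding sum_item_number[OF fin] target_number_def
      using digits_unique[of "?J + R" "\<lambda>j. card (U \<inter> ?D j)" b "\<lambda>j. if j < ?J then L else 1"]
      by (auto intro!: sum.cong)
  qed
  show ?thesis
  proof
    assume "\<exists>U\<subseteq>?I. (\<Sum>u\<in>U. item_number Cs R L b u) = target_number Cs R L b"
    then obtain U where U: "U \<subseteq> ?I" and all: "\<forall>j<?J + R. card (U \<inter> ?D j) = (if j < ?J then L else 1)"
      using iff by blast
    have clause: "card (U \<inter> ?D j) = L" if "j < ?J" for j
      using all that by auto
    have var: "card (U \<inter> ?D (?J + v)) = 1" if "v < R" for v
      using all that by (auto dest: spec[of _ "?J + v"])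
    have fin: "finite U" using U by (rule finite_subset) simp
    have single: "\<not> ((0, v) \<in> U \<and> (1, v) \<in> U)" if "v < R" for v
    proof
      assume "(0, v) \<in> U \<and> (1, v) \<in> U"
      then have "U \<inter> ?D (?J + v) = {(0, v), (1, v)}" by (auto simp: digit_items_def)
      with var[OF that] show False by (simp add: card_insert_if)
    qed
    have "\<exists>(s, v)\<in>set c. ((0, v) \<in> U) = s" if c: "c \<in> set Cs" for c
    proof -
      obtain j where j: "j < ?J" "Cs ! j = c" using c by (auto simp: in_set_conv_nth)
      have "U \<inter> literal_item ` set c \<noteq> {}"
      proof
        assume "U \<inter> literal_item ` set c = {}"
        then have "U \<inter> ?D j \<subseteq> {2..L} \<times> {j}" using j by (auto simp: digit_items_def)
        \<comment> \<open>Slack items alone reach at most \<open>L - 1\<close>.\<close>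
        then have "card (U \<inter> ?D j) \<le> card ({2..L} \<times> {j})" by (intro card_mono) auto
        with clause[OF j(1)] L show False by simp
      qed
      then obtain s v where "(s, v) \<in> set c" "literal_item (s, v) \<in> U" by auto
      then show ?thesis
        using single[OF vars[OF c]] by (cases s) (force simp: literal_item_def)+
    qed
    then show "\<exists>\<nu>. sat \<nu> (set Cs)" unfolding sat_def by (intro exI[of _ "\<lambda>v. (0, v) \<in> U"]) auto
  next
    assume "\<exists>\<nu>. sat \<nu> (set Cs)"
    then obtain \<nu> where \<nu>: "sat \<nu> (set Cs)" by blast
    define T where "T = {literal_item (\<nu> v, v) | v. v < R}"
    \<comment> \<open>A repeated literal is a single item and counts once. The slack items chosen
      below supply what the clause digit still lacks.\<close>
    define n where "n = (\<lambda>j. card (T \<inter> literal_item ` set (Cs ! j)))"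
    define U where "U = T \<union> {(i, j). j < ?J \<and> 2 \<le> i \<and> i < 2 + (L - n j)}"
    have n: "1 \<le> n j \<and> n j \<le> L" if j: "j < ?J" for j
    proof
      have c: "Cs ! j \<in> set Cs" using j by simp
      then obtain s v where sv: "(s, v) \<in> set (Cs ! j)" "\<nu> v = s" using \<nu> by (auto simp: sat_def)
      then have "literal_item (s, v) \<in> T \<inter> literal_item ` set (Cs ! j)"
        using vars[OF c sv(1)] by (auto simp: T_def)
      then show "1 \<le> n j"
        unfolding n_def Suc_le_eq One_nat_def by (subst card_gt_0_iff) auto
      have "n j \<le> card (literal_item ` set (Cs ! j))" unfolding n_def by (intro card_mono) auto
      also have "\<dots> \<le> card (set (Cs ! j))" by (intro card_image_le) auto
      also have "\<dots> \<le> length (Cs ! j)" by (rule card_length)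
      also have "\<dots> \<le> L" using len c by blast
      finally show "n j \<le> L" .
    qed
    have lit01: "fst (literal_item l) < 2" for l
      by (auto simp: literal_item_def split: prod.splits)
    have U: "U \<subseteq> ?I"
    proof
      fix u assume "u \<in> U"
      then show "u \<in> ?I"
        using n[of "snd u"] by (auto simp: U_def T_def items_def literal_item_def)
    qed
    have "card (U \<inter> ?D j) = L" if j: "j < ?J" for j
    proof -
      define A where "A = literal_item ` set (Cs ! j)"
      have A2: "i < 2" if "(i, k) \<in> A" for i k
        using that lit01 by (metis A_def fst_conv imageE)
      have T2: "i < 2" if "(i, k) \<in> T" for i k
        using that by (auto simp: T_def literal_item_def split: if_splits)
      have D: "?D j = A \<union> {2..L} \<times> {j}" using j by (simp add: digit_items_def A_def)
      have nL: "i < 2 + (L - n j) \<Longrightarrow> i \<le> L" for i using n[OF j] by linarith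
      have "(i, k) \<in> U \<inter> ?D j \<longleftrightarrow> (i, k) \<in> (T \<inter> A) \<union> {2..<2 + (L - n j)} \<times> {j}" for i k
        unfolding D U_def using A2[of i k] T2[of i k] nL[of i] j
        by (cases "i < 2"; cases "k = j"; simp; blast)
      then have "U \<inter> ?D j = (T \<inter> A) \<union> {2..<2 + (L - n j)} \<times> {j}"
        unfolding set_eq_iff split_paired_All by blast
      moreover have "(T \<inter> A) \<inter> {2..<2 + (L - n j)} \<times> {j} = {}"
        using A2 by fastforce
      moreover have "finite A" by (simp add: A_def)
      ultimately have "card (U \<inter> ?D j) = n j + (L - n j)"
        unfolding n_def A_def by (simp add: card_Un_disjoint)
      then show ?thesis using n[OF j] by simp
    qed
    moreover have "card (U \<inter> ?D (?J + v)) = 1" if "v < R" for v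
    proof -
      have "U \<inter> ?D (?J + v) = {literal_item (\<nu> v, v)}"
        using that by (auto simp: U_def digit_items_def T_def literal_item_def)
      then show ?thesis by simp
    qed
    moreover have "\<exists>v<R. j = ?J + v" if "j < ?J + R" "\<not> j < ?J" for j
      using that by (intro exI[of _ "j - ?J"]) auto
    ultimately have "\<forall>j<?J + R. card (U \<inter> ?D j) = (if j < ?J then L else 1)"
      by fastforce
    with iff[OF U] U show "\<exists>U\<subseteq>?I. (\<Sum>u\<in>U. item_number Cs R L b u) = target_number Cs R L b"
      by blast
  qed
qed

section \<open>Operations on generators\<close>

text \<open>The continuation is told the level of the leaf, since its own loops bind registers from
  there on.\<close>

primrec bind :: "'a gen \<Rightarrow> (nat \<Rightarrow> 'a \<Rightarrow> 'b gen) \<Rightarrow> nat \<Rightarrow> 'b gen" where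
  "bind (Leaf a) f k = f k a"
| "bind Skip f k = Skip"
| "bind (Then g h) f k = Then (bind g f k) (bind h f k)"
| "bind (IfEq a b g h) f k = IfEq a b (bind g f k) (bind h f k)"
| "bind (IfBit a g h) f k = IfBit a (bind g f k) (bind h f k)"
| "bind (For a g) f k = For a (bind g f (Suc k))"

lemma eval_bind:
  "eval x (bind g f k) k env = concat (map (\<lambda>(a, k', env'). eval x (f k' a) k' env') (eval x g k env))"
  by (induction g arbitrary: k env) (auto simp: map_concat concat_concat o_def)

lemma produce_bind:
  "produce x (bind g f k) k env =
     concat (map (\<lambda>(a, k', env'). produce x (f k' a) k' env') (eval x g k env))"
  by (simp add: produce_def eval_bind map_concat concat_concat o_def case_prod_unfold)

lemma gen_ok_bind:
  assumes "gen_ok lv g k" "\<And>k' a. k \<le> k' \<Longrightarrow> a \<in> set_gen g \<Longrightarrow> lv a \<subseteq> {..<k'} \<Longrightarrow> gen_ok lv' (f k' a) k'"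
  shows "gen_ok lv' (bind g f k) k"
  using assms by (induction g arbitrary: k) auto

lemma eval_leaf: "(a, k', env') \<in> set (eval x g k env) \<Longrightarrow> a \<in> set_gen g"
  by (induction g arbitrary: k env) (auto split: if_splits)

section \<open>Clause generators moved to other levels, and the number of their leaves\<close>

type_synonym clause_leaf = "(bool \<times> aexp) list"

fun clause_val :: "clause_leaf \<times> nat \<times> (nat \<Rightarrow> nat) \<Rightarrow> clause" where
  "clause_val (cl, k, env) = map (\<lambda>(s, e). (s, aval e env)) cl"

definition clause_vars :: "clause_leaf \<Rightarrow> nat set" where
  "clause_vars cl = (\<Union>l\<in>set cl. avars (snd l))"

text \<open>Register \<open>0\<close> is global; all others are local and are moved by a shift.\<close>

primrec shift :: "nat \<Rightarrow> aexp \<Rightarrow> aexp" where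
  "shift d (Num n) = Num n"
| "shift d (Var v) = Var (if v = 0 then 0 else v + d)"
| "shift d (Plus a b) = Plus (shift d a) (shift d b)"
| "shift d (Times a b) = Times (shift d a) (shift d b)"

primrec shift_gen :: "nat \<Rightarrow> clause_leaf gen \<Rightarrow> clause_leaf gen" where
  "shift_gen d (Leaf cl) = Leaf (map (map_prod id (shift d)) cl)"
| "shift_gen d Skip = Skip"
| "shift_gen d (Then g h) = Then (shift_gen d g) (shift_gen d h)"
| "shift_gen d (IfEq a b g h) = IfEq (shift d a) (shift d b) (shift_gen d g) (shift_gen d h)"
| "shift_gen d (IfBit a g h) = IfBit (shift d a) (shift_gen d g) (shift_gen d h)"
| "shift_gen d (For a g) = For (shift d a) (shift_gen d g)"

lemma aval_shift:
  assumes "env' 0 = env 0" "\<And>v. 1 \<le> v \<Longrightarrow> env' (v + d) = env v"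
  shows "aval (shift d e) env' = aval e env"
  using assms by (induction e) auto

text \<open>Levels and environments at the leaves differ after a shift; only the clauses they denote
  agree, hence the comparison through \<open>clause_val\<close>.\<close>

lemma eval_shift:
  assumes "1 \<le> k" "env' 0 = env 0" "\<And>v. 1 \<le> v \<Longrightarrow> env' (v + d) = env v"
  shows "map clause_val (eval x (shift_gen d g) (k + d) env') = map clause_val (eval x g k env)"
  using assms
proof (induction g arbitrary: k env env')
  case (Leaf cl)
  then show ?case by (auto simp: aval_shift)
next
  case (For a g)
  have "map clause_val (eval x (shift_gen d g) (Suc k + d) (env'(k + d := i))) =
      map clause_val (eval x g (Suc k) (env(k := i)))" for i
    by (rule For.IH) (use For.prems in auto)
  then show ?case
    using For.prems by (simp add: aval_shift[of env' env] map_concat o_def)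
next
  case (IfEq a b g h)
  then show ?case by (simp add: aval_shift[of env' env])
next
  case (IfBit a g h)
  then show ?case by (simp add: aval_shift[of env' env])
qed simp_all

lemma avars_shift: "avars e \<subseteq> {..<k} \<Longrightarrow> avars (shift d e) \<subseteq> {..<k + d}"
  by (induction e) (auto split: if_splits)

lemma gen_ok_shift: "gen_ok clause_vars g k \<Longrightarrow> gen_ok clause_vars (shift_gen d g) (k + d)"
proof (induction g arbitrary: k)
  case (Leaf cl)
  have "avars (shift d (snd l)) \<subseteq> {..<k + d}" if "l \<in> set cl" for l
    by (rule avars_shift) (use Leaf that in \<open>auto simp: clause_vars_def\<close>)
  then show ?case by (fastforce simp: clause_vars_def)
qed (use avars_shift in \<open>force simp: avars_shift\<close>)+

primrec gen_size :: "'a gen \<Rightarrow> aexp" where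
  "gen_size (Leaf a) = Num 1"
| "gen_size Skip = Num 0"
| "gen_size (Then g h) = Plus (gen_size g) (gen_size h)"
| "gen_size (IfEq a b g h) = gen_size g"
| "gen_size (IfBit a g h) = gen_size g"
| "gen_size (For a g) = Times a (gen_size g)"

text \<open>The number of clauses determines loop bounds and bit positions of the output, so it must
  be an expression in the input length. Hence branches have equally many leaves, and loop bounds
  mention register \<open>0\<close> only. This also justifies that \<open>gen_size\<close> looks at
  one branch.\<close>

primrec balanced :: "'a gen \<Rightarrow> bool" where
  "balanced (Leaf a) = True"
| "balanced Skip = True"
| "balanced (Then g h) = (balanced g \<and> balanced h)"
| "balanced (IfEq a b g h) = (balanced g \<and> balanced h \<and> gen_size g = gen_size h)"
| "balanced (IfBit a g h) = (balanced g \<and> balanced h \<and> gen_size g = gen_size h)"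
| "balanced (For a g) = (avars a \<subseteq> {0} \<and> balanced g)"

lemma avars_gen_size: "balanced g \<Longrightarrow> avars (gen_size g) \<subseteq> {0}"
  by (induction g) auto

lemma length_eval:
  "balanced g \<Longrightarrow> 1 \<le> k \<Longrightarrow> length (eval x g k env) = aval (gen_size g) env"
proof (induction g arbitrary: k env)
  case (For a g)
  have "aval (gen_size g) (env(k := i)) = aval (gen_size g) env" for i
    by (rule aval_cong) (use avars_gen_size[of g] For.prems in auto)
  then show ?case using For by (simp add: length_concat o_def sum_list_triv)
qed auto

section \<open>Numbers as bit strings\<close>

definition bits_value :: "bool list \<Rightarrow> nat" where
  "bits_value w = horner_sum of_bool 2 w"

lemma bits_value_simps [simp]:
  "bits_value [] = 0" "bits_value (b # w) = of_bool b + 2 * bits_value w"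
  by (simp_all add: bits_value_def)

lemma bits_value_append [simp]: "bits_value (v @ w) = bits_value v + 2 ^ length v * bits_value w"
  by (simp add: bits_value_def horner_sum_append)

lemma bits_value_replicate [simp]: "bits_value (replicate n False) = 0"
  by (induction n) auto

lemma bits_value_bits: "bits_value (map (bit d) [0..<n]) = take_bit n d"
  unfolding bits_value_def by (rule horner_sum_bit_eq_take_bit)

lemma bits_value_pos: "w \<noteq> [] \<Longrightarrow> last w \<Longrightarrow> 0 < bits_value w"
  by (induction w) (auto split: if_splits)

text \<open>A string whose last bit is set has no zeros at its top end and is therefore itself the
  code of its value.\<close>

lemma enc_nat_bits_value: "w \<noteq> [] \<Longrightarrow> last w \<Longrightarrow> enc_nat (bits_value w) = w"
proof (induction w)
  case (Cons b w)
  show ?case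
  proof (cases "w = []")
    case True
    with Cons show ?thesis by (simp add: enc_nat.simps)
  next
    case False
    then have "enc_nat (bits_value w) = w" "0 < bits_value w"
      using Cons bits_value_pos by auto
    then show ?thesis by (subst enc_nat.simps) auto
  qed
qed simp

lemma bits_value_concat:
  assumes "\<And>a. a \<in> set xs \<Longrightarrow> length (f a) = W"
  shows "bits_value (concat (map f xs)) = (\<Sum>j<length xs. bits_value (f (xs ! j)) * (2 ^ W) ^ j)"
  using assms
proof (induction xs)
  case (Cons a xs)
  then show ?case
    by (simp add: sum.lessThan_Suc_shift sum_distrib_left mult_ac del: sum.lessThan_Suc)
qed simp

lemma double_append [simp]: "double (v @ w) = double v @ double w"
  by (simp add: double_def)

lemma double_Nil [simp]: "double [] = []"
  and double_Cons [simp]: "double (b # w) = b # b # double w"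
  by (simp_all add: double_def)

lemma double_concat: "double (concat ws) = concat (map double ws)"
  by (induction ws) auto

lemma pair_double: "pair v w = double v @ [False, True] @ w"
  by (simp add: pair_def double_def)

text \<open>A nonnegative integer as a rational inside a list: the sign bit has become four bits;
  after the number come the doubled separator, the doubled code of the denominator \<open>1\<close>,
  and the separator of the list.\<close>

definition enc_entry :: "bool list \<Rightarrow> bool list" where
  "enc_entry w = replicate 4 False @ double (double w)
     @ [False, False, True, True, False, False, True, True, False, True]"

lemma enc_list_concat: "enc_list ws = concat (map (\<lambda>w. double w @ [False, True]) ws)"
  by (induction ws) (auto simp: enc_list_def pair_double)

lemma enc_list_entry:
  "double (enc_rat (of_nat a)) @ [False, True] = enc_entry (enc_nat a)"
proof -
  have "quotient_of (of_nat a) = (int a, 1)"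
    using quotient_of_int[of "int a"] by (simp add: of_rat_of_int_eq[symmetric])
  moreover have "enc_nat 1 = [True]" by (simp add: enc_nat.simps)
  ultimately show ?thesis
    by (simp add: enc_rat_def enc_int_def pair_double enc_entry_def numeral_eq_Suc)
qed

lemma enc_instance_gadget:
  "enc_instance (q, gadget as T B) =
     double (enc_nat q) @ [False, True] @ double (enc_nat (length as + 2)) @ [False, True] @
     concat (map (\<lambda>i. concat (map (\<lambda>j. enc_entry (enc_nat (gadget_entry as T B i j)))
       [0..<length as + 2])) [0..<length as + 2])"
proof -
  define n where "n = length as + 2"
  have dim: "dim_row (gadget as T B) = n" by (simp add: gadget_def n_def)
  have 1: "entries (gadget as T B) =
      concat (map (\<lambda>i. map (\<lambda>j. of_nat (gadget_entry as T B i j)) [0..<n]) [0..<n])"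
    unfolding entries_def product_concat_map map_concat n_def
    by (auto simp: gadget_def o_def intro!: arg_cong[of _ _ concat])
  have 2: "concat (map (\<lambda>w. double w @ [False, True]) (map enc_rat
      (concat (map (\<lambda>i. map (\<lambda>j. of_nat (gadget_entry as T B i j)) [0..<n]) [0..<n])))) =
    concat (map (\<lambda>i. concat (map (\<lambda>j. enc_entry (enc_nat (gadget_entry as T B i j))) [0..<n])) [0..<n])"
    by (simp add: map_concat concat_concat o_def enc_list_entry)
  show ?thesis
    unfolding enc_instance_def prod.case dim 1 enc_list_concat list.map concat.simps append_assoc
      2[unfolded list.map] n_def[symmetric] ..
qed

section \<open>Generating rank instances from clause generators\<close>

lemma enc_nat_0 [simp]: "enc_nat 0 = []"
  by (simp add: enc_nat.simps)

lemma eval_env: "(a, k', env') \<in> set (eval x g k env) \<Longrightarrow> k \<le> k' \<and> (\<forall>v<k. env' v = env v)"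
proof (induction g arbitrary: k env)
  case (For b g)
  then obtain i where "(a, k', env') \<in> set (eval x g (Suc k) (env(k := i)))" by auto
  from For.IH[OF this] show ?case by auto
qed (auto split: if_splits)

text \<open>An entry of a matrix is a list element that is itself a pair, so that bits are doubled twice.\<close>

definition qbits :: "bool list \<Rightarrow> out_leaf gen" where
  "qbits w = Leaf (Bits (double (double w)))"

definition zeros :: "aexp \<Rightarrow> out_leaf gen" where
  "zeros e = For e (qbits [False])"

definition entry :: "out_leaf gen \<Rightarrow> out_leaf gen" where
  "entry g = Then (Leaf (Bits (replicate 4 False))) (Then g
     (Leaf (Bits [False, False, True, True, False, False, True, True, False, True])))"

lemma produce_qbits [simp]: "produce x (qbits w) k env = double (double w)"
  by (simp add: qbits_def)

lemma produce_repeat: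
  "concat (map (\<lambda>i. double (double w)) (rev [0..<n])) = double (double (concat (replicate n w)))"
  by (induction n) auto

lemma concat_replicate_single: "concat (replicate n [b]) = replicate n b"
  by (induction n) auto

lemma produce_zeros [simp]:
  "produce x (zeros e) k env = double (double (replicate (aval e env) False))"
  using produce_repeat[of "[False]" "aval e env"] by (simp add: zeros_def concat_replicate_single)

lemma produce_entry: "produce x g k env = double (double w) \<Longrightarrow> produce x (entry g) k env = enc_entry w"
  by (simp add: entry_def enc_entry_def)

lemma gen_ok_qbits [simp]: "gen_ok leaf_vars (qbits w) k"
  by (simp add: qbits_def)

lemma gen_ok_zeros [simp]: "gen_ok leaf_vars (zeros e) k \<longleftrightarrow> avars e \<subseteq> {..<k}"
  by (simp add: zeros_def)

lemma gen_ok_entry [simp]: "gen_ok leaf_vars (entry g) k \<longleftrightarrow> gen_ok leaf_vars g k"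
  by (simp add: entry_def)

definition val :: "bool list \<Rightarrow> aexp \<Rightarrow> nat" where
  "val x e = aval e (initial_env (length x))"

lemma aval_global: "avars e \<subseteq> {0} \<Longrightarrow> env 0 = length x \<Longrightarrow> aval e env = val x e"
  unfolding val_def by (rule aval_cong) (auto simp: initial_env_def)

locale cnf_generator =
  fixes F :: "clause_leaf gen" and R' :: aexp and L :: nat
  assumes F_ok: "gen_ok clause_vars F 1" and F_balanced: "balanced F"
    and R'_global: "avars R' \<subseteq> {0}" and L_pos: "1 \<le> L"
    and F_length: "\<And>cl. cl \<in> set_gen F \<Longrightarrow> length cl \<le> L"
begin

text \<open>One variable more than \<open>R'\<close>, so that the target always has a highest
  variable digit \<open>1\<close>, which is printed without padding.\<close>

definition "R = Plus R' (Num 1)"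
definition "J = gen_size F"
text \<open>The number of items: two literals per variable and \<open>L - 1\<close> slack items per
  clause.\<close>

definition "M = Plus (Times (Num 2) R) (Times (Num (L - 1)) J)"
text \<open>Bits per digit. The base \<open>2 ^ W\<close> exceeds \<open>M + L\<close>; a printed
  digit is at most \<open>L\<close> and fits into \<open>L\<close> bits, the other \<open>M\<close>
  being zero.\<close>

definition "W = Plus (Num L) M"

lemma avars_global [simp]: "avars R' \<subseteq> {0}" "avars R \<subseteq> {0}" "avars J \<subseteq> {0}" "avars M \<subseteq> {0}" "avars W \<subseteq> {0}"
  using R'_global avars_gen_size[OF F_balanced] by (auto simp: R_def J_def M_def W_def)

lemma avars_level [simp]:
  assumes "1 \<le> k"
  shows "avars R' \<subseteq> {..<k}" "avars R \<subseteq> {..<k}" "avars J \<subseteq> {..<k}" "avars M \<subseteq> {..<k}" "avars W \<subseteq> {..<k}"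
  using avars_global assms by fastforce+

definition digit :: "nat \<Rightarrow> out_leaf gen" where
  "digit d = Then (qbits (map (bit d) [0..<L])) (zeros M)"

definition power_gen :: "aexp \<Rightarrow> out_leaf gen" where
  "power_gen e = Then (zeros (Times W e)) (qbits [True])"

text \<open>Signs are compared when the generator is built, variables only when it runs.\<close>

definition member_digit :: "bool \<Rightarrow> aexp \<Rightarrow> clause_leaf \<Rightarrow> out_leaf gen" where
  "member_digit s e cl = foldr (\<lambda>(s', e') h. if s' = s then IfEq e e' (digit 1) h else h) cl (digit 0)"

text \<open>The highest digit of a literal item belongs to its variable, and the only digit of a
  slack item to its clause; in both cases the final power supplies the leading \<open>1\<close>. As
  \<open>F\<close> lives at level \<open>1\<close>, it is shifted by \<open>k - 1\<close>.\<close>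

definition number_gen :: "nat \<Rightarrow> nat \<times> aexp \<Rightarrow> out_leaf gen" where
  "number_gen k = (\<lambda>(c, e). Then
     (if c < 2 then bind (shift_gen (k - 1) F) (\<lambda>_. member_digit (c = 0) e) k else Skip) (power_gen e))"

definition target_gen :: "out_leaf gen" where
  "target_gen = Then (For J (digit L)) (Then (For R' (digit 1)) (qbits [True]))"

text \<open>All numbers and the target lie below \<open>2 ^ (W * (J + R))\<close>, and there are
  fewer than \<open>2 ^ W\<close> of them, so this power exceeds their sum.\<close>

definition bound_gen :: "out_leaf gen" where
  "bound_gen = power_gen (Plus J (Plus R (Num 1)))"

definition items_gen :: "nat \<Rightarrow> (nat \<times> aexp) gen" where
  "items_gen k = Then (For R (Then (Leaf (0, Var k)) (Leaf (1, Var k))))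
     (For J (foldr (\<lambda>c. Then (Leaf (c, Var k))) [2..<Suc L] Skip))"

text \<open>Doubling the diagonal entry just prepends \<open>False\<close>, and a zero entry has the
  empty code.\<close>

definition row_gen :: "nat \<Rightarrow> nat \<times> aexp \<Rightarrow> out_leaf gen" where
  "row_gen k u = Then
     (bind (items_gen k) (\<lambda>k' u'. if fst u = fst u' then
        IfEq (snd u) (snd u') (entry (Then (qbits [False]) (number_gen k' u))) (entry Skip)
        else entry Skip) k)
     (Then (entry (number_gen k u)) (entry (number_gen k u)))"

definition instance_gen :: "out_leaf gen" where
  "instance_gen =
     Then (Leaf (Binary (Plus (Times (Num 2) M) (Num 2)))) (Then (Leaf (Bits [False, True]))
     (Then (Leaf (Binary (Plus M (Num 2)))) (Then (Leaf (Bits [False, True]))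
     (Then (bind (items_gen 1) row_gen 1)
     (Then (Then (bind (items_gen 1) (\<lambda>k u. entry (number_gen k u)) 1) (Then (entry bound_gen) (entry target_gen)))
     (Then (bind (items_gen 1) (\<lambda>k u. entry (number_gen k u)) 1) (Then (entry target_gen) (entry bound_gen))))))))"

subsection \<open>Well-formedness\<close>

lemma gen_ok_digit [simp]: "1 \<le> k \<Longrightarrow> gen_ok leaf_vars (digit d) k"
  by (simp add: digit_def)

lemma gen_ok_power [simp]: "1 \<le> k \<Longrightarrow> avars e \<subseteq> {..<k} \<Longrightarrow> gen_ok leaf_vars (power_gen e) k"
  by (simp add: power_gen_def)

lemma gen_ok_member:
  assumes "1 \<le> k" "avars e \<subseteq> {..<k}" "clause_vars cl \<subseteq> {..<k}"
  shows "gen_ok leaf_vars (member_digit s e cl) k"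
  using assms(3) unfolding member_digit_def
  by (induction cl) (use assms in \<open>auto simp: clause_vars_def\<close>)

lemma gen_ok_number:
  assumes "1 \<le> k" "avars (snd u) \<subseteq> {..<k}"
  shows "gen_ok leaf_vars (number_gen k u) k"
proof -
  have F: "gen_ok clause_vars (shift_gen (k - 1) F) k"
    using gen_ok_shift[OF F_ok, of "k - 1"] assms by simp
  have "gen_ok leaf_vars (bind (shift_gen (k - 1) F) (\<lambda>_. member_digit s (snd u)) k) k" for s
    by (rule gen_ok_bind[OF F], rule gen_ok_member) (use assms in auto)
  then show ?thesis
    using assms by (cases u) (simp add: number_gen_def)
qed

lemma gen_ok_items: "1 \<le> k \<Longrightarrow> gen_ok (\<lambda>u. avars (snd u)) (items_gen k) k"
proof -
  assume "1 \<le> k"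
  moreover have "gen_ok (\<lambda>u. avars (snd u)) (foldr (\<lambda>c. Then (Leaf (c, Var k))) cs Skip) (Suc k)" for cs :: "nat list"
    by (induction cs) auto
  ultimately show ?thesis by (simp add: items_gen_def del: upt_Suc)
qed

lemma gen_ok_target [simp]: "1 \<le> k \<Longrightarrow> gen_ok leaf_vars target_gen k"
  by (simp add: target_gen_def)

lemma gen_ok_bound [simp]: "1 \<le> k \<Longrightarrow> gen_ok leaf_vars bound_gen k"
  by (simp add: bound_gen_def)

lemma gen_ok_row:
  assumes "1 \<le> k" "avars (snd u) \<subseteq> {..<k}"
  shows "gen_ok leaf_vars (row_gen k u) k"
  unfolding row_gen_def gen_ok.simps gen_ok_entry
proof (intro conjI gen_ok_bind[OF gen_ok_items])
  fix k' and u' :: "nat \<times> aexp" assume "k \<le> k'" "avars (snd u') \<subseteq> {..<k'}"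
  moreover from this assms(2) have "avars (snd u) \<subseteq> {..<k'}"
    by (meson lessThan_subset_iff order_trans)
  ultimately show "gen_ok leaf_vars (if fst u = fst u' then
      IfEq (snd u) (snd u') (entry (Then (qbits [False]) (number_gen k' u))) (entry Skip)
      else entry Skip) k'"
    using assms(1) gen_ok_number[of k' u] by auto
qed (use assms gen_ok_number in auto)

lemma gen_ok_instance: "gen_ok leaf_vars instance_gen 1"
proof -
  have 1: "gen_ok leaf_vars (bind (items_gen 1) row_gen 1) 1"
    by (intro gen_ok_bind[OF gen_ok_items] gen_ok_row) auto
  have 2: "gen_ok leaf_vars (bind (items_gen 1) (\<lambda>k u. entry (number_gen k u)) 1) 1"
    by (rule gen_ok_bind[OF gen_ok_items]) (auto simp: gen_ok_number)
  show ?thesis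
    unfolding instance_gen_def using 1 2 by simp
qed

subsection \<open>The generated instance\<close>

definition clauses :: "bool list \<Rightarrow> clause list" where
  "clauses x = map clause_val (eval x F 1 (initial_env (length x)))"

definition digit_bits :: "bool list \<Rightarrow> nat \<Rightarrow> bool list" where
  "digit_bits x d = map (bit d) [0..<L] @ replicate (val x M) False"

definition item_bits :: "bool list \<Rightarrow> nat \<times> nat \<Rightarrow> bool list" where
  "item_bits x = (\<lambda>(c, i).
     (if c < 2 then concat (map (\<lambda>cl. digit_bits x (of_bool ((c = 0, i) \<in> set cl))) (clauses x)) else [])
     @ replicate (val x W * i) False @ [True])"

definition target_bits :: "bool list \<Rightarrow> bool list" where
  "target_bits x = concat (replicate (val x J) (digit_bits x L))
     @ concat (replicate (val x R') (digit_bits x 1)) @ [True]"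

definition bound_bits :: "bool list \<Rightarrow> bool list" where
  "bound_bits x = replicate (val x W * (val x J + val x R + 1)) False @ [True]"

text \<open>Loops run downwards, which reverses the index ranges; rows and columns follow the same
  list.\<close>

definition item_list :: "bool list \<Rightarrow> (nat \<times> nat) list" where
  "item_list x = concat (map (\<lambda>i. [(0, i), (1, i)]) (rev [0..<val x R]))
     @ concat (map (\<lambda>j. map (\<lambda>c. (c, j)) [2..<Suc L]) (rev [0..<val x J]))"

lemma aval_globals [simp]:
  assumes "env 0 = length x"
  shows "aval R' env = val x R'" "aval R env = val x R" "aval J env = val x J"
    "aval M env = val x M" "aval W env = val x W"
  using assms by (simp_all add: aval_global)

lemma val_simps:
  "val x R = val x R' + 1" "val x M = 2 * val x R + (L - 1) * val x J" "val x W = L + val x M"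
  by (simp_all add: val_def R_def M_def W_def)

lemma length_clauses: "length (clauses x) = val x J"
  by (simp add: clauses_def J_def val_def length_eval[OF F_balanced])

lemma produce_digit [simp]:
  "env 0 = length x \<Longrightarrow> produce x (digit d) k env = double (double (digit_bits x d))"
  by (simp add: digit_def digit_bits_def)

lemma produce_member:
  assumes "env 0 = length x"
  shows "produce x (member_digit s e cl) k env
    = double (double (digit_bits x (of_bool ((s, aval e env) \<in> set (clause_val (cl, k, env))))))"
  unfolding member_digit_def
proof (induction cl)
  case Nil
  then show ?case using assms by simp
next
  case (Cons l cl)
  obtain s' e' where l: "l = (s', e')" by (cases l)
  show ?case
  proof (cases "s' = s")
    case True
    with Cons show ?thesis by (simp add: l assms)
  next
    case False
    with Cons show ?thesis by (simp add: l)
  qed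
qed

lemma produce_power:
  "env 0 = length x \<Longrightarrow> produce x (power_gen e) k env =
    double (double (replicate (val x W * aval e env) False @ [True]))"
  by (simp add: power_gen_def)

lemma produce_number:
  assumes "1 \<le> k" "env 0 = length x" "\<And>r. k \<le> r \<Longrightarrow> env r = 0" "avars e \<subseteq> {..<k}"
  shows "produce x (number_gen k (c, e)) k env = double (double (item_bits x (c, aval e env)))"
proof -
  let ?G = "shift_gen (k - 1) F"
  let ?i = "aval e env"
  let ?s = "c = 0"
  let ?h = "\<lambda>cl. double (double (digit_bits x (of_bool ((?s, ?i) \<in> set cl))))"
  have "produce x (member_digit ?s e cl) k' env' = ?h (clause_val (cl, k', env'))"
    if "(cl, k', env') \<in> set (eval x ?G k env)" for cl k' env'
  proof -
    have env': "\<forall>v<k. env' v = env v" using eval_env[OF that] by simp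
    then have "aval e env' = ?i" using assms(4) by (intro aval_cong) auto
    moreover have "env' 0 = length x" using env' assms by simp
    ultimately show ?thesis using produce_member[of env' x ?s e cl k'] by simp
  qed
  then have "produce x (bind ?G (\<lambda>_. member_digit ?s e) k) k env
      = concat (map (\<lambda>t. ?h (clause_val t)) (eval x ?G k env))"
    unfolding produce_bind by (intro arg_cong[of _ _ concat] map_cong) auto
  also have "\<dots> = concat (map ?h (map clause_val (eval x ?G k env)))"
    by (simp add: o_def)
  also have "map clause_val (eval x ?G k env) = clauses x"
    using eval_shift[of 1 env "initial_env (length x)" "k - 1" x F] assms
    by (simp add: clauses_def initial_env_def)
  finally show ?thesis
    using assms(2) by (simp add: number_gen_def item_bits_def produce_power double_concat o_def)
qed

lemma produce_target: "env 0 = length x \<Longrightarrow> 1 \<le> k \<Longrightarrow> produce x target_gen k env = double (double (target_bits x))"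
  by (simp add: target_gen_def target_bits_def produce_repeat)

lemma produce_bound: "env 0 = length x \<Longrightarrow> produce x bound_gen k env = double (double (bound_bits x))"
  by (simp add: bound_gen_def bound_bits_def produce_power)

lemma eval_items:
  assumes "1 \<le> k" "env 0 = length x"
  shows "eval x (items_gen k) k env = map (\<lambda>(c, i). ((c, Var k), Suc k, env(k := i))) (item_list x)"
proof -
  have "eval x (foldr (\<lambda>c. Then (Leaf (c, Var k))) cs Skip) (Suc k) env'
      = map (\<lambda>c. ((c, Var k), Suc k, env')) cs" for cs :: "nat list" and env'
    by (induction cs) auto
  then show ?thesis
    using assms by (simp add: items_gen_def item_list_def map_concat o_def del: upt_Suc)
qed

lemma produce_row:
  assumes "1 \<le> k" "env 0 = length x" "\<And>r. k \<le> r \<Longrightarrow> env r = 0" "avars e \<subseteq> {..<k}" "v = (c, aval e env)"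
  shows "produce x (row_gen k (c, e)) k env =
    concat (map (\<lambda>u. enc_entry (if v = u then False # item_bits x v else [])) (item_list x))
    @ enc_entry (item_bits x v) @ enc_entry (item_bits x v)"
proof -
  have [simp]: "produce x (entry (number_gen k (c, e))) k env = enc_entry (item_bits x v)"
    using assms by (intro produce_entry) (simp add: produce_number)
  have e: "aval e (env(k := i)) = aval e env" for i
    using assms(4) by (intro aval_cong) auto
  have n: "produce x (entry (Then (qbits [False]) (number_gen (Suc k) (c, e)))) (Suc k) (env(k := i))
      = enc_entry (False # item_bits x v)" for i
    using assms(4)
    by (intro produce_entry, simp, subst produce_number) (use assms e in \<open>auto simp: less_Suc_eq\<close>)
  have z: "produce x (entry Skip) k' env' = enc_entry []" for k' env'
    by (intro produce_entry) simp
  have cell: "produce x (if c = c' then IfEq e (Var k) (entry (Then (qbits [False]) (number_gen (Suc k) (c, e)))) (entry Skip)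
      else entry Skip) (Suc k) (env(k := i)) = enc_entry (if v = (c', i) then False # item_bits x v else [])" for c' i
    using assms(5) n z by (cases "c' = c") (auto simp: e)
  have "produce x (bind (items_gen k) (\<lambda>k' u'. if fst (c, e) = fst u' then
        IfEq (snd (c, e)) (snd u') (entry (Then (qbits [False]) (number_gen k' (c, e)))) (entry Skip)
        else entry Skip) k) k env
      = concat (map (\<lambda>u. enc_entry (if v = u then False # item_bits x v else [])) (item_list x))"
    unfolding produce_bind eval_items[of k env x, OF assms(1,2)] map_map
  proof (intro arg_cong[of _ _ concat] map_cong refl)
    fix u :: "nat \<times> nat"
    obtain c' i where u: "u = (c', i)" by (cases u)
    show "((\<lambda>(a, k', env'). produce x (if fst (c, e) = fst a then
        IfEq (snd (c, e)) (snd a) (entry (Then (qbits [False]) (number_gen k' (c, e)))) (entry Skip)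
        else entry Skip) k' env') \<circ> (\<lambda>(c, i). ((c, Var k), Suc k, env(k := i)))) u =
        enc_entry (if v = u then False # item_bits x v else [])"
      unfolding u comp_apply prod.case fst_conv snd_conv by (rule cell)
  qed
  then show ?thesis
    unfolding row_gen_def by simp
qed

lemma length_item_list: "length (item_list x) = val x M"
  by (simp add: item_list_def length_concat o_def sum_list_triv val_simps del: upt_Suc)

lemma set_item_list: "set (item_list x) = items (clauses x) (val x R) L"
  by (force simp: item_list_def items_def length_clauses simp del: upt_Suc)

lemma distinct_item_list: "distinct (item_list x)"
proof -
  have "card (set (item_list x)) = length (item_list x)"
    by (simp add: set_item_list card_items length_clauses length_item_list val_simps)
  then show ?thesis by (rule card_distinct)
qed

definition "numbers x = map (\<lambda>u. bits_value (item_bits x u)) (item_list x)"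
definition "target x = bits_value (target_bits x)"
definition "bnd x = bits_value (bound_bits x)"

lemma enc_numbers:
  "enc_nat (bits_value (item_bits x u)) = item_bits x u"
  "enc_nat (2 * bits_value (item_bits x u)) = False # item_bits x u"
  "enc_nat (target x) = target_bits x" "enc_nat (bnd x) = bound_bits x"
proof -
  have l: "item_bits x u \<noteq> [] \<and> last (item_bits x u)"
    by (auto simp: item_bits_def split: prod.splits)
  then show "enc_nat (bits_value (item_bits x u)) = item_bits x u"
    by (intro enc_nat_bits_value) auto
  show "enc_nat (2 * bits_value (item_bits x u)) = False # item_bits x u"
    using enc_nat_bits_value[of "False # item_bits x u"] l by simp
  show "enc_nat (target x) = target_bits x" "enc_nat (bnd x) = bound_bits x"
    unfolding target_def bnd_def
    by (intro enc_nat_bits_value; simp add: target_bits_def bound_bits_def)+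
qed

lemma concat_map_nth: "concat (map f xs) = concat (map (\<lambda>j. f (xs ! j)) [0..<length xs])"
  by (metis map_nth map_map comp_apply map_cong)

theorem produce_instance:
  "produce x instance_gen 1 (initial_env (length x)) =
     enc_instance (2 * length (numbers x) + 2, gadget (numbers x) (target x) (bnd x))"
proof -
  let ?m = "length (item_list x)"
  let ?e = "initial_env (length x)"
  let ?I = "item_list x"
  let ?g = "\<lambda>i j. enc_entry (enc_nat (gadget_entry (numbers x) (target x) (bnd x) i j))"
  have e0: "?e 0 = length x" "\<And>r. 1 \<le> r \<Longrightarrow> ?e r = 0" by (auto simp: initial_env_def)
  have items: "eval x (items_gen 1) 1 ?e = map (\<lambda>(c, i). ((c, Var 1), Suc 1, ?e(1 := i))) ?I"
    by (rule eval_items) (simp_all add: e0)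
  have len: "length (numbers x) = ?m" by (simp add: numbers_def)
  have cols: "concat (map (?g i) [0..<?m + 2]) = concat (map (?g i) [0..<?m]) @ ?g i ?m @ ?g i (?m + 1)" for i
    by simp
  have rows: "concat (map h [0..<?m + 2]) = concat (map h [0..<?m]) @ h ?m @ h (?m + 1)" for h :: "nat \<Rightarrow> bool list"
    by simp
  have num: "numbers x ! i = bits_value (item_bits x (?I ! i))" if "i < ?m" for i
    using that by (simp add: numbers_def)
  have inner: "concat (map (?g i) [0..<?m + 2]) =
      concat (map (\<lambda>u. enc_entry (if ?I ! i = u then False # item_bits x (?I ! i) else [])) ?I)
      @ enc_entry (item_bits x (?I ! i)) @ enc_entry (item_bits x (?I ! i))" if i: "i < ?m" for i
  proof -
    have "?g i j = enc_entry (if ?I ! i = ?I ! j then False # item_bits x (?I ! i) else [])" if "j < ?m" for j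
      using that i distinct_item_list[of x]
      by (auto simp: gadget_entry_def len num enc_numbers nth_eq_iff_index_eq enc_nat_0)
    moreover have "?g i ?m = enc_entry (item_bits x (?I ! i))" "?g i (?m + 1) = enc_entry (item_bits x (?I ! i))"
      using i by (auto simp: gadget_entry_def len num enc_numbers)
    ultimately show ?thesis
      unfolding cols concat_map_nth[of _ ?I] by (auto intro!: arg_cong[of _ _ concat])
  qed
  have "produce x (bind (items_gen 1) row_gen 1) 1 ?e = concat (map (\<lambda>v.
      concat (map (\<lambda>u. enc_entry (if v = u then False # item_bits x v else [])) ?I)
      @ enc_entry (item_bits x v) @ enc_entry (item_bits x v)) ?I)"
    unfolding produce_bind items map_map o_def
    by (intro arg_cong[of _ _ concat] map_cong) (auto intro!: produce_row simp: e0)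
  also have "\<dots> = concat (map (\<lambda>i. concat (map (?g i) [0..<?m + 2])) [0..<?m])"
    by (rule trans[OF concat_map_nth], intro arg_cong[of _ _ concat] map_cong refl inner[symmetric]) simp
  finally have 1: "produce x (bind (items_gen 1) row_gen 1) 1 ?e = \<dots>" .
  have "produce x (bind (items_gen 1) (\<lambda>k u. entry (number_gen k u)) 1) 1 ?e =
      concat (map (\<lambda>v. enc_entry (item_bits x v)) ?I)"
    unfolding produce_bind items map_map o_def
    by (intro arg_cong[of _ _ concat] map_cong) (auto intro!: produce_entry simp: e0 produce_number)
  also have "\<dots> = concat (map (\<lambda>j. enc_entry (item_bits x (?I ! j))) [0..<?m])"
    by (rule concat_map_nth)
  also have "\<dots> = concat (map (?g i) [0..<?m])" if "?m \<le> i" for i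
    using that by (intro arg_cong[of _ _ concat] map_cong) (auto simp: gadget_entry_def len num enc_numbers)
  finally have 2: "produce x (bind (items_gen 1) (\<lambda>k u. entry (number_gen k u)) 1) 1 ?e =
      concat (map (?g i) [0..<?m])" if "?m \<le> i" for i
    using that .
  have 3: "produce x (entry target_gen) 1 ?e = enc_entry (target_bits x)"
    "produce x (entry bound_gen) 1 ?e = enc_entry (bound_bits x)"
    by (auto intro!: produce_entry simp: produce_target produce_bound e0)
  have 4: "?g ?m ?m = enc_entry (bound_bits x)" "?g ?m (?m + 1) = enc_entry (target_bits x)"
    "?g (?m + 1) ?m = enc_entry (target_bits x)" "?g (?m + 1) (?m + 1) = enc_entry (bound_bits x)"
    by (auto simp: gadget_entry_def len enc_numbers)
  have 5: "concat (map (?g ?m) [0..<?m + 2]) =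
      produce x (Then (bind (items_gen 1) (\<lambda>k u. entry (number_gen k u)) 1) (Then (entry bound_gen) (entry target_gen))) 1 ?e"
    "concat (map (?g (?m + 1)) [0..<?m + 2]) =
      produce x (Then (bind (items_gen 1) (\<lambda>k u. entry (number_gen k u)) 1) (Then (entry target_gen) (entry bound_gen))) 1 ?e"
    unfolding cols 4 produce_simps 3 using 2[of ?m] 2[of "?m + 1"] by simp_all
  have M: "aval M ?e = ?m" by (simp add: e0 length_item_list)
  show ?thesis
    unfolding enc_instance_gadget len rows[of "\<lambda>i. concat (map (?g i) [0..<?m + 2])"] 5 1[symmetric]
      instance_gen_def
    by (simp add: M mult.commute)
qed

subsection \<open>Correctness of the reduction\<close>

lemma length_digit_bits [simp]: "length (digit_bits x d) = val x W"
  by (simp add: digit_bits_def val_simps)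

lemma digit_bits_value:
  assumes "d \<le> L"
  shows "bits_value (digit_bits x d) = d"
proof -
  have "d < 2 ^ L" using assms by (meson le_less_trans less_exp)
  then show ?thesis by (simp add: digit_bits_def bits_value_bits take_bit_nat_eq_self)
qed

abbreviation "base x \<equiv> (2 :: nat) ^ val x W"

lemma sum_lessThan_add: "(\<Sum>j<m + n. f j) = (\<Sum>j<m. f j) + (\<Sum>j<n. f (m + j))"
  for f :: "nat \<Rightarrow> nat"
  by (induction n) auto

lemma item_bits_value:
  assumes "u \<in> items (clauses x) (val x R) L"
  shows "bits_value (item_bits x u) = item_number (clauses x) (val x R) L (base x) u"
proof -
  let ?Cs = "clauses x"
  obtain c i where u: "u = (c, i)" by (cases u)
  have pick: "(\<Sum>r<n. of_bool (r = i) * f r) = f i" if "i < n" for i n and f :: "nat \<Rightarrow> nat"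
  proof -
    have "(\<Sum>r<n. of_bool (r = i) * f r) = (\<Sum>r<n. if r = i then f r else 0)"
      by (intro sum.cong) auto
    then show ?thesis using that by simp
  qed
  show ?thesis
  proof (cases "c < 2")
    case True
    let ?s = "c = 0"
    have i: "i < val x R" using assms True by (auto simp: u items_def)
    have mem: "u \<in> digit_items ?Cs L j \<longleftrightarrow> (?s, i) \<in> set (?Cs ! j)" if "j < length ?Cs" for j
      using that True by (force simp: u digit_items_def literal_item_def)
    have own: "u \<in> digit_items ?Cs L (length ?Cs + r) \<longleftrightarrow> r = i" for r
      using True by (auto simp: u digit_items_def)
    have "bits_value (item_bits x u) =
        bits_value (concat (map (\<lambda>cl. digit_bits x (of_bool ((?s, i) \<in> set cl))) ?Cs))
        + 2 ^ (length ?Cs * val x W) * 2 ^ (val x W * i)"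
      using True by (simp add: u item_bits_def length_concat o_def sum_list_triv)
    also have "bits_value (concat (map (\<lambda>cl. digit_bits x (of_bool ((?s, i) \<in> set cl))) ?Cs))
        = (\<Sum>j<length ?Cs. of_bool (u \<in> digit_items ?Cs L j) * base x ^ j)"
      by (subst bits_value_concat[of _ _ "val x W"]) (use L_pos mem in \<open>auto simp: digit_bits_value\<close>)
    also have "(2 :: nat) ^ (length ?Cs * val x W) * 2 ^ (val x W * i) = base x ^ (length ?Cs + i)"
      by (simp add: power_add power_mult[symmetric] mult.commute)
    also have "\<dots> = (\<Sum>r<val x R. of_bool (u \<in> digit_items ?Cs L (length ?Cs + r)) * base x ^ (length ?Cs + r))"
      unfolding own using pick[OF i] by simp
    finally show ?thesis unfolding item_number_def sum_lessThan_add .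
  next
    case False
    then have c: "2 \<le> c" "c \<le> L" "i < length ?Cs" using assms by (auto simp: u items_def)
    have mem: "u \<in> digit_items ?Cs L j \<longleftrightarrow> j = i" for j
      using c by (auto simp: u digit_items_def literal_item_def split: if_splits)
    show ?thesis
      unfolding item_number_def mem using c pick[of i "length ?Cs + val x R" "\<lambda>j. base x ^ j"]
      by (simp add: u item_bits_def power_mult[symmetric])
  qed
qed

lemma target_value: "target x = target_number (clauses x) (val x R) L (base x)"
proof -
  have rep: "bits_value (concat (replicate n (digit_bits x d))) = (\<Sum>j<n. d * base x ^ j)" if "d \<le> L" for n d
    using bits_value_concat[of "[0..<n]" "\<lambda>_. digit_bits x d" "val x W"] that
    by (simp add: map_replicate_const digit_bits_value)
  have "target x = (\<Sum>j<val x J. L * base x ^ j)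
      + 2 ^ (val x W * val x J) * ((\<Sum>j<val x R'. base x ^ j) + 2 ^ (val x W * val x R'))"
    using L_pos by (simp add: target_def target_bits_def rep length_concat sum_list_replicate mult.commute)
  also have "\<dots> = target_number (clauses x) (val x R) L (base x)"
    unfolding target_number_def length_clauses sum_lessThan_add
    by (simp add: val_simps(1) power_mult power_add sum_distrib_left distrib_left)
  finally show ?thesis .
qed

lemma sum_numbers_bound: "sum_list (numbers x) + target x < bnd x"
proof -
  let ?N = "length (clauses x) + val x R"
  have W: "val x M + L < base x"
    using less_exp[of "val x W"] by (simp add: val_simps add.commute)
  have "bits_value (item_bits x u) \<le> base x ^ ?N" if "u \<in> set (item_list x)" for u
    using that digits_less[of ?N "\<lambda>j. of_bool (u \<in> digit_items (clauses x) L j)" "base x"] W L_pos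
    by (simp add: set_item_list item_bits_value item_number_def less_imp_le)
  then have "sum_list (numbers x) \<le> (\<Sum>u\<leftarrow>item_list x. base x ^ ?N)"
    unfolding numbers_def by (rule sum_list_mono)
  also have "\<dots> = val x M * base x ^ ?N"
    by (simp add: sum_list_triv length_item_list)
  finally have "sum_list (numbers x) \<le> val x M * base x ^ ?N" .
  moreover have "target x < base x ^ ?N"
    unfolding target_value target_number_def by (rule digits_less) (use W L_pos in auto)
  ultimately have "sum_list (numbers x) + target x < (val x M + 1) * base x ^ ?N"
    by (simp add: algebra_simps)
  also have "\<dots> \<le> base x * base x ^ ?N"
    using W L_pos by (intro mult_le_mono1) simp
  also have "\<dots> = bnd x"
    by (simp add: bnd_def bound_bits_def length_clauses power_mult[symmetric] power_add[symmetric] algebra_simps)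
  finally show ?thesis .
qed

lemma subset_numbers_iff:
  "(\<exists>S\<subseteq>{..<length (numbers x)}. (\<Sum>i\<in>S. numbers x ! i) = T) \<longleftrightarrow>
   (\<exists>U\<subseteq>set (item_list x). (\<Sum>u\<in>U. bits_value (item_bits x u)) = T)"
proof -
  let ?I = "item_list x"
  have len: "length (numbers x) = length ?I" by (simp add: numbers_def)
  have eq: "(\<Sum>u\<in>(!) ?I ` S. bits_value (item_bits x u)) = (\<Sum>i\<in>S. numbers x ! i)"
    if S: "S \<subseteq> {..<length ?I}" for S
  proof -
    have "inj_on ((!) ?I) S"
      using S distinct_item_list by (intro inj_on_nth) auto
    then have "(\<Sum>u\<in>(!) ?I ` S. bits_value (item_bits x u)) = (\<Sum>i\<in>S. bits_value (item_bits x (?I ! i)))"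
      by (simp add: sum.reindex)
    also have "\<dots> = (\<Sum>i\<in>S. numbers x ! i)"
      using S by (intro sum.cong) (auto simp: numbers_def)
    finally show ?thesis .
  qed
  show ?thesis
  proof
    assume "\<exists>S\<subseteq>{..<length (numbers x)}. (\<Sum>i\<in>S. numbers x ! i) = T"
    then obtain S where "S \<subseteq> {..<length ?I}" "(\<Sum>i\<in>S. numbers x ! i) = T" unfolding len by blast
    with eq show "\<exists>U\<subseteq>set ?I. (\<Sum>u\<in>U. bits_value (item_bits x u)) = T"
      by (intro exI[of _ "(!) ?I ` S"]) auto
  next
    assume "\<exists>U\<subseteq>set ?I. (\<Sum>u\<in>U. bits_value (item_bits x u)) = T"
    then obtain U where U: "U \<subseteq> set ?I" "(\<Sum>u\<in>U. bits_value (item_bits x u)) = T" by blast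
    let ?S = "{i. i < length ?I \<and> ?I ! i \<in> U}"
    have S: "?S \<subseteq> {..<length ?I}" by auto
    have "U = (!) ?I ` ?S" using U(1) by (force simp: in_set_conv_nth)
    with eq[OF S] U(2) have "(\<Sum>i\<in>?S. numbers x ! i) = T" by simp
    with S show "\<exists>S\<subseteq>{..<length (numbers x)}. (\<Sum>i\<in>S. numbers x ! i) = T"
      unfolding len by blast
  qed
qed

lemma polytime_instance: "polytime (\<lambda>x. produce x instance_gen 1 (initial_env (length x)))"
  by (rule polytime_gen[OF gen_ok_instance])

lemma instance_promise: "produce x instance_gen 1 (initial_env (length x)) \<in> enc_instance ` rank_promise"
  unfolding produce_instance using sum_numbers_bound[of x] by (intro imageI gadget_promise) simp

lemma instance_yes_iff:
  assumes "\<And>c s v. c \<in> set (clauses x) \<Longrightarrow> (s, v) \<in> set c \<Longrightarrow> v < val x R"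
  shows "produce x instance_gen 1 (initial_env (length x)) \<in> enc_instance ` rank_yes \<longleftrightarrow>
    (\<exists>\<nu>. sat \<nu> (set (clauses x)))"
proof -
  let ?q = "2 * length (numbers x) + 2" and ?G = "gadget (numbers x) (target x) (bnd x)"
  have square: "square_mat (snd y)" if "y \<in> rank_promise" for y
    using that by (auto simp: rank_promise_def)
  have "rank_yes \<subseteq> rank_promise" by (auto simp: rank_yes_def)
  moreover have "(?q, ?G) \<in> rank_promise"
    using sum_numbers_bound[of x] by (intro gadget_promise) simp
  \<comment> \<open>Injectivity of the encoding excludes that a different yes-instance has the same
    string.\<close>
  ultimately have "enc_instance (?q, ?G) \<in> enc_instance ` rank_yes \<longleftrightarrow> (?q, ?G) \<in> rank_yes"
    using square by (intro inj_on_image_mem_iff[OF inj_on_enc_instance]) fastforce+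
  also have "\<dots> \<longleftrightarrow> (\<exists>S\<subseteq>{..<length (numbers x)}. (\<Sum>i\<in>S. numbers x ! i) = target x)"
  proof (rule gadget_yes_iff)
    have "last (item_bits x u) \<and> item_bits x u \<noteq> []" for u
      by (auto simp: item_bits_def split: prod.splits)
    then show "\<forall>a\<in>set (numbers x). 0 < a"
      by (auto simp: numbers_def intro: bits_value_pos)
  qed (rule sum_numbers_bound)
  also have "\<dots> \<longleftrightarrow> (\<exists>U\<subseteq>set (item_list x). (\<Sum>u\<in>U. bits_value (item_bits x u)) = target x)"
    by (rule subset_numbers_iff)
  also have "\<dots> \<longleftrightarrow> (\<exists>U\<subseteq>items (clauses x) (val x R) L.
      (\<Sum>u\<in>U. item_number (clauses x) (val x R) L (base x) u) = target_number (clauses x) (val x R) L (base x))"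
  proof -
    have "(\<Sum>u\<in>U. bits_value (item_bits x u)) = (\<Sum>u\<in>U. item_number (clauses x) (val x R) L (base x) u)"
      if "U \<subseteq> items (clauses x) (val x R) L" for U
      using that by (intro sum.cong) (auto simp: item_bits_value)
    then show ?thesis unfolding set_item_list target_value by (intro ex_cong1) auto
  qed
  also have "\<dots> \<longleftrightarrow> (\<exists>\<nu>. sat \<nu> (set (clauses x)))"
  proof (rule subset_sum_iff_sat[OF assms])
    show "length c \<le> L" if "c \<in> set (clauses x)" for c
      using that F_length by (auto simp: clauses_def dest!: eval_leaf)
    show "2 * val x R + (L - 1) * length (clauses x) + L < base x"
      using less_exp[of "val x W"] by (simp add: val_simps length_clauses add.commute)
  qed (use L_pos in auto)
  finally show ?thesis unfolding produce_instance .
qed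

end

section \<open>Computations as clauses\<close>

definition gen_all :: "('a \<Rightarrow> (nat \<Rightarrow> nat) \<Rightarrow> bool) \<Rightarrow> bool list \<Rightarrow> 'a gen \<Rightarrow> nat \<Rightarrow> (nat \<Rightarrow> nat) \<Rightarrow> bool" where
  "gen_all \<Phi> x g k env \<longleftrightarrow> (\<forall>(a, k', env')\<in>set (eval x g k env). \<Phi> a env')"

lemma gen_all_simps [simp]:
  "gen_all \<Phi> x (Leaf l) k env \<longleftrightarrow> \<Phi> l env"
  "gen_all \<Phi> x Skip k env"
  "gen_all \<Phi> x (Then g h) k env \<longleftrightarrow> gen_all \<Phi> x g k env \<and> gen_all \<Phi> x h k env"
  "gen_all \<Phi> x (IfEq a b g h) k env \<longleftrightarrow>
     (if aval a env = aval b env then gen_all \<Phi> x g k env else gen_all \<Phi> x h k env)"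
  "gen_all \<Phi> x (IfBit a g h) k env \<longleftrightarrow>
     (if aval a env < length x \<and> x ! aval a env then gen_all \<Phi> x g k env else gen_all \<Phi> x h k env)"
  "gen_all \<Phi> x (For a g) k env \<longleftrightarrow> (\<forall>i<aval a env. gen_all \<Phi> x g (Suc k) (env(k := i)))"
  by (auto simp: gen_all_def ball_Un)

definition seq_gen :: "'a gen list \<Rightarrow> 'a gen" where
  "seq_gen gs = foldr Then gs Skip"

lemma seq_gen_simps [simp]:
  "gen_all \<Phi> x (seq_gen gs) k env \<longleftrightarrow> (\<forall>g\<in>set gs. gen_all \<Phi> x g k env)"
  "gen_ok lv (seq_gen gs) k \<longleftrightarrow> (\<forall>g\<in>set gs. gen_ok lv g k)"
  "balanced (seq_gen gs) \<longleftrightarrow> (\<forall>g\<in>set gs. balanced g)"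
  "set_gen (seq_gen gs) = (\<Union>g\<in>set gs. set_gen g)"
  by (induction gs) (auto simp: seq_gen_def)

lemma eval_map_gen: "eval x (map_gen f g) k env = map (\<lambda>(a, k', env'). (f a, k', env')) (eval x g k env)"
  by (induction g arbitrary: k env) (auto simp: map_concat o_def)

lemma gen_ok_map_gen: "gen_ok lv (map_gen f g) k \<longleftrightarrow> gen_ok (\<lambda>a. lv (f a)) g k"
  by (induction g arbitrary: k) auto

lemma gen_size_map_gen: "gen_size (map_gen f g) = gen_size g"
  by (induction g) auto

lemma balanced_map_gen: "balanced (map_gen f g) \<longleftrightarrow> balanced g"
  by (induction g) (auto simp: gen_size_map_gen)

lemma poly_aexp: "\<exists>e. avars e \<subseteq> {0} \<and> (\<forall>env. aval e env = poly p (env 0))"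
proof (induction p)
  case 0
  show ?case by (intro exI[of _ "Num 0"]) simp
next
  case (pCons a p)
  then obtain e where "avars e \<subseteq> {0}" "\<forall>env. aval e env = poly p (env 0)" by blast
  \<comment> \<open>Horner's scheme.\<close>
  then show ?case by (intro exI[of _ "Plus (Num a) (Times (Var 0) e)"]) auto
qed

lemma length_pair: "length (pair x u) = 2 * length x + 2 + length u"
  by (induction x) (auto simp: pair_def)

lemma nth_pair:
  "i < length x \<Longrightarrow> pair x u ! (2 * i) = x ! i"
  "i < length x \<Longrightarrow> pair x u ! Suc (2 * i) = x ! i"
  "pair x u ! (2 * length x) = False"
  "pair x u ! Suc (2 * length x) = True"
  "pair x u ! (2 * length x + 2 + i) = u ! i"
proof -
  have d: "length (double x) = 2 * length x" by (induction x) auto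
  have n: "i < length x \<Longrightarrow> double x ! (2 * i) = x ! i \<and> double x ! Suc (2 * i) = x ! i"
  proof (induction x arbitrary: i)
    case (Cons b x)
    then show ?case by (cases i) auto
  qed simp
  show "i < length x \<Longrightarrow> pair x u ! (2 * i) = x ! i"
    "i < length x \<Longrightarrow> pair x u ! Suc (2 * i) = x ! i"
    using n by (auto simp: pair_double nth_append d)
  show "pair x u ! (2 * length x) = False" "pair x u ! Suc (2 * length x) = True"
    "pair x u ! (2 * length x + 2 + i) = u ! i"
    by (auto simp: pair_double nth_append d)
qed

text \<open>
  A variable is a triple of a kind, a time and a position. Cells are addressed relative to the head of
  their tape, which is at position \<open>C\<close> throughout; the variable \<open>mark_kind\<close> holds at the relative
  position of cell \<open>0\<close> of the output tape. All clauses about the run are Horn clauses, so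
  that a satisfying assignment has to make true what is true of the run.
\<close>

type_synonym sym_clause = "(bool \<times> nat \<times> aexp \<times> aexp) list"

text \<open>One more than \<open>offset\<close>, to stay within the natural numbers.\<close>

fun shifted :: "move \<Rightarrow> nat" where
  "shifted Left = 0"
| "shifted Stay = 1"
| "shifted Right = 2"

lemma offset_shifted: "offset d = int (shifted d) - 1"
  by (cases d) auto

lemma shifted_le: "shifted d \<le> 2"
  by (cases d) auto

locale cook_levin =
  fixes M :: tm and mA HA :: aexp
  assumes wf: "wf_tm M" and mA_global: "avars mA \<subseteq> {0}" and HA_global: "avars HA \<subseteq> {0}"
begin

abbreviation "k \<equiv> ntapes M"

definition mark_kind :: nat where "mark_kind = nstates M + 1"
definition cell_kind :: "nat \<Rightarrow> nat \<Rightarrow> nat" where "cell_kind \<tau> a = nstates M + 2 + (\<tau> * nsyms M + a)"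
definition kinds :: nat where "kinds = nstates M + 2 + k * nsyms M"

text \<open>With \<open>H\<close> the time bound, the head is drawn at \<open>C = 2 H + 1\<close>.
  After a move \<open>d\<close> the cell just written lies at \<open>C - offset d\<close>, which is
  \<open>C' + (2 - shifted d)\<close>. Reliable information shrinks by one position per step at
  either end and the head travels at most \<open>H\<close>, so there must be about
  \<open>2 H\<close> positions on either side.\<close>

definition "C' = Times (Num 2) HA"
definition "C = Plus C' (Num 1)"
definition "E1 = Plus (Times (Num 2) (Var 0)) (Num 2)"
definition "E = Plus E1 mA"
definition "Q = Plus C (Plus E C)"
text \<open>A copying clause leads from \<open>p + shifted d\<close> to \<open>p + 1\<close>; for
  \<open>p\<close> below \<open>Q\<close> both stay below \<open>P\<close>.\<close>

definition "P = Plus Q (Num 2)"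

text \<open>A halted machine idles explicitly, so that transition clauses cover all times up to the
  bound, whenever it halts.\<close>

definition delta' :: "nat \<Rightarrow> nat list \<Rightarrow> nat \<times> (nat \<times> move) list" where
  "delta' s as = (if s < nstates M then delta M s as else (s, map (\<lambda>a. (a, Stay)) as))"

text \<open>The negated premises of a transition: the state and the scanned symbols at the time in
  register \<open>1\<close>. State variables always carry position \<open>0\<close>.\<close>

definition situation :: "nat \<Rightarrow> nat list \<Rightarrow> sym_clause" where
  "situation s as = (False, s, Var 1, Num 0) # map (\<lambda>\<tau>. (False, cell_kind \<tau> (as ! \<tau>), Var 1, C)) [0..<k]"

text \<open>Seen from the moving head every cell is displaced, so all cells are copied with a shift
  except the scanned one, which is rewritten. A tautology stands in for its copying clause, since
  the number of clauses must not depend on the position.\<close>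

definition step_gen :: "nat \<Rightarrow> nat list \<Rightarrow> sym_clause gen" where
  "step_gen s as = (let pre = situation s as; s' = fst (delta' s as); acts = snd (delta' s as);
      t' = Plus (Var 1) (Num 1); new = Plus (Var 2) (Num 1);
      old = (\<lambda>\<tau>. Plus (Var 2) (Num (shifted (snd (acts ! \<tau>))))) in
    seq_gen (
      [Leaf (pre @ [(True, s', t', Num 0)]),
       For Q (Leaf (pre @ [(False, mark_kind, Var 1, old 1), (True, mark_kind, t', new)]))] @
      map (\<lambda>\<tau>. Then
        (Leaf (pre @ [(True, cell_kind \<tau> (fst (acts ! \<tau>)), t', Plus C' (Num (2 - shifted (snd (acts ! \<tau>)))))]))
        (For Q (seq_gen (map (\<lambda>a. IfEq (old \<tau>) C
            (Leaf [(True, 0, Num 0, Num 0), (False, 0, Num 0, Num 0)])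
            (Leaf (pre @ [(False, cell_kind \<tau> a, Var 1, old \<tau>), (True, cell_kind \<tau> a, t', new)])))
          [0..<nsyms M])))) [0..<k]))"

text \<open>The clauses of the certificate cells are the only ones with two positive literals: here
  the assignment has a choice.\<close>

definition init_gen :: "sym_clause gen" where
  "init_gen = (let cell = (\<lambda>\<tau> a p. (True, cell_kind \<tau> a, Num 0, p));
      bit0 = Plus C (Times (Num 2) (Var 1)); bit1 = Plus bit0 (Num 1);
      sep = Plus C (Times (Num 2) (Var 0)) in
    seq_gen (
      [Leaf [(True, 0, Num 0, Num 0)], Leaf [(True, mark_kind, Num 0, C)],
       For C (Leaf [cell 0 0 (Var 1)]), For (Plus C (Num 2)) (Leaf [cell 0 0 (Plus (Plus C E) (Var 1))]),
       For (Var 0) (IfBit (Var 1) (Then (Leaf [cell 0 2 bit0]) (Leaf [cell 0 2 bit1]))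
         (Then (Leaf [cell 0 1 bit0]) (Leaf [cell 0 1 bit1]))),
       Leaf [cell 0 1 sep], Leaf [cell 0 2 (Plus sep (Num 1))],
       For mA (Leaf [cell 0 1 (Plus (Plus C E1) (Var 1)), cell 0 2 (Plus (Plus C E1) (Var 1))])] @
      map (\<lambda>\<tau>. For P (Leaf [cell \<tau> 0 (Var 1)])) [1..<k]))"

text \<open>All clauses are negative. Since the symbols really on the output tape must be marked
  true, excluding all others leaves \<open>2\<close> and then a blank, that is, the output
  \<open>[True]\<close>.\<close>

definition final_gen :: "sym_clause gen" where
  "final_gen = seq_gen (
      map (\<lambda>s. Leaf [(False, s, HA, Num 0)]) [0..<nstates M] @
      [For Q (seq_gen (
        map (\<lambda>a. Leaf [(False, mark_kind, HA, Var 1), (False, cell_kind 1 a, HA, Var 1)])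
          (filter (\<lambda>a. a \<noteq> 2) [0..<nsyms M]) @
        map (\<lambda>a. Leaf [(False, mark_kind, HA, Var 1), (False, cell_kind 1 a, HA, Plus (Var 1) (Num 1))])
          [1..<nsyms M]))])"

definition run_gen :: "sym_clause gen" where
  "run_gen = Then init_gen (Then final_gen (For HA (seq_gen (map (\<lambda>(s, as). step_gen s as)
     (List.product [0..<Suc (nstates M)] (List.n_lists k [0..<nsyms M]))))))"

definition code_var :: "nat \<Rightarrow> aexp \<Rightarrow> aexp \<Rightarrow> aexp" where
  "code_var a t p = Plus (Times (Plus (Times t P) p) (Num kinds)) (Num a)"

definition code_clause :: "sym_clause \<Rightarrow> clause_leaf" where
  "code_clause = map (\<lambda>(s, a, t, p). (s, code_var a t p))"

definition sym_vars :: "sym_clause \<Rightarrow> nat set" where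
  "sym_vars cl = (\<Union>(s, a, t, p)\<in>set cl. avars t \<union> avars p)"

lemma sym_vars_simps [simp]:
  "sym_vars [] = {}" "sym_vars ((s, a, t, p) # cl) = avars t \<union> avars p \<union> sym_vars cl"
  "sym_vars (cl @ cl') = sym_vars cl \<union> sym_vars cl'"
  by (auto simp: sym_vars_def)

lemma avars_consts [simp]:
  "avars mA \<subseteq> {0}" "avars HA \<subseteq> {0}" "avars C' \<subseteq> {0}" "avars C \<subseteq> {0}" "avars E1 \<subseteq> {0}" "avars E \<subseteq> {0}"
  "avars Q \<subseteq> {0}" "avars P \<subseteq> {0}"
  using mA_global HA_global by (auto simp: C'_def C_def E1_def E_def Q_def P_def)

lemma avars_consts_level [simp]:
  assumes "1 \<le> l"
  shows "avars mA \<subseteq> {..<l}" "avars HA \<subseteq> {..<l}" "avars C' \<subseteq> {..<l}" "avars C \<subseteq> {..<l}" "avars E1 \<subseteq> {..<l}"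
    "avars E \<subseteq> {..<l}" "avars Q \<subseteq> {..<l}" "avars P \<subseteq> {..<l}"
  using avars_consts assms by fastforce+

lemma sym_vars_situation: "2 \<le> l \<Longrightarrow> sym_vars (situation s as) \<subseteq> {..<l}"
  by (auto simp: situation_def sym_vars_def dest: subsetD[OF avars_consts(4)])

lemma gen_ok_run: "gen_ok sym_vars run_gen 1"
  by (auto simp: run_gen_def init_gen_def final_gen_def step_gen_def Let_def sym_vars_situation)

lemma balanced_run: "balanced run_gen"
  by (auto simp: run_gen_def init_gen_def final_gen_def step_gen_def Let_def
      dest: subsetD[OF avars_consts(1)] subsetD[OF avars_consts(2)] subsetD[OF avars_consts(4)]
        subsetD[OF avars_consts(7)] subsetD[OF avars_consts(8)])

text \<open>A situation has \<open>k + 1\<close> literals, and at most two are added.\<close>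

lemma length_run: "cl \<in> set_gen run_gen \<Longrightarrow> length cl \<le> k + 3"
  by (auto simp: run_gen_def init_gen_def final_gen_def step_gen_def Let_def situation_def)

section \<open>Meaning of the clauses and range of their variables\<close>

definition clause_holds :: "(nat \<Rightarrow> nat \<Rightarrow> nat \<Rightarrow> bool) \<Rightarrow> sym_clause \<Rightarrow> (nat \<Rightarrow> nat) \<Rightarrow> bool" where
  "clause_holds \<phi> cl env \<longleftrightarrow> (\<exists>(s, a, t, p)\<in>set cl. \<phi> a (aval t env) (aval p env) = s)"

text \<open>Keeps the variable numbers below \<open>R\<close> and makes the numbering of triples
  invertible.\<close>

definition in_range :: "bool list \<Rightarrow> sym_clause \<Rightarrow> (nat \<Rightarrow> nat) \<Rightarrow> bool" where
  "in_range x cl env \<longleftrightarrow>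
     (\<forall>(s, a, t, p)\<in>set cl. a < kinds \<and> aval t env \<le> val x HA \<and> aval p env < val x P)"

lemma clause_holds_simps [simp]:
  "\<not> clause_holds \<phi> [] env"
  "clause_holds \<phi> ((s, a, t, p) # cl) env \<longleftrightarrow> \<phi> a (aval t env) (aval p env) = s \<or> clause_holds \<phi> cl env"
  "clause_holds \<phi> (cl @ cl') env \<longleftrightarrow> clause_holds \<phi> cl env \<or> clause_holds \<phi> cl' env"
  by (auto simp: clause_holds_def)

lemma in_range_simps [simp]:
  "in_range x [] env"
  "in_range x ((s, a, t, p) # cl) env \<longleftrightarrow>
     a < kinds \<and> aval t env \<le> val x HA \<and> aval p env < val x P \<and> in_range x cl env"
  "in_range x (cl @ cl') env \<longleftrightarrow> in_range x cl env \<and> in_range x cl' env"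
  by (auto simp: in_range_def ball_Un)

lemma aval_consts [simp]:
  assumes "env 0 = length x"
  shows "aval HA env = val x HA" "aval mA env = val x mA"
    "aval C' env = 2 * val x HA" "aval C env = 2 * val x HA + 1"
    "aval E1 env = 2 * length x + 2" "aval E env = 2 * length x + 2 + val x mA"
    "aval Q env = 4 * val x HA + 2 + (2 * length x + 2 + val x mA)"
    "aval P env = 4 * val x HA + 4 + (2 * length x + 2 + val x mA)"
  using assms aval_global[where env = env and x = x, OF mA_global] aval_global[where env = env and x = x, OF HA_global]
  by (simp_all add: C'_def C_def E1_def E_def Q_def P_def)

lemma val_consts:
  "val x C = 2 * val x HA + 1" "val x E = 2 * length x + 2 + val x mA"
  "val x Q = 4 * val x HA + 2 + (2 * length x + 2 + val x mA)"
  "val x P = 4 * val x HA + 4 + (2 * length x + 2 + val x mA)"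
  by (simp_all add: val_def[of x C] val_def[of x E] val_def[of x Q] val_def[of x P] initial_env_def)

lemma initial_env_0 [simp]: "initial_env n 0 = n"
  by (simp add: initial_env_def)

lemma cell_kind_less: "\<tau> < k \<Longrightarrow> a < nsyms M \<Longrightarrow> cell_kind \<tau> a < kinds"
proof -
  assume "\<tau> < k" "a < nsyms M"
  then have "\<tau> * nsyms M + a < Suc \<tau> * nsyms M" by simp
  also have "\<dots> \<le> k * nsyms M" using \<open>\<tau> < k\<close> by (intro mult_le_mono1) simp
  finally show ?thesis by (simp add: cell_kind_def kinds_def)
qed

lemma kinds_less: "s \<le> nstates M \<Longrightarrow> s < kinds" "mark_kind < kinds"
  by (simp_all add: kinds_def mark_kind_def)

lemma machine: "2 \<le> k" "3 \<le> nsyms M" "1 \<le> nstates M"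
  using wf by (auto simp: wf_tm_def)

abbreviation "symbols \<equiv> {as. length as = k \<and> set as \<subseteq> {..<nsyms M}}"

lemma set_n_lists_symbols: "set (List.n_lists k [0..<nsyms M]) = symbols"
  by (auto simp: set_n_lists)

lemma delta'_wf:
  assumes "s \<le> nstates M" "as \<in> symbols"
  shows "fst (delta' s as) \<le> nstates M" "length (snd (delta' s as)) = k"
    "\<tau> < k \<Longrightarrow> fst (snd (delta' s as) ! \<tau>) < nsyms M"
proof -
  have *: "fst (delta' s as) \<le> nstates M \<and> length (snd (delta' s as)) = k
      \<and> (\<forall>b\<in>fst ` set (snd (delta' s as)). b < nsyms M)"
  proof (cases "s < nstates M")
    case True
    then show ?thesis
      using wf assms by (auto simp: wf_tm_def delta'_def subset_iff)
  next
    case False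
    then show ?thesis using assms by (auto simp: delta'_def)
  qed
  then show "fst (delta' s as) \<le> nstates M" "length (snd (delta' s as)) = k" by auto
  from * show "\<tau> < k \<Longrightarrow> fst (snd (delta' s as) ! \<tau>) < nsyms M" by auto
qed

lemma clause_holds_situation [simp]:
  assumes "env 0 = length x"
  shows "clause_holds \<phi> (situation s as) env \<longleftrightarrow>
    \<not> (\<phi> s (env 1) 0 \<and> (\<forall>\<tau><k. \<phi> (cell_kind \<tau> (as ! \<tau>)) (env 1) (val x C)))"
  using assms by (auto simp: situation_def clause_holds_def val_consts)

lemma step_gen_holds:
  "gen_all (clause_holds \<phi>) x (step_gen s as) 2 ((initial_env (length x))(1 := t)) \<longleftrightarrow>
   (\<phi> s t 0 \<and> (\<forall>\<tau><k. \<phi> (cell_kind \<tau> (as ! \<tau>)) t (val x C)) \<longrightarrow>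
     (let s' = fst (delta' s as); acts = snd (delta' s as); d = (\<lambda>\<tau>. shifted (snd (acts ! \<tau>))) in
       \<phi> s' (t + 1) 0 \<and>
       (\<forall>p<val x Q. \<phi> mark_kind t (p + d 1) \<longrightarrow> \<phi> mark_kind (t + 1) (p + 1)) \<and>
       (\<forall>\<tau><k. \<phi> (cell_kind \<tau> (fst (acts ! \<tau>))) (t + 1) (2 * val x HA + (2 - d \<tau>)) \<and>
         (\<forall>p<val x Q. \<forall>a<nsyms M. p + d \<tau> \<noteq> val x C \<longrightarrow>
            \<phi> (cell_kind \<tau> a) t (p + d \<tau>) \<longrightarrow> \<phi> (cell_kind \<tau> a) (t + 1) (p + 1)))))"
  (is "_ \<longleftrightarrow> (?pre \<longrightarrow> ?post)")
proof (cases ?pre)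
  case True
  then show ?thesis
    by (auto simp: step_gen_def Let_def val_consts)
next
  case False
  then show ?thesis
    by (auto simp: step_gen_def Let_def val_consts)
qed

lemma init_gen_holds:
  "gen_all (clause_holds \<phi>) x init_gen 1 (initial_env (length x)) \<longleftrightarrow>
     \<phi> 0 0 0 \<and> \<phi> mark_kind 0 (val x C) \<and>
     (\<forall>p<val x C. \<phi> (cell_kind 0 0) 0 p) \<and> (\<forall>p<val x C + 2. \<phi> (cell_kind 0 0) 0 (val x C + val x E + p)) \<and>
     (\<forall>i<length x. \<phi> (cell_kind 0 (bit_symbol (x ! i))) 0 (val x C + 2 * i) \<and>
        \<phi> (cell_kind 0 (bit_symbol (x ! i))) 0 (val x C + 2 * i + 1)) \<and>
     \<phi> (cell_kind 0 1) 0 (val x C + 2 * length x) \<and> \<phi> (cell_kind 0 2) 0 (val x C + 2 * length x + 1) \<and>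
     (\<forall>i<val x mA. \<phi> (cell_kind 0 1) 0 (val x C + (2 * length x + 2) + i) \<or>
        \<phi> (cell_kind 0 2) 0 (val x C + (2 * length x + 2) + i)) \<and>
     (\<forall>\<tau>\<in>{1..<k}. \<forall>p<val x P. \<phi> (cell_kind \<tau> 0) 0 p)"
  by (auto simp: init_gen_def Let_def val_consts bit_symbol_def)

lemma final_gen_holds:
  "gen_all (clause_holds \<phi>) x final_gen 1 (initial_env (length x)) \<longleftrightarrow>
     (\<forall>s<nstates M. \<not> \<phi> s (val x HA) 0) \<and>
     (\<forall>p<val x Q. \<phi> mark_kind (val x HA) p \<longrightarrow>
       (\<forall>a<nsyms M. (a \<noteq> 2 \<longrightarrow> \<not> \<phi> (cell_kind 1 a) (val x HA) p) \<and>
         (a \<noteq> 0 \<longrightarrow> \<not> \<phi> (cell_kind 1 a) (val x HA) (p + 1))))"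
  by (auto simp: final_gen_def val_consts ball_Un)

lemma run_gen_holds:
  "gen_all (clause_holds \<phi>) x run_gen 1 (initial_env (length x)) \<longleftrightarrow>
     gen_all (clause_holds \<phi>) x init_gen 1 (initial_env (length x)) \<and>
     gen_all (clause_holds \<phi>) x final_gen 1 (initial_env (length x)) \<and>
     (\<forall>t<val x HA. \<forall>s\<le>nstates M. \<forall>as\<in>symbols.
        gen_all (clause_holds \<phi>) x (step_gen s as) 2 ((initial_env (length x))(1 := t)))"
  unfolding run_gen_def
  by (auto simp: set_n_lists_symbols numeral_2_eq_2 less_Suc_eq_le simp del: upt_Suc)

lemma in_range_situation:
  assumes "env 0 = length x" "env 1 \<le> val x HA" "s \<le> nstates M" "as \<in> symbols"
  shows "in_range x (situation s as) env"
proof -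
  have "cell_kind \<tau> (as ! \<tau>) < kinds" if "\<tau> < k" for \<tau>
    using that assms(4) by (intro cell_kind_less) (auto simp: subset_iff)
  then show ?thesis
    using assms by (auto simp: situation_def in_range_def val_consts kinds_def)
qed

lemma in_range_run: "gen_all (in_range x) x run_gen 1 (initial_env (length x))"
proof -
  have 1: "gen_all (in_range x) x init_gen 1 (initial_env (length x))"
    using machine by (auto simp: init_gen_def Let_def val_consts cell_kind_less kinds_less)
  have 2: "gen_all (in_range x) x final_gen 1 (initial_env (length x))"
    using machine by (auto simp: final_gen_def val_consts cell_kind_less kinds_less ball_Un)
  have 3: "gen_all (in_range x) x (step_gen s as) 2 ((initial_env (length x))(1 := t))"
    if "s \<le> nstates M" "as \<in> symbols" "t < val x HA" for s as t
  proof -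
    have sit: "in_range x (situation s as) env" if "env 0 = length x" "env 1 = t" for env
      using that \<open>s \<le> nstates M\<close> \<open>as \<in> symbols\<close> \<open>t < val x HA\<close> by (intro in_range_situation) auto
    have sh: "p + shifted d < 6 + r" if "p < Suc (Suc (Suc (Suc r)))" for p d r
      using shifted_le[of d] that by simp
    show ?thesis
      using that delta'_wf[OF that(1,2)] machine
      by (auto simp: step_gen_def Let_def sit val_consts cell_kind_less kinds_less
          intro: sh)
  qed
  show ?thesis
    unfolding run_gen_def using 1 2 3
    by (auto simp: set_n_lists_symbols numeral_2_eq_2 less_Suc_eq_le simp del: upt_Suc)
qed

subsection \<open>Soundness and completeness\<close>

definition config_at :: "bool list \<Rightarrow> bool list \<Rightarrow> nat \<Rightarrow> config" where
  "config_at x u t = (step M ^^ t) (init_config M (pair x u))"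

definition rel_cell :: "nat \<Rightarrow> tape \<Rightarrow> nat \<Rightarrow> nat" where
  "rel_cell c tp p = fst tp (snd tp + int p - int c)"

lemma rel_cell_act: "rel_cell c (act (b, d) tp) (p + 1) = (if p + shifted d = c then b else rel_cell c tp (p + shifted d))"
proof -
  obtain f h where tp: "tp = (f, h)" by (cases tp)
  have eq: "h + offset d + int (p + 1) - int c = h + int (p + shifted d) - int c"
    by (simp add: offset_shifted)
  have "rel_cell c (act (b, d) tp) (p + 1) = (f(h := b)) (h + int (p + shifted d) - int c)"
    by (simp only: tp rel_cell_def act.simps fst_conv snd_conv eq)
  also have "\<dots> = (if p + shifted d = c then b else rel_cell c tp (p + shifted d))"
    by (auto simp: tp rel_cell_def)
  finally show ?thesis .
qed

lemma rel_cell_act_center: "rel_cell (2 * h + 1) (act (b, d) tp) (2 * h + (2 - shifted d)) = b"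
proof -
  have "snd tp + offset d + int (2 * h + (2 - shifted d)) - int (2 * h + 1) = snd tp"
    using shifted_le[of d] by (simp add: offset_shifted)
  then show ?thesis by (cases tp) (simp add: rel_cell_def)
qed

lemma rel_cell_center: "rel_cell c tp c = read tp"
  by (cases tp) (simp add: rel_cell_def)

lemma rel_cell_input:
  "rel_cell c (input_tape w) p = (if c \<le> p \<and> p < c + length w then bit_symbol (w ! (p - c)) else 0)"
  by (auto simp: rel_cell_def input_tape_def nat_diff_distrib)

lemma rel_cell_blank: "rel_cell c blank_tape p = 0"
  by (simp add: rel_cell_def blank_tape_def)

lemma rel_cell_mark:
  assumes "snd tp + int p = int c"
  shows "rel_cell c tp p = fst tp 0" "rel_cell c tp (p + 1) = fst tp 1"
proof -
  have "snd tp + int p - int c = 0" "snd tp + int (p + 1) - int c = 1"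
    using assms by simp_all
  then show "rel_cell c tp p = fst tp 0" "rel_cell c tp (p + 1) = fst tp 1"
    unfolding rel_cell_def by (simp_all only:)
qed

lemma step_delta':
  assumes "s \<le> nstates M"
  shows "step M (s, ts) = (fst (delta' s (map read ts)), map2 act (snd (delta' s (map read ts))) ts)"
proof (cases "s < nstates M")
  case True
  then show ?thesis by (simp add: step_def delta'_def split: prod.split)
next
  case False
  have "map2 act (map (\<lambda>a. (a, Stay)) (map read ts)) ts = ts"
    by (induction ts) (auto simp: act_stay)
  with False assms show ?thesis by (simp add: step_def delta'_def)
qed

text \<open>The bound on the heads keeps the origin of the output tape inside the reliable
  window.\<close>

definition config_ok :: "nat \<Rightarrow> config \<Rightarrow> bool" where
  "config_ok t c \<longleftrightarrow> fst c \<le> nstates M \<and> length (snd c) = k \<and>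
     (\<forall>\<tau><k. (\<forall>i. fst (snd c ! \<tau>) i < nsyms M) \<and> \<bar>snd (snd c ! \<tau>)\<bar> \<le> int t)"

lemma config_ok_symbols: "config_ok t (s, ts) \<Longrightarrow> map read ts \<in> symbols"
proof -
  assume c: "config_ok t (s, ts)"
  then have "read (ts ! \<tau>) < nsyms M" if "\<tau> < k" for \<tau>
    using that by (cases "ts ! \<tau>") (auto simp: config_ok_def)
  with c have "\<forall>tp\<in>set ts. read tp < nsyms M"
    unfolding config_ok_def by (metis in_set_conv_nth snd_conv)
  with c show ?thesis by (simp add: config_ok_def image_subset_iff)
qed

lemma config_ok_step:
  assumes "config_ok t (s, ts)"
  shows "config_ok (Suc t) (step M (s, ts))"
proof -
  let ?d = "delta' s (map read ts)"
  have s: "s \<le> nstates M" and len: "length ts = k" using assms by (auto simp: config_ok_def)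
  note wf' = delta'_wf[OF s config_ok_symbols[OF assms]]
  have "(\<forall>i. fst (map2 act (snd ?d) ts ! \<tau>) i < nsyms M) \<and> \<bar>snd (map2 act (snd ?d) ts ! \<tau>)\<bar> \<le> int (Suc t)"
    if \<tau>: "\<tau> < k" for \<tau>
  proof -
    obtain b d where bd: "snd ?d ! \<tau> = (b, d)" by (cases "snd ?d ! \<tau>")
    obtain c h where ch: "ts ! \<tau> = (c, h)" by (cases "ts ! \<tau>")
    have "map2 act (snd ?d) ts ! \<tau> = (c(h := b), h + offset d)"
      using \<tau> len wf'(2) by (simp add: bd ch)
    moreover have "\<bar>offset d\<bar> \<le> 1" by (cases d) auto
    moreover have "b < nsyms M" using wf'(3)[OF \<tau>] bd by simp
    moreover have "(\<forall>i. c i < nsyms M) \<and> \<bar>h\<bar> \<le> int t"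
      using assms \<tau> ch by (auto simp: config_ok_def)
    ultimately show ?thesis by auto
  qed
  then show ?thesis
    using wf' len by (simp add: step_delta'[OF s] config_ok_def)
qed

lemma config_ok_at: "config_ok t (config_at x u t)"
proof (induction t)
  case 0
  have "bit_symbol b < nsyms M" for b using machine by (simp add: bit_symbol_def)
  then show ?case
    using machine
    by (auto simp: config_at_def config_ok_def init_config_def nth_Cons' input_tape_def blank_tape_def)
next
  case (Suc t)
  then show ?case
    using config_ok_step[of t "fst (config_at x u t)" "snd (config_at x u t)"]
    by (simp add: config_at_def)
qed

lemma tape_at_0:
  assumes "\<tau> < k"
  shows "snd (config_at x u 0) ! \<tau> = (if \<tau> = 0 then input_tape (pair x u) else blank_tape)"
  using assms by (simp add: config_at_def init_config_def nth_Cons')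

lemma state_at_0: "fst (config_at x u 0) = 0"
  by (simp add: config_at_def init_config_def)

lemma config_at_Suc:
  assumes "config_at x u t = (s, ts)"
  shows "config_at x u (Suc t) = (fst (delta' s (map read ts)), map2 act (snd (delta' s (map read ts))) ts)"
  using step_delta'[of s ts] config_ok_at[of t x u] assms by (simp add: config_at_def config_ok_def)

definition accepts :: "bool list \<Rightarrow> bool list \<Rightarrow> bool" where
  "accepts x u \<longleftrightarrow> (case config_at x u (val x HA) of (s, ts) \<Rightarrow> s = nstates M \<and> holds_string (ts ! 1) [True])"

lemma holds_string_True: "holds_string tp [True] \<longleftrightarrow> fst tp 0 = 2 \<and> fst tp 1 = 0"
  by (auto simp: holds_string_def bit_symbol_def)

text \<open>True facts must be marked true; nothing is said about false ones, which Horn clauses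
  cannot control. A step yields clauses for the positions \<open>1\<close> to \<open>Q\<close> only,
  so the window loses one position at each end.\<close>

definition tracks :: "(nat \<Rightarrow> nat \<Rightarrow> nat \<Rightarrow> bool) \<Rightarrow> bool list \<Rightarrow> nat \<Rightarrow> config \<Rightarrow> bool" where
  "tracks \<phi> x t = (\<lambda>(s, ts). \<phi> s t 0 \<and>
     (\<forall>\<tau><k. \<forall>p. t \<le> p \<and> p + t < val x P \<longrightarrow> \<phi> (cell_kind \<tau> (rel_cell (val x C) (ts ! \<tau>) p)) t p) \<and>
     (\<forall>p. t \<le> p \<and> p + t < val x P \<and> snd (ts ! 1) + int p = int (val x C) \<longrightarrow> \<phi> mark_kind t p))"

lemma tracks_init:
  assumes init: "gen_all (clause_holds \<phi>) x init_gen 1 (initial_env (length x))"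
    and u: "u = map (\<lambda>i. \<phi> (cell_kind 0 2) 0 (val x C + (2 * length x + 2) + i)) [0..<val x mA]"
  shows "tracks \<phi> x 0 (config_at x u 0)"
proof -
  let ?c = "val x C" and ?n = "length x" and ?m = "val x mA"
  let ?w = "pair x u"
  note I = init[unfolded init_gen_holds]
  have len: "length ?w = val x E" using u by (simp add: length_pair val_consts)
  have bit: "\<phi> (cell_kind 0 (bit_symbol (?w ! j))) 0 (?c + j)" if j: "j < val x E" for j
  proof -
    consider i where "j = 2 * i" "i < ?n" | i where "j = Suc (2 * i)" "i < ?n" | "j = 2 * ?n" | "j = Suc (2 * ?n)"
      | i where "j = 2 * ?n + 2 + i" "i < ?m"
    proof -
      assume *: "\<And>i. j = 2 * i \<Longrightarrow> i < ?n \<Longrightarrow> thesis" "\<And>i. j = Suc (2 * i) \<Longrightarrow> i < ?n \<Longrightarrow> thesis"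
        "j = 2 * ?n \<Longrightarrow> thesis" "j = Suc (2 * ?n) \<Longrightarrow> thesis" "\<And>i. j = 2 * ?n + 2 + i \<Longrightarrow> i < ?m \<Longrightarrow> thesis"
      show thesis
      proof (cases "j < 2 * ?n")
        case True
        then show ?thesis using *(1)[of "j div 2"] *(2)[of "j div 2"] by (cases "even j") auto
      next
        case False
        then show ?thesis
          using *(3,4) *(5)[of "j - (2 * ?n + 2)"] j by (auto simp: val_consts) linarith
      qed
    qed
    then show ?thesis
    proof cases
      case (5 i)
      have "u ! i = \<phi> (cell_kind 0 2) 0 (?c + (2 * ?n + 2) + i)" using u 5 by simp
      moreover have "\<phi> (cell_kind 0 1) 0 (?c + (2 * ?n + 2) + i) \<or> \<phi> (cell_kind 0 2) 0 (?c + (2 * ?n + 2) + i)"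
        using I 5 by blast
      ultimately have "\<phi> (cell_kind 0 (bit_symbol (u ! i))) 0 (?c + (2 * ?n + 2) + i)"
        by (auto simp: bit_symbol_def)
      moreover have "?w ! j = u ! i" unfolding 5 by (rule nth_pair)
      ultimately show ?thesis by (simp add: 5 add.assoc)
    qed (use I in \<open>auto simp: nth_pair bit_symbol_def\<close>)
  qed
  have cell: "\<phi> (cell_kind \<tau> (rel_cell ?c (snd (config_at x u 0) ! \<tau>) p)) 0 p"
    if \<tau>: "\<tau> < k" and p: "p < val x P" for \<tau> p
  proof (cases "\<tau> = 0")
    case False
    then have "\<phi> (cell_kind \<tau> 0) 0 p" using I \<tau> p by auto
    then show ?thesis using False \<tau> by (simp add: tape_at_0 rel_cell_blank)
  next
    case True
    consider "p < ?c" | "?c \<le> p" "p < ?c + val x E" | "?c + val x E \<le> p" by linarith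
    then show ?thesis
    proof cases
      case 1
      then have "\<phi> (cell_kind 0 0) 0 p" using I by blast
      then show ?thesis using True \<tau> 1 by (simp add: tape_at_0 rel_cell_input)
    next
      case 2
      then show ?thesis
        using True \<tau> bit[of "p - ?c"] len by (simp add: tape_at_0 rel_cell_input)
    next
      case 3
      then have "p - (?c + val x E) < ?c + 2" "p = ?c + val x E + (p - (?c + val x E))"
        using p by (auto simp: val_consts)
      then have "\<phi> (cell_kind 0 0) 0 p" using I by metis
      then show ?thesis using True \<tau> 3 len by (simp add: tape_at_0 rel_cell_input)
    qed
  qed
  have "snd (snd (config_at x u 0) ! 1) = 0"
    using machine by (subst tape_at_0) (auto simp: blank_tape_def)
  then show ?thesis
    using I cell by (auto simp: tracks_def state_at_0 case_prod_unfold)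
qed

lemma tracks_step:
  assumes ok: "config_ok t (s, ts)" and tr: "tracks \<phi> x t (s, ts)" and t: "t < val x HA"
    and gen: "gen_all (clause_holds \<phi>) x (step_gen s (map read ts)) 2 ((initial_env (length x))(1 := t))"
  shows "tracks \<phi> x (Suc t) (fst (delta' s (map read ts)), map2 act (snd (delta' s (map read ts))) ts)"
proof -
  let ?c = "val x C" and ?acts = "snd (delta' s (map read ts))"
  let ?sh = "\<lambda>\<tau>. shifted (snd (?acts ! \<tau>))"
  have s: "s \<le> nstates M" and len: "length ts = k" using ok by (auto simp: config_ok_def)
  note wf' = delta'_wf[OF s config_ok_symbols[OF ok]]
  have cells: "\<phi> (cell_kind \<tau> (rel_cell ?c (ts ! \<tau>) p)) t p" if "\<tau> < k" "t \<le> p" "p + t < val x P" for \<tau> p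
    using tr that by (simp add: tracks_def)
  have marks: "\<phi> mark_kind t p" if "t \<le> p" "p + t < val x P" "snd (ts ! 1) + int p = int ?c" for p
    using tr that by (simp add: tracks_def)
  have cpos: "t \<le> ?c" "?c + t < val x P" using t by (auto simp: val_consts)
  have "\<phi> (cell_kind \<tau> (map read ts ! \<tau>)) t ?c" if "\<tau> < k" for \<tau>
    using cells[OF that cpos] that len by (simp add: rel_cell_center)
  moreover have "\<phi> s t 0" using tr by (simp add: tracks_def)
  ultimately have G: "\<phi> (fst (delta' s (map read ts))) (t + 1) 0"
    "\<And>p. p < val x Q \<Longrightarrow> \<phi> mark_kind t (p + ?sh 1) \<Longrightarrow> \<phi> mark_kind (t + 1) (p + 1)"
    "\<And>\<tau>. \<tau> < k \<Longrightarrow> \<phi> (cell_kind \<tau> (fst (?acts ! \<tau>))) (t + 1) (2 * val x HA + (2 - ?sh \<tau>))"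
    "\<And>\<tau> p a. \<tau> < k \<Longrightarrow> p < val x Q \<Longrightarrow> a < nsyms M \<Longrightarrow> p + ?sh \<tau> \<noteq> ?c \<Longrightarrow>
       \<phi> (cell_kind \<tau> a) t (p + ?sh \<tau>) \<Longrightarrow> \<phi> (cell_kind \<tau> a) (t + 1) (p + 1)"
    using gen unfolding step_gen_holds Let_def by blast+
  have nth: "map2 act ?acts ts ! \<tau> = act (?acts ! \<tau>) (ts ! \<tau>)" if "\<tau> < k" for \<tau>
    using that len wf'(2) by simp
  have old: "p < val x Q" "t \<le> p + ?sh \<tau>" "p + ?sh \<tau> + t < val x P"
    if "Suc t \<le> p + 1" "p + 1 + Suc t < val x P" for p \<tau>
    using that shifted_le[of "snd (?acts ! \<tau>)"] by (auto simp: val_consts)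
  have cell: "\<phi> (cell_kind \<tau> (rel_cell ?c (map2 act ?acts ts ! \<tau>) (p + 1))) (t + 1) (p + 1)"
    if \<tau>: "\<tau> < k" and p: "Suc t \<le> p + 1" "p + 1 + Suc t < val x P" for \<tau> p
  proof -
    obtain b d where bd: "?acts ! \<tau> = (b, d)" by (cases "?acts ! \<tau>")
    show ?thesis
    proof (cases "p + shifted d = ?c")
      case True
      then have "p + 1 = 2 * val x HA + (2 - shifted d)"
        using shifted_le[of d] by (simp add: val_consts)
      with G(3)[OF \<tau>] True show ?thesis unfolding nth[OF \<tau>] bd rel_cell_act by (simp add: bd)
    next
      case False
      let ?a = "rel_cell ?c (ts ! \<tau>) (p + shifted d)"
      have "?a < nsyms M" using ok \<tau> by (auto simp: config_ok_def rel_cell_def)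
      moreover have "\<phi> (cell_kind \<tau> ?a) t (p + shifted d)"
        using cells[OF \<tau>] old(2,3)[OF p, of \<tau>] by (simp add: bd)
      ultimately show ?thesis
        using G(4)[OF \<tau> old(1)[OF p]] False unfolding nth[OF \<tau>] bd rel_cell_act by (simp add: bd)
    qed
  qed
  have mark: "\<phi> mark_kind (t + 1) (p + 1)"
    if p: "Suc t \<le> p + 1" "p + 1 + Suc t < val x P" and m: "snd (map2 act ?acts ts ! 1) + int (p + 1) = int ?c" for p
  proof -
    have "snd (map2 act ?acts ts ! 1) = snd (ts ! 1) + offset (snd (?acts ! 1))"
      using nth[of 1] machine by (cases "?acts ! 1"; cases "ts ! 1") simp
    then have "snd (ts ! 1) + int (p + ?sh 1) = int ?c"
      using m by (simp add: offset_shifted)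
    then have "\<phi> mark_kind t (p + ?sh 1)"
      by (intro marks old[OF p])
    then show ?thesis by (rule G(2)[OF old(1)[OF p]])
  qed
  have "\<exists>q. p = q + 1" if "Suc t \<le> p" for p using that by (intro exI[of _ "p - 1"]) simp
  then show ?thesis
    unfolding tracks_def prod.case using G(1) cell mark by (metis Suc_eq_plus1)
qed

lemma soundness:
  assumes "gen_all (clause_holds \<phi>) x run_gen 1 (initial_env (length x))"
  shows "\<exists>u. length u = val x mA \<and> accepts x u"
proof -
  \<comment> \<open>The certificate is read off the assignment; a cell marked with both symbols
    counts as \<open>True\<close>.\<close>
  define u where "u = map (\<lambda>i. \<phi> (cell_kind 0 2) 0 (val x C + (2 * length x + 2) + i)) [0..<val x mA]"
  note G = assms[unfolded run_gen_holds]
  have tr: "tracks \<phi> x t (config_at x u t)" if "t \<le> val x HA" for t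
    using that
  proof (induction t)
    case 0
    show ?case
      by (rule tracks_init[where \<phi> = \<phi>]) (use G u_def in blast)+
  next
    case (Suc t)
    obtain s ts where c: "config_at x u t = (s, ts)" by (cases "config_at x u t")
    have ok: "config_ok t (s, ts)" using config_ok_at[of t x u] c by simp
    have "s \<le> nstates M" using ok by (simp add: config_ok_def)
    then have "gen_all (clause_holds \<phi>) x (step_gen s (map read ts)) 2 ((initial_env (length x))(1 := t))"
      using G Suc.prems config_ok_symbols[OF ok] by auto
    then show ?case
      using Suc c ok unfolding config_at_Suc[OF c] by (intro tracks_step) auto
  qed
  let ?h = "val x HA"
  obtain s ts where c: "config_at x u ?h = (s, ts)" by (cases "config_at x u ?h")
  have ok: "config_ok ?h (s, ts)" using config_ok_at[of ?h x u] c by simp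
  have T: "tracks \<phi> x ?h (s, ts)" using tr[of ?h] c by simp
  have F: "\<And>s. s < nstates M \<Longrightarrow> \<not> \<phi> s ?h 0"
    "\<And>p a. p < val x Q \<Longrightarrow> \<phi> mark_kind ?h p \<Longrightarrow> a < nsyms M \<Longrightarrow> \<phi> (cell_kind 1 a) ?h p \<Longrightarrow> a = 2"
    "\<And>p a. p < val x Q \<Longrightarrow> \<phi> mark_kind ?h p \<Longrightarrow> a < nsyms M \<Longrightarrow> \<phi> (cell_kind 1 a) ?h (p + 1) \<Longrightarrow> a = 0"
    using G unfolding final_gen_holds by blast+
  have "\<not> s < nstates M" using F(1)[of s] T by (auto simp: tracks_def)
  then have "s = nstates M" using ok by (simp add: config_ok_def)
  moreover have "fst (ts ! 1) 0 = 2 \<and> fst (ts ! 1) 1 = 0"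
  proof -
    let ?tp = "ts ! 1"
    have head: "\<bar>snd ?tp\<bar> \<le> int ?h" and sym: "\<And>i. fst ?tp i < nsyms M"
      using ok machine by (auto simp: config_ok_def)
    \<comment> \<open>The relative position of cell \<open>0\<close> of the output tape.\<close>
    define p where "p = nat (int (val x C) - snd ?tp)"
    have p: "snd ?tp + int p = int (val x C)" "?h \<le> p" "p + 1 + ?h < val x P" "p < val x Q"
      using head by (auto simp: p_def val_consts)
    have m: "\<phi> mark_kind ?h p" using T p by (auto simp: tracks_def)
    note rel_cell_mark[OF p(1)]
    moreover have "\<phi> (cell_kind 1 (rel_cell (val x C) ?tp q)) ?h q" if "q = p \<or> q = p + 1" for q
      using T p that machine by (auto simp: tracks_def)
    ultimately have "\<phi> (cell_kind 1 (fst ?tp 0)) ?h p" "\<phi> (cell_kind 1 (fst ?tp 1)) ?h (p + 1)"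
      by metis+
    then show ?thesis using F(2,3)[OF p(4) m sym] by blast
  qed
  ultimately have "accepts x u" using c by (simp add: accepts_def holds_string_True)
  then show ?thesis by (intro exI[of _ u]) (simp add: u_def)
qed

definition truth :: "bool list \<Rightarrow> bool list \<Rightarrow> nat \<Rightarrow> nat \<Rightarrow> nat \<Rightarrow> bool" where
  "truth x u a t p = (case config_at x u t of (s, ts) \<Rightarrow>
     if a \<le> nstates M then a = s
     else if a = mark_kind then snd (ts ! 1) + int p = int (val x C)
     else let b = a - (nstates M + 2) in rel_cell (val x C) (ts ! (b div nsyms M)) p = b mod nsyms M)"

lemma truth_simps:
  assumes "config_at x u t = (s, ts)"
  shows "s' \<le> nstates M \<Longrightarrow> truth x u s' t p \<longleftrightarrow> s' = s"
    "truth x u mark_kind t p \<longleftrightarrow> snd (ts ! 1) + int p = int (val x C)"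
    "a < nsyms M \<Longrightarrow> truth x u (cell_kind \<tau> a) t p \<longleftrightarrow> rel_cell (val x C) (ts ! \<tau>) p = a"
  using assms by (auto simp: truth_def mark_kind_def cell_kind_def Let_def)

lemma completeness:
  assumes u: "length u = val x mA" and acc: "accepts x u"
  shows "gen_all (clause_holds (truth x u)) x run_gen 1 (initial_env (length x))"
proof -
  let ?c = "val x C" and ?w = "pair x u"
  obtain s0 ts0 where c0: "config_at x u 0 = (s0, ts0)" by (cases "config_at x u 0")
  have s0: "s0 = 0" using state_at_0[of x u] c0 by simp
  have ts0: "ts0 ! \<tau> = (if \<tau> = 0 then input_tape ?w else blank_tape)" if "\<tau> < k" for \<tau>
    using tape_at_0[OF that, of x u] c0 by simp
  have len: "length ?w = val x E" using u by (simp add: length_pair val_consts)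
  have k: "0 < k" "1 < k" and sy: "0 < nsyms M" "1 < nsyms M" "2 < nsyms M" using machine by auto
  have bs: "bit_symbol b < nsyms M" for b using machine by (simp add: bit_symbol_def)
  note t0 = truth_simps[OF c0]
  have cell0: "truth x u (cell_kind 0 a) 0 p \<longleftrightarrow>
      (if ?c \<le> p \<and> p < ?c + val x E then bit_symbol (?w ! (p - ?c)) else 0) = a" if "a < nsyms M" for a p
    using that ts0[OF k(1)] by (simp add: t0 rel_cell_input len)
  have init: "gen_all (clause_holds (truth x u)) x init_gen 1 (initial_env (length x))"
    unfolding init_gen_holds
  proof (intro conjI allI impI ballI)
    show "truth x u 0 0 0" by (simp add: t0 s0)
    show "truth x u mark_kind 0 ?c" using k ts0[of 1] by (simp add: t0 blank_tape_def)
  next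
    fix i assume i: "i < length x"
    then have "?c + 2 * i < ?c + val x E" "?c + 2 * i + 1 < ?c + val x E" by (auto simp: val_consts)
    then show "truth x u (cell_kind 0 (bit_symbol (x ! i))) 0 (?c + 2 * i)"
      "truth x u (cell_kind 0 (bit_symbol (x ! i))) 0 (?c + 2 * i + 1)"
      using i by (auto simp: cell0[OF bs] nth_pair)
  next
    fix i assume i: "i < val x mA"
    define q where "q = ?c + (2 * length x + 2) + i"
    have "?w ! (q - ?c) = u ! i"
      using nth_pair(5)[of x u i] by (simp add: q_def add.assoc)
    moreover have "?c \<le> q" "q < ?c + val x E" using i by (simp_all add: q_def val_consts)
    ultimately have "truth x u (cell_kind 0 1) 0 q \<or> truth x u (cell_kind 0 2) 0 q"
      by (simp add: cell0[OF sy(2)] cell0[OF sy(3)] bit_symbol_def del: One_nat_def)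
    then show "truth x u (cell_kind 0 1) 0 (?c + (2 * length x + 2) + i) \<or>
        truth x u (cell_kind 0 2) 0 (?c + (2 * length x + 2) + i)"
      unfolding q_def .
  next
    fix \<tau> p assume "\<tau> \<in> {1..<k}"
    then show "truth x u (cell_kind \<tau> 0) 0 p" using ts0[of \<tau>] by (simp add: t0 sy rel_cell_blank)
  next
    show "truth x u (cell_kind 0 1) 0 (?c + 2 * length x)"
      unfolding cell0[OF sy(2)] by (simp add: nth_pair bit_symbol_def val_consts(2))
    show "truth x u (cell_kind 0 2) 0 (?c + 2 * length x + 1)"
      unfolding cell0[OF sy(3)] by (simp add: nth_pair bit_symbol_def val_consts(2))
  qed (auto simp: cell0 sy)
  let ?h = "val x HA"
  obtain s ts where c: "config_at x u ?h = (s, ts)" by (cases "config_at x u ?h")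
  have s: "s = nstates M" and out: "fst (ts ! 1) 0 = 2" "fst (ts ! 1) 1 = 0"
    using acc c by (auto simp: accepts_def holds_string_True)
  have final: "gen_all (clause_holds (truth x u)) x final_gen 1 (initial_env (length x))"
    unfolding final_gen_holds
  proof (intro conjI allI impI)
    show "\<not> truth x u s' ?h 0" if "s' < nstates M" for s'
      using that s by (simp add: truth_simps[OF c])
  next
    fix p a assume m: "truth x u mark_kind ?h p" and a: "a < nsyms M"
    then have p: "snd (ts ! 1) + int p = int ?c" by (simp add: truth_simps[OF c])
    note rel = rel_cell_mark[OF p]
    from rel show "a \<noteq> 2 \<Longrightarrow> \<not> truth x u (cell_kind 1 a) ?h p"
      "a \<noteq> 0 \<Longrightarrow> \<not> truth x u (cell_kind 1 a) ?h (p + 1)"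
      using out a by (auto simp: truth_simps[OF c])
  qed
  have "gen_all (clause_holds (truth x u)) x (step_gen s as) 2 ((initial_env (length x))(1 := t))"
    if s: "s \<le> nstates M" and as: "as \<in> symbols" for s as t
    unfolding step_gen_holds
  proof (rule impI)
    obtain s' ts where c: "config_at x u t = (s', ts)" by (cases "config_at x u t")
    have ok: "config_ok t (s', ts)" using config_ok_at[of t x u] c by simp
    have lents: "length ts = k" using ok by (simp add: config_ok_def)
    have as_less: "as ! \<tau> < nsyms M" if "\<tau> < k" for \<tau> using as that by (auto simp: subset_iff)
    assume pre: "truth x u s t 0 \<and> (\<forall>\<tau><k. truth x u (cell_kind \<tau> (as ! \<tau>)) t ?c)"
    then have "s' = s" using s by (simp add: truth_simps[OF c])
    \<comment> \<open>At each time only one situation is active, namely the scanned one; all other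
      transition clauses hold vacuously.\<close>
    have "as = map read ts"
      using pre as lents as_less
      by (intro nth_equalityI) (auto simp: truth_simps[OF c] rel_cell_center)
    let ?acts = "snd (delta' s as)"
    note wf' = delta'_wf[OF s as]
    have c1: "config_at x u (t + 1) = (fst (delta' s as), map2 act ?acts ts)"
      using config_at_Suc[OF c] \<open>s' = s\<close> \<open>as = map read ts\<close> by simp
    note t1 = truth_simps[OF c1] and t0 = truth_simps[OF c]
    have nth: "map2 act ?acts ts ! \<tau> = act (?acts ! \<tau>) (ts ! \<tau>)" if "\<tau> < k" for \<tau>
      using that lents wf'(2) by simp
    show "let s' = fst (delta' s as); acts = snd (delta' s as); d = (\<lambda>\<tau>. shifted (snd (acts ! \<tau>))) in
       truth x u s' (t + 1) 0 \<and>
       (\<forall>p<val x Q. truth x u mark_kind t (p + d 1) \<longrightarrow> truth x u mark_kind (t + 1) (p + 1)) \<and>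
       (\<forall>\<tau><k. truth x u (cell_kind \<tau> (fst (acts ! \<tau>))) (t + 1) (2 * val x HA + (2 - d \<tau>)) \<and>
         (\<forall>p<val x Q. \<forall>a<nsyms M. p + d \<tau> \<noteq> ?c \<longrightarrow>
            truth x u (cell_kind \<tau> a) t (p + d \<tau>) \<longrightarrow> truth x u (cell_kind \<tau> a) (t + 1) (p + 1)))"
      unfolding Let_def
    proof (intro conjI allI impI)
      show "truth x u (fst (delta' s as)) (t + 1) 0" using wf'(1) by (simp only: t1)
    next
      fix p assume "truth x u mark_kind t (p + shifted (snd (?acts ! 1)))"
      moreover have "snd (map2 act ?acts ts ! 1) = snd (ts ! 1) + offset (snd (?acts ! 1))"
        using nth[of 1] k by (cases "?acts ! 1"; cases "ts ! 1") simp
      ultimately show "truth x u mark_kind (t + 1) (p + 1)"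
        unfolding t1 t0 by (simp add: offset_shifted)
    next
      fix \<tau> assume \<tau>: "\<tau> < k"
      obtain b d where bd: "?acts ! \<tau> = (b, d)" by (cases "?acts ! \<tau>")
      have "b < nsyms M" using wf'(3)[OF \<tau>] bd by simp
      then show "truth x u (cell_kind \<tau> (fst (?acts ! \<tau>))) (t + 1) (2 * val x HA + (2 - shifted (snd (?acts ! \<tau>))))"
        unfolding bd fst_conv snd_conv
        by (subst t1(3)) (simp_all only: nth[OF \<tau>] bd val_consts rel_cell_act_center)
      fix p a
      assume a: "a < nsyms M" and ne: "p + shifted (snd (?acts ! \<tau>)) \<noteq> ?c"
        and old: "truth x u (cell_kind \<tau> a) t (p + shifted (snd (?acts ! \<tau>)))"
      then show "truth x u (cell_kind \<tau> a) (t + 1) (p + 1)"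
        unfolding t1(3)[OF a] t0(3)[OF a] nth[OF \<tau>] bd rel_cell_act snd_conv by simp
    qed
  qed
  with init final show ?thesis unfolding run_gen_holds by blast
qed

subsection \<open>The reduction\<close>

definition F :: "clause_leaf gen" where "F = map_gen code_clause run_gen"
text \<open>Times run from \<open>0\<close> to the bound inclusive.\<close>

definition R' :: aexp where "R' = Times (Times (Plus HA (Num 1)) P) (Num kinds)"

definition var_id :: "bool list \<Rightarrow> nat \<Rightarrow> nat \<Rightarrow> nat \<Rightarrow> nat" where
  "var_id x a t p = (t * val x P + p) * kinds + a"

lemma gen_ok_mono:
  assumes "gen_ok lv g l" "\<And>a l'. l \<le> l' \<Longrightarrow> lv a \<subseteq> {..<l'} \<Longrightarrow> lv' a \<subseteq> {..<l'}"
  shows "gen_ok lv' g l"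
  using assms
proof (induction g arbitrary: l)
  case (For b g)
  from For.prems have "gen_ok lv' g (Suc l)"
    by (intro For.IH) auto
  with For.prems show ?case by simp
qed simp_all

lemma clause_vars_code: "1 \<le> l \<Longrightarrow> sym_vars cl \<subseteq> {..<l} \<Longrightarrow> clause_vars (code_clause cl) \<subseteq> {..<l}"
proof -
  assume l: "1 \<le> l" and cl: "sym_vars cl \<subseteq> {..<l}"
  have "avars (code_var a t p) \<subseteq> {..<l}" if "(s, a, t, p) \<in> set cl" for s a t p
  proof -
    have "avars t \<union> avars p \<subseteq> sym_vars cl" using that by (auto simp: sym_vars_def)
    with cl have "avars t \<subseteq> {..<l}" "avars p \<subseteq> {..<l}" by auto
    with l show ?thesis by (simp add: code_var_def)
  qed
  then show ?thesis by (fastforce simp: clause_vars_def code_clause_def subset_iff)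
qed

lemma cnf_generator: "cnf_generator F R' (k + 3)"
proof
  show "gen_ok clause_vars F 1"
    unfolding F_def gen_ok_map_gen
    by (rule gen_ok_mono[OF gen_ok_run]) (rule clause_vars_code)
  show "balanced F" by (simp add: F_def balanced_map_gen balanced_run)
  show "avars R' \<subseteq> {0}" using avars_consts(2,8) by (simp add: R'_def)
  show "length cl \<le> k + 3" if "cl \<in> set_gen F" for cl
    using that length_run by (auto simp: F_def gen.set_map code_clause_def)
qed simp

sublocale cnf: cnf_generator F R' "k + 3"
  by (rule cnf_generator)

lemma set_clauses:
  "set (cnf.clauses x) = (\<lambda>(cl, _, env). map (\<lambda>(s, a, t, p). (s, var_id x a (aval t env) (aval p env))) cl)
     ` set (eval x run_gen 1 (initial_env (length x)))"
proof -
  have "clause_val (code_clause cl, l, env) = map (\<lambda>(s, a, t, p). (s, var_id x a (aval t env) (aval p env))) cl"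
    if "(cl, l, env) \<in> set (eval x run_gen 1 (initial_env (length x)))" for cl l env
  proof -
    have "env 0 = length x" using eval_env[OF that] by simp
    then show ?thesis
      by (auto simp: code_clause_def code_var_def var_id_def val_consts)
  qed
  then show ?thesis
    unfolding cnf.clauses_def unfolding F_def eval_map_gen set_map image_image
    by (intro image_cong refl) (auto simp del: clause_val.simps)
qed

lemma sat_clauses_iff:
  "sat \<nu> (set (cnf.clauses x)) \<longleftrightarrow>
   gen_all (clause_holds (\<lambda>a t p. \<nu> (var_id x a t p))) x run_gen 1 (initial_env (length x))"
  unfolding sat_def set_clauses gen_all_def clause_holds_def ball_simps
proof (intro ball_cong refl)
  fix y :: "sym_clause \<times> nat \<times> (nat \<Rightarrow> nat)"
  obtain cl l env where y: "y = (cl, l, env)" by (cases y)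
  have "(\<exists>(s, v)\<in>set (map (\<lambda>(s, a, t, p). (s, var_id x a (aval t env) (aval p env))) cl). \<nu> v = s) \<longleftrightarrow>
      (\<exists>(s, a, t, p)\<in>set cl. \<nu> (var_id x a (aval t env) (aval p env)) = s)"
    by (induction cl) auto
  then show "(\<exists>(s, v)\<in>set (case y of (cl, _, env) \<Rightarrow>
        map (\<lambda>(s, a, t, p). (s, var_id x a (aval t env) (aval p env))) cl). \<nu> v = s) \<longleftrightarrow>
      (case y of (cl, _, env) \<Rightarrow> \<exists>(s, a, t, p)\<in>set cl. \<nu> (var_id x a (aval t env) (aval p env)) = s)"
    unfolding y prod.case .
qed

lemma var_id_less:
  assumes "a < kinds" "t \<le> val x HA" "p < val x P"
  shows "var_id x a t p < val x cnf.R"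
proof -
  have "t * val x P + p < Suc t * val x P" using assms by simp
  also have "\<dots> \<le> (val x HA + 1) * val x P" using assms by (intro mult_le_mono1) simp
  finally have "t * val x P + p + 1 \<le> (val x HA + 1) * val x P" by simp
  then have "(t * val x P + p + 1) * kinds \<le> (val x HA + 1) * val x P * kinds"
    by (rule mult_le_mono1)
  moreover have "var_id x a t p < (t * val x P + p + 1) * kinds"
    using assms by (simp add: var_id_def)
  moreover have "val x cnf.R = (val x HA + 1) * val x P * kinds + 1"
    unfolding cnf.R_def unfolding R'_def val_def aval.simps ..
  ultimately show ?thesis by linarith
qed

lemma clause_var_less:
  assumes "c \<in> set (cnf.clauses x)" "(s, v) \<in> set c"
  shows "v < val x cnf.R"
proof -
  obtain cl l env a t p where "(cl, l, env) \<in> set (eval x run_gen 1 (initial_env (length x)))"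
    and cl: "(s, a, t, p) \<in> set cl" and v: "v = var_id x a (aval t env) (aval p env)"
    using assms unfolding set_clauses by fastforce
  then have "in_range x cl env" using in_range_run[of x] by (auto simp: gen_all_def)
  with cl show ?thesis unfolding v by (intro var_id_less) (auto simp: in_range_def)
qed

lemma sat_iff_accepts: "(\<exists>\<nu>. sat \<nu> (set (cnf.clauses x))) \<longleftrightarrow> (\<exists>u. length u = val x mA \<and> accepts x u)"
proof
  assume "\<exists>\<nu>. sat \<nu> (set (cnf.clauses x))"
  then obtain \<nu> where "sat \<nu> (set (cnf.clauses x))" by (elim exE)
  then show "\<exists>u. length u = val x mA \<and> accepts x u"
    unfolding sat_clauses_iff by (rule soundness)
next
  assume "\<exists>u. length u = val x mA \<and> accepts x u"
  then obtain u where u: "length u = val x mA" "accepts x u" by blast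
  \<comment> \<open>Decoding of the mixed-radix variable number; time is the outermost digit and
    needs no bound.\<close>
  define \<nu> where "\<nu> = (\<lambda>v. truth x u (v mod kinds) (v div kinds div val x P) (v div kinds mod val x P))"
  have \<nu>: "\<nu> (var_id x a t p) = truth x u a t p" if "a < kinds" "p < val x P" for a t p
    using that by (simp add: \<nu>_def var_id_def)
  have transfer: "clause_holds (\<lambda>a t p. \<nu> (var_id x a t p)) cl env"
    if holds: "clause_holds (truth x u) cl env" and range: "in_range x cl env" for cl env
  proof -
    obtain s a t p where l: "(s, a, t, p) \<in> set cl" "truth x u a (aval t env) (aval p env) = s"
      using holds by (auto simp: clause_holds_def)
    with range have "\<nu> (var_id x a (aval t env) (aval p env)) = s"
      by (subst \<nu>) (auto simp: in_range_def)
    with l(1) show ?thesis by (auto simp: clause_holds_def)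
  qed
  have "gen_all (clause_holds (\<lambda>a t p. \<nu> (var_id x a t p))) x run_gen 1 (initial_env (length x))"
    unfolding gen_all_def
  proof (intro ballI)
    fix y assume y: "y \<in> set (eval x run_gen 1 (initial_env (length x)))"
    obtain cl l env where y': "y = (cl, l, env)" by (cases y)
    have "clause_holds (truth x u) cl env" "in_range x cl env"
      using bspec[OF completeness[OF u, unfolded gen_all_def] y] bspec[OF in_range_run[unfolded gen_all_def] y]
      by (simp_all only: y' prod.case)
    then show "case y of (cl, l, env) \<Rightarrow> clause_holds (\<lambda>a t p. \<nu> (var_id x a t p)) cl env"
      unfolding y' prod.case by (rule transfer)
  qed
  then show "\<exists>\<nu>. sat \<nu> (set (cnf.clauses x))"
    unfolding sat_clauses_iff[symmetric] by (intro exI[of _ \<nu>])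
qed

theorem reduction:
  "\<exists>f. polytime f \<and> (\<forall>x. f x \<in> enc_instance ` rank_promise \<and>
     (f x \<in> enc_instance ` rank_yes \<longleftrightarrow> (\<exists>u. length u = val x mA \<and> accepts x u)))"
proof (intro exI conjI allI)
  show "polytime (\<lambda>x. produce x cnf.instance_gen 1 (initial_env (length x)))"
    by (rule cnf.polytime_instance)
  show "produce x cnf.instance_gen 1 (initial_env (length x)) \<in> enc_instance ` rank_promise" for x
    by (rule cnf.instance_promise)
  show "produce x cnf.instance_gen 1 (initial_env (length x)) \<in> enc_instance ` rank_yes \<longleftrightarrow>
      (\<exists>u. length u = val x mA \<and> accepts x u)" for x
    unfolding sat_iff_accepts[symmetric] by (rule cnf.instance_yes_iff) (rule clause_var_less)
qed

end

section \<open>Output of a halted verifier and the final reduction\<close>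

lemma step_halted: "(step M ^^ t) (nstates M, ts) = (nstates M, ts)"
  by (induction t) (simp_all add: step_def)

lemma halts_with_mono:
  assumes "halts_with M x t y" "t \<le> t'"
  shows "halts_with M x t' y"
proof -
  obtain ts where ts: "(step M ^^ t) (init_config M x) = (nstates M, ts)" "holds_string (ts ! 1) y"
    using assms(1) by (auto simp: halts_with_def split: prod.splits)
  have "(step M ^^ (t' - t + t)) (init_config M x) = (step M ^^ (t' - t)) ((step M ^^ t) (init_config M x))"
    unfolding funpow_add comp_apply ..
  then have "(step M ^^ t') (init_config M x) = (step M ^^ (t' - t)) ((step M ^^ t) (init_config M x))"
    using assms(2) by simp
  then show ?thesis using ts by (simp add: halts_with_def step_halted)
qed

text \<open>Bit symbols are not blank, so the tape determines the end of the string. Hence finding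
  \<open>[True]\<close> on the tape decides the value of the verifier.\<close>

lemma holds_string_inject:
  assumes "holds_string tp y" "holds_string tp z"
  shows "y = z"
proof -
  have *: "length z \<le> length y" if "holds_string tp y" "holds_string tp z" for y z
  proof (rule ccontr)
    assume "\<not> ?thesis"
    then have "fst tp (int (length y)) = bit_symbol (z ! length y)"
      using that(2) by (simp add: holds_string_def)
    with that(1) show False by (simp add: holds_string_def bit_symbol_def split: if_splits)
  qed
  then have len: "length y = length z" using assms by (simp add: le_antisym)
  show ?thesis
  proof (rule nth_equalityI[OF len])
    fix i assume "i < length y"
    then have "bit_symbol (y ! i) = bit_symbol (z ! i)"
      using assms len by (simp add: holds_string_def)
    then show "y ! i = z ! i" by (auto simp: bit_symbol_def split: if_splits)
  qed
qed

theorem theorem4p2: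
  shows "NP_hard_promise (enc_instance ` rank_promise) (enc_instance ` rank_yes)"
  unfolding NP_hard_promise_def
proof
  fix L assume "L \<in> NP"
  then obtain V and p :: "nat poly" where V: "polytime V"
    and L: "\<And>x. x \<in> L \<longleftrightarrow> (\<exists>u. length u = poly p (length x) \<and> V (pair x u) = [True])"
    unfolding NP_def by blast
  from V obtain M and q :: "nat poly" where M: "wf_tm M"
    and halts: "\<And>x. \<exists>t\<le>poly q (length x). halts_with M x t (V x)"
    unfolding polytime_def by blast
  obtain mA where mA: "avars mA \<subseteq> {0}" "\<And>env. aval mA env = poly p (env 0)"
    using poly_aexp[of p] by blast
  \<comment> \<open>The verifier runs on \<open>pair x u\<close>, whose length is
    \<open>2 * n + 2 + poly p n\<close>.\<close>
  have time: "poly (pcompose q ([:2, 2:] + p)) n = poly q (2 * n + 2 + poly p n)" for n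
    unfolding poly_pcompose by (rule arg_cong[of _ _ "poly q"]) simp
  obtain HA where HA: "avars HA \<subseteq> {0}" "\<And>env. aval HA env = poly q (2 * env 0 + 2 + poly p (env 0))"
    using poly_aexp[of "pcompose q ([:2, 2:] + p)"] unfolding time by blast
  interpret cook_levin M mA HA
    by unfold_locales (use M mA HA in auto)
  have val: "val x mA = poly p (length x)" "val x HA = poly q (2 * length x + 2 + poly p (length x))" for x
    by (simp_all add: val_def mA HA)
  have "accepts x u \<longleftrightarrow> V (pair x u) = [True]" if u: "length u = poly p (length x)" for x u
  proof -
    obtain t where t: "t \<le> poly q (length (pair x u))" "halts_with M (pair x u) t (V (pair x u))"
      using halts by blast
    from t(1) have "t \<le> val x HA" by (simp add: length_pair val u)
    from halts_with_mono[OF t(2) this] obtain ts where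
      "config_at x u (val x HA) = (nstates M, ts)" "holds_string (ts ! 1) (V (pair x u))"
      by (auto simp: halts_with_def config_at_def split: prod.splits)
    then show ?thesis
      using holds_string_inject[of "ts ! 1" "V (pair x u)" "[True]"] by (auto simp: accepts_def)
  qed
  then have "x \<in> L \<longleftrightarrow> (\<exists>u. length u = val x mA \<and> accepts x u)" for x
    unfolding L val by metis
  moreover from reduction obtain f where "polytime f" "\<And>x. f x \<in> enc_instance ` rank_promise"
    "\<And>x. f x \<in> enc_instance ` rank_yes \<longleftrightarrow> (\<exists>u. length u = val x mA \<and> accepts x u)"
    by blast
  ultimately show "\<exists>f. polytime f \<and> (\<forall>x. f x \<in> enc_instance ` rank_promise \<and>
      (x \<in> L \<longleftrightarrow> f x \<in> enc_instance ` rank_yes))"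
    by (intro exI[of _ f]) simp
qed

end
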